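(* Let $p\ge 1$ be an integer, let $\alpha,\beta\in\mathbb{R}$, and let $\bm\nu=(\nu_1,\nu_2,\nu_3)\in\mathbb{Q}^3$ have positive components. For $n\in\mathbb{N}$ with $n\bm\nu\in\mathbb{N}^3$, put $\bm n=(n_1,n_2,n_3)=(n\nu_1,n\nu_2,n\nu_3)$ and consider the matrix $\mathcal{A}^{p,\alpha,\beta}_{\bm n}$ of size $3(n_1+p-2)(n_2+p-2)(n_3+p-2)$ defined in the context. Then, as $n\to\infty$, $$\{n\,\mathcal{A}^{p,\alpha,\beta}_{\bm n}\}_{\bm n}\sim_\lambda (f^{p,\alpha,\beta},[-\pi,\pi]^3),$$ where $f^{p,\alpha,\beta}:[-\pi,\pi]^3\to\mathbb{C}^{3\times 3}$ is the matrix-valued function $f^{p,\alpha,\beta}=[f^{p,\alpha,\beta}_{i,j}]_{i,j=1}^3$ whose entries at $(\theta_1,\theta_2,\theta_3)$ are $$f_{1,1}^{p,\alpha,\beta}=\beta\gamma_1\mathfrak{s}_p(\theta_1)\mathfrak{m}_p(\theta_2)\mathfrak{m}_p(\theta_3)+\alpha\gamma_2\mathfrak{m}_p(\theta_1)\mathfrak{s}_p(\theta_2)\mathfrak{m}_p(\theta_3)+\alpha\gamma_3\mathfrak{m}_p(\theta_1)\mathfrak{m}_p(\theta_2)\mathfrak{s}_p(\theta_3),$$ $$f_{2,2}^{p,\alpha,\beta}=\alpha\gamma_1\mathfrak{s}_p(\theta_1)\mathfrak{m}_p(\theta_2)\mathfrak{m}_p(\theta_3)+\beta\gamma_2\mathfrak{m}_p(\theta_1)\mathfrak{s}_p(\theta_2)\mathfrak{m}_p(\theta_3)+\alpha\gamma_3\mathfrak{m}_p(\theta_1)\mathfrak{m}_p(\theta_2)\mathfrak{s}_p(\theta_3),$$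 $$f_{3,3}^{p,\alpha,\beta}=\alpha\gamma_1\mathfrak{s}_p(\theta_1)\mathfrak{m}_p(\theta_2)\mathfrak{m}_p(\theta_3)+\alpha\gamma_2\mathfrak{m}_p(\theta_1)\mathfrak{s}_p(\theta_2)\mathfrak{m}_p(\theta_3)+\beta\gamma_3\mathfrak{m}_p(\theta_1)\mathfrak{m}_p(\theta_2)\mathfrak{s}_p(\theta_3),$$ $$f_{1,2}^{p,\alpha,\beta}=f_{2,1}^{p,\alpha,\beta}=-(\alpha-\beta)\delta_3\,\mathfrak{a}_p(\theta_1)\mathfrak{a}_p(\theta_2)\mathfrak{m}_p(\theta_3),$$ $$f_{1,3}^{p,\alpha,\beta}=f_{3,1}^{p,\alpha,\beta}=-(\alpha-\beta)\delta_2\,\mathfrak{a}_p(\theta_1)\mathfrak{m}_p(\theta_2)\mathfrak{a}_p(\theta_3),$$ $$f_{2,3}^{p,\alpha,\beta}=f_{3,2}^{p,\alpha,\beta}=-(\alpha-\beta)\delta_1\,\mathfrak{m}_p(\theta_1)\mathfrak{a}_p(\theta_2)\mathfrak{a}_p(\theta_3),$$ with $\gamma_i=\dfrac{\nu_i^2}{\nu_1\nu_2\nu_3}$ and $\delta_i=\dfrac1{\nu_i}$ for $i=1,2,3$.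
   Context: **B-splines.** For integers $p\ge 0$, $n\ge 1$, consider the knots $\xi_1=\cdots=\xi_{p+1}=0<\xi_{p+2}<\cdots<\xi_{p+n}<1=\xi_{p+n+1}=\cdots=\xi_{2p+n+1}$ with $\xi_{i+p+1}=i/n$ for $i=0,\ldots,n$. For $1\le i\le n+2p$ let $N_i^0(x)=1$ if $x\in[\xi_i,\xi_{i+1})$ and $0$ otherwise. For $1\le k\le p$, $1\le i\le n+2p-k$, $$N_i^k(x)=\frac{x-\xi_i}{\xi_{i+k}-\xi_i}N_i^{k-1}(x)+\frac{\xi_{i+k+1}-x}{\xi_{i+k+1}-\xi_{i+1}}N_{i+1}^{k-1}(x),$$ where a fraction with zero denominator is taken to be zero. This gives the $n+p$ degree-$p$ B-splines $N_1^p,\ldots,N_{n+p}^p$ on $[0,1]$ (they depend on $n$). **Univariate matrices** (for $p\ge1$; all of size $n+p-2$, indices $i,j=1,\ldots,n+p-2$): $$(M^p_n)_{i,j}=\int_0^1 N^p_{i+1}N^p_{j+1}\,dx,\quad (A^p_n)_{i,j}=\int_0^1 N^p_{i+1}(N^p_{j+1})'\,dx,\quad (S^p_n)_{i,j}=\int_0^1 (N^p_{i+1})'(N^p_{j+1})'\,dx.$$ **3D curl-div matrix.** Write $M_l=M^p_{n_l}$, $A_l=A^p_{n_l}$, $S_l=S^p_{n_l}$ for $l=1,2,3$, and let $\otimes$ be the Kronecker product. Then $\mathcal{A}^{p,\alpha,\beta}_{\bm n}=\alpha\,\mathcal{C}+\beta\,\mathcal{D}$, where $$\mathcal{C}=\begin{bmatrix}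 M_1\otimes M_2\otimes S_3+M_1\otimes S_2\otimes M_3 & -A_1^T\otimes A_2\otimes M_3 & -A_1^T\otimes M_2\otimes A_3\\ -A_1\otimes A_2^T\otimes M_3 & S_1\otimes M_2\otimes M_3+M_1\otimes M_2\otimes S_3 & -M_1\otimes A_2^T\otimes A_3\\ -A_1\otimes M_2\otimes A_3^T & -M_1\otimes A_2\otimes A_3^T & S_1\otimes M_2\otimes M_3+M_1\otimes S_2\otimes M_3\end{bmatrix},$$ $$\mathcal{D}=\begin{bmatrix} S_1\otimes M_2\otimes M_3 & A_1\otimes A_2^T\otimes M_3 & A_1\otimes M_2\otimes A_3^T\\ A_1^T\otimes A_2\otimes M_3 & M_1\otimes S_2\otimes M_3 & M_1\otimes A_2\otimes A_3^T\\ A_1^T\otimes M_2\otimes A_3 & M_1\otimes A_2^T\otimes A_3 & M_1\otimes M_2\otimes S_3\end{bmatrix}.$$ **Cardinal B-splines.** $\phi_0(t)=1$ for $t\in[0,1)$ and $0$ otherwise; for $p\ge1$, $\phi_p(t)=\frac{t}{p}\phi_{p-1}(t)+\frac{p+1-t}{p}\phi_{p-1}(t-1)$. **Univariate symbols.** For $\theta\in[-\pi,\pi]$, $$\mathfrak{m}_p(\theta)=\phi_{2p+1}(p+1)+2\sum_{k=1}^p\phi_{2p+1}(p+1-k)\cos(k\theta),$$ $$\mathfrak{a}_p(\theta)=-2\sum_{k=1}^p\phi_{2p+1}'(p+1-k)\sin(k\theta),$$ $$\mathfrak{s}_p(\theta)=-\phi_{2p+1}''(p+1)-2\sum_{k=1}^p\phi_{2p+1}''(p+1-k)\cos(k\theta).$$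 **Spectral distribution.** Let $f:G\to\mathbb{C}^{s\times s}$ be measurable, $G\subset\mathbb{R}^q$ measurable with Lebesgue measure $0<\mu_q(G)<\infty$, and let $\{A_{\bm n}\}_{\bm n}$ be a sequence of square matrices of sizes $d_{\bm n}\to\infty$ as $\bm n\to\infty$ (all components tend to infinity). One writes $\{A_{\bm n}\}_{\bm n}\sim_\lambda(f,G)$ if for every continuous compactly supported $F:\mathbb{C}\to\mathbb{C}$, $$\lim_{\bm n\to\infty}\frac1{d_{\bm n}}\sum_{j=1}^{d_{\bm n}}F(\lambda_j(A_{\bm n}))=\frac1{\mu_q(G)}\int_G\frac{1}{s}\sum_{i=1}^sF(\lambda_i(f(\bm t)))\,d\bm t,$$ where $\lambda_j(\cdot)$ denote eigenvalues counted with multiplicity. *)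

theory Defs
  imports "HOL-Analysis.Analysis" "Jordan_Normal_Form.Char_Poly"
begin

text \<open>Indices of knots and of B-splines are 1-based.\<close>

definition knot :: "nat \<Rightarrow> nat \<Rightarrow> nat \<Rightarrow> real" where
  "knot p n i =
     (if i \<le> p + 1 then 0
      else if p + n + 1 \<le> i then 1
      else (real i - real p - 1) / real n)"

text \<open>\<open>bspline p n k i\<close> is the B-spline $N_i^k$ over the knots belonging to \<open>p\<close> and \<open>n\<close>.
  The convention that a fraction with zero denominator is zero is that of HOL division.\<close>

primrec bspline :: "nat \<Rightarrow> nat \<Rightarrow> nat \<Rightarrow> nat \<Rightarrow> real \<Rightarrow> real" where
  "bspline p n 0 i x = (if knot p n i \<le> x \<and> x < knot p n (i + 1) then 1 else 0)"
| "bspline p n (Suc k) i x =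
     (x - knot p n i) / (knot p n (i + Suc k) - knot p n i) * bspline p n k i x
   + (knot p n (i + Suc k + 1) - x) / (knot p n (i + Suc k + 1) - knot p n (i + 1))
       * bspline p n k (i + 1) x"

text \<open>Matrix indices are 0-based here, so entry \<open>(i, j)\<close> involves the B-splines with numbers
  \<open>i + 2\<close> and \<open>j + 2\<close>. The derivative \<open>deriv\<close> is unspecified at the finitely many points where
  a B-spline is not differentiable; these do not affect the integrals.\<close>

definition mass_mat :: "nat \<Rightarrow> nat \<Rightarrow> real mat" where
  "mass_mat p n = mat (n + p - 2) (n + p - 2) (\<lambda>(i, j).
     LINT x:{0..1}|lborel. bspline p n p (i + 2) x * bspline p n p (j + 2) x)"

definition adv_mat :: "nat \<Rightarrow> nat \<Rightarrow> real mat" where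
  "adv_mat p n = mat (n + p - 2) (n + p - 2) (\<lambda>(i, j).
     LINT x:{0..1}|lborel. bspline p n p (i + 2) x * deriv (bspline p n p (j + 2)) x)"

definition stiff_mat :: "nat \<Rightarrow> nat \<Rightarrow> real mat" where
  "stiff_mat p n = mat (n + p - 2) (n + p - 2) (\<lambda>(i, j).
     LINT x:{0..1}|lborel. deriv (bspline p n p (i + 2)) x * deriv (bspline p n p (j + 2)) x)"

definition kron :: "'a::times mat \<Rightarrow> 'a mat \<Rightarrow> 'a mat" (infixl \<open>\<otimes>\<^sub>K\<close> 72) where
  "A \<otimes>\<^sub>K B = mat (dim_row A * dim_row B) (dim_col A * dim_col B) (\<lambda>(i, j).
     A $$ (i div dim_row B, j div dim_col B) * B $$ (i mod dim_row B, j mod dim_col B))"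

definition block3_mat :: "nat \<Rightarrow> 'a mat list list \<Rightarrow> 'a mat" where
  "block3_mat d Bs = mat (3 * d) (3 * d) (\<lambda>(i, j).
     (Bs ! (i div d) ! (j div d)) $$ (i mod d, j mod d))"

definition curl_div_mat :: "nat \<Rightarrow> real \<Rightarrow> real \<Rightarrow> nat \<times> nat \<times> nat \<Rightarrow> real mat" where
  "curl_div_mat p \<alpha> \<beta> = (\<lambda>(n1, n2, n3).
     let d = (n1 + p - 2) * (n2 + p - 2) * (n3 + p - 2);
         M1 = mass_mat p n1; M2 = mass_mat p n2; M3 = mass_mat p n3;
         A1 = adv_mat p n1; A2 = adv_mat p n2; A3 = adv_mat p n3;
         S1 = stiff_mat p n1; S2 = stiff_mat p n2; S3 = stiff_mat p n3;
         T1 = transpose_mat A1; T2 = transpose_mat A2; T3 = transpose_mat A3;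
         C = block3_mat d
           [[M1 \<otimes>\<^sub>K M2 \<otimes>\<^sub>K S3 + M1 \<otimes>\<^sub>K S2 \<otimes>\<^sub>K M3, - (T1 \<otimes>\<^sub>K A2 \<otimes>\<^sub>K M3), - (T1 \<otimes>\<^sub>K M2 \<otimes>\<^sub>K A3)],
            [- (A1 \<otimes>\<^sub>K T2 \<otimes>\<^sub>K M3), S1 \<otimes>\<^sub>K M2 \<otimes>\<^sub>K M3 + M1 \<otimes>\<^sub>K M2 \<otimes>\<^sub>K S3, - (M1 \<otimes>\<^sub>K T2 \<otimes>\<^sub>K A3)],
            [- (A1 \<otimes>\<^sub>K M2 \<otimes>\<^sub>K T3), - (M1 \<otimes>\<^sub>K A2 \<otimes>\<^sub>K T3), S1 \<otimes>\<^sub>K M2 \<otimes>\<^sub>K M3 + M1 \<otimes>\<^sub>K S2 \<otimes>\<^sub>K M3]];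
         D = block3_mat d
           [[S1 \<otimes>\<^sub>K M2 \<otimes>\<^sub>K M3, A1 \<otimes>\<^sub>K T2 \<otimes>\<^sub>K M3, A1 \<otimes>\<^sub>K M2 \<otimes>\<^sub>K T3],
            [T1 \<otimes>\<^sub>K A2 \<otimes>\<^sub>K M3, M1 \<otimes>\<^sub>K S2 \<otimes>\<^sub>K M3, M1 \<otimes>\<^sub>K A2 \<otimes>\<^sub>K T3],
            [T1 \<otimes>\<^sub>K M2 \<otimes>\<^sub>K A3, M1 \<otimes>\<^sub>K T2 \<otimes>\<^sub>K A3, M1 \<otimes>\<^sub>K M2 \<otimes>\<^sub>K S3]]
     in \<alpha> \<cdot>\<^sub>m C + \<beta> \<cdot>\<^sub>m D)"

primrec cardinal_bspline :: "nat \<Rightarrow> real \<Rightarrow> real" where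
  "cardinal_bspline 0 t = (if 0 \<le> t \<and> t < 1 then 1 else 0)"
| "cardinal_bspline (Suc p) t =
     t / real (Suc p) * cardinal_bspline p t
   + (real (Suc p) + 1 - t) / real (Suc p) * cardinal_bspline p (t - 1)"

definition mass_symbol :: "nat \<Rightarrow> real \<Rightarrow> real" where
  "mass_symbol p \<theta> = cardinal_bspline (2 * p + 1) (real p + 1)
     + 2 * (\<Sum>k = 1..p. cardinal_bspline (2 * p + 1) (real p + 1 - real k) * cos (real k * \<theta>))"

definition adv_symbol :: "nat \<Rightarrow> real \<Rightarrow> real" where
  "adv_symbol p \<theta> =
     - 2 * (\<Sum>k = 1..p. deriv (cardinal_bspline (2 * p + 1)) (real p + 1 - real k)
                          * sin (real k * \<theta>))"

definition stiff_symbol :: "nat \<Rightarrow> real \<Rightarrow> real" where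
  "stiff_symbol p \<theta> = - (deriv ^^ 2) (cardinal_bspline (2 * p + 1)) (real p + 1)
     - 2 * (\<Sum>k = 1..p. (deriv ^^ 2) (cardinal_bspline (2 * p + 1)) (real p + 1 - real k)
                          * cos (real k * \<theta>))"

definition curl_div_symbol ::
  "nat \<Rightarrow> real \<Rightarrow> real \<Rightarrow> real \<times> real \<times> real \<Rightarrow> real \<times> real \<times> real \<Rightarrow> complex mat" where
  "curl_div_symbol p \<alpha> \<beta> = (\<lambda>(\<nu>1, \<nu>2, \<nu>3) (\<theta>1, \<theta>2, \<theta>3).
     let \<gamma>1 = \<nu>1\<^sup>2 / (\<nu>1 * \<nu>2 * \<nu>3); \<gamma>2 = \<nu>2\<^sup>2 / (\<nu>1 * \<nu>2 * \<nu>3); \<gamma>3 = \<nu>3\<^sup>2 / (\<nu>1 * \<nu>2 * \<nu>3);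
         \<delta>1 = 1 / \<nu>1; \<delta>2 = 1 / \<nu>2; \<delta>3 = 1 / \<nu>3;
         m = mass_symbol p; a = adv_symbol p; s = stiff_symbol p;
         smm = s \<theta>1 * m \<theta>2 * m \<theta>3; msm = m \<theta>1 * s \<theta>2 * m \<theta>3; mms = m \<theta>1 * m \<theta>2 * s \<theta>3;
         f11 = \<beta> * \<gamma>1 * smm + \<alpha> * \<gamma>2 * msm + \<alpha> * \<gamma>3 * mms;
         f22 = \<alpha> * \<gamma>1 * smm + \<beta> * \<gamma>2 * msm + \<alpha> * \<gamma>3 * mms;
         f33 = \<alpha> * \<gamma>1 * smm + \<alpha> * \<gamma>2 * msm + \<beta> * \<gamma>3 * mms;
         f12 = - (\<alpha> - \<beta>) * \<delta>3 * a \<theta>1 * a \<theta>2 * m \<theta>3;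
         f13 = - (\<alpha> - \<beta>) * \<delta>2 * a \<theta>1 * m \<theta>2 * a \<theta>3;
         f23 = - (\<alpha> - \<beta>) * \<delta>1 * m \<theta>1 * a \<theta>2 * a \<theta>3
     in map_mat complex_of_real
          (mat_of_rows_list 3 [[f11, f12, f13], [f12, f22, f23], [f13, f23, f33]]))"

text \<open>Eigenvalues are counted with algebraic multiplicity.\<close>

definition eigval_sum :: "(complex \<Rightarrow> complex) \<Rightarrow> complex mat \<Rightarrow> complex" where
  "eigval_sum F A = (\<Sum>z\<in>#proots (char_poly A). F z)"

text \<open>\<open>spectral_distribution \<F> A s f G\<close> states that the matrices \<open>A i\<close> are distributed, as \<open>i\<close>
  tends to infinity along the filter \<open>\<F>\<close> on the (multi-)index type, like the eigenvalues of the
  \<open>s\<close> by \<open>s\<close> matrix-valued function \<open>f\<close> on \<open>G\<close>. The standing assumptions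
  on \<open>f\<close>, \<open>G\<close> and \<open>A\<close> are part of the definition.\<close>

definition spectral_distribution ::
  "'i filter \<Rightarrow> ('i \<Rightarrow> complex mat) \<Rightarrow> nat \<Rightarrow> ('a::euclidean_space \<Rightarrow> complex mat) \<Rightarrow> 'a set \<Rightarrow> bool"
  where
  "spectral_distribution \<F> A s f G \<longleftrightarrow>
     G \<in> lmeasurable \<and> 0 < measure lebesgue G \<and>
     0 < s \<and> (\<forall>t\<in>G. f t \<in> carrier_mat s s) \<and>
     (\<forall>i<s. \<forall>j<s. (\<lambda>t. f t $$ (i, j)) \<in> borel_measurable (lebesgue_on G)) \<and>
     (\<forall>\<^sub>F i in \<F>. square_mat (A i)) \<and> filterlim (\<lambda>i. dim_row (A i)) at_top \<F> \<and>
     (\<forall>F. continuous_on UNIV F \<and> compact (closure {z. F z \<noteq> 0}) \<longrightarrow>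
       ((\<lambda>i. eigval_sum F (A i) / of_nat (dim_row (A i))) \<longlongrightarrow>
          (LINT t:G|lebesgue. eigval_sum F (f t) / of_nat s) / of_real (measure lebesgue G)) \<F>)"

end

theory Submission
  imports Defs "Jordan_Normal_Form.Schur_Decomposition"
begin

text \<open>The matrices are real symmetric, banded with respect to the grid positions of their indices, and
  uniformly bounded, so their eigenvalues stay in a fixed compact interval. By the Weierstrass
  approximation theorem it suffices to compare moments, that is, the traces of powers. Away from a
  boundary layer of fixed width the entries are those of a block Toeplitz matrix with the given symbol.
  Hence so are the entries of every power, the layer being enlarged by one bandwidth per factor, and a
  diagonal entry of the \<open>k\<close>-th power is the mean of the corresponding entry of the \<open>k\<close>-th power of the
  symbol. The boundary layer contains a vanishing proportion of the indices. The Toeplitz coefficients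
  come from the fact that correlations of cardinal B-splines are again cardinal B-splines; near the
  boundary only crude bounds on B-splines and their derivatives are needed.\<close>

section \<open>Eigenvalue sums and traces\<close>

text \<open>Real spectra are what makes moments sufficient: on a real interval polynomials in
  \<open>z\<close> alone are dense, whereas on a disc the conjugate of \<open>z\<close> would be
  needed as well, and traces of powers do not see it. Hermiticity of the symbol rests on a pairing:
  an advection factor has the imaginary symbol \<open>\<i> * adv_symbol\<close>, its transpose has
  the negative, and every off-diagonal block multiplies one of each kind, so the product is real.
  The factor \<open>n\<close> is a matter of scaling. Entries of mass, advection and stiffness
  matrices are of order \<open>1 / n\<close>, \<open>1\<close> and \<open>n\<close>, so every triple
  product in the curl-div matrix is of order \<open>1 / n\<close>; the ratios of the three grid
  sizes survive as the weights \<gamma> and \<delta>. Splines with repeated knots follow no Toeplitz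
  pattern. Of the entries that involve them only a uniform bound and the band structure are asked,
  and the predicate \<open>block_toeplitz_like\<close> therefore demands these two everywhere, but
  Toeplitz form only at a fixed depth.\<close>

definition mat_trace :: "'a::comm_monoid_add mat \<Rightarrow> 'a" where
  "mat_trace A = (\<Sum>i<dim_row A. A $$ (i, i))"

lemma index_mult_mat_sum:
  assumes "A \<in> carrier_mat n m" "B \<in> carrier_mat m l" "i < n" "j < l"
  shows "(A * B) $$ (i, j) = (\<Sum>k<m. A $$ (i, k) * B $$ (k, j))"
  using assms by (auto simp: scalar_prod_def atLeast0LessThan)

lemma mat_trace_mult_commute:
  fixes A :: "'a::comm_semiring_0 mat"
  assumes A: "A \<in> carrier_mat n m" and B: "B \<in> carrier_mat m n"
  shows "mat_trace (A * B) = mat_trace (B * A)"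
proof -
  have "mat_trace (A * B) = (\<Sum>i<n. \<Sum>k<m. A $$ (i, k) * B $$ (k, i))"
    using A by (simp add: mat_trace_def index_mult_mat_sum[OF A B])
  also have "\<dots> = (\<Sum>k<m. \<Sum>i<n. B $$ (k, i) * A $$ (i, k))"
    by (subst sum.swap) (simp add: mult.commute)
  also have "\<dots> = mat_trace (B * A)"
    using B by (simp add: mat_trace_def index_mult_mat_sum[OF B A])
  finally show ?thesis .
qed

lemma mat_trace_similar:
  fixes A :: "'a::comm_ring_1 mat"
  assumes "similar_mat_wit A B P Q"
  shows "mat_trace A = mat_trace B"
proof -
  define n where "n = dim_row A"
  have carr: "B \<in> carrier_mat n n" "P \<in> carrier_mat n n" "Q \<in> carrier_mat n n"
    and QP: "Q * P = 1\<^sub>m n" and A: "A = P * B * Q"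
    using similar_mat_witD[OF n_def assms] by blast+
  have "mat_trace A = mat_trace (P * (B * Q))"
    using A carr by (simp add: assoc_mult_mat[of P n n B n Q n])
  also have "\<dots> = mat_trace (B * Q * P)"
    using carr by (intro mat_trace_mult_commute[of _ n n]) auto
  also have "B * Q * P = B"
    using carr QP by (simp add: assoc_mult_mat[of B n n Q n P n])
  finally show ?thesis .
qed

lemma upper_triangular_pow_mat:
  fixes B :: "'a::comm_semiring_1 mat"
  assumes B: "B \<in> carrier_mat n n" and ut: "upper_triangular B"
  shows "upper_triangular (B ^\<^sub>m k) \<and> (\<forall>i<n. (B ^\<^sub>m k) $$ (i, i) = (B $$ (i, i)) ^ k)"
proof (induction k)
  case 0
  show ?case using B by auto
next
  case (Suc k)
  have Bk: "B ^\<^sub>m k \<in> carrier_mat n n" using B by simp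
  have z: "B $$ (i, j) = 0" "(B ^\<^sub>m k) $$ (i, j) = 0" if "i < n" "j < i" for i j
    using that ut Suc.IH B Bk unfolding upper_triangular_def by auto
  have "(B ^\<^sub>m Suc k) $$ (i, j) = 0" if "i < n" "j < i" for i j
  proof -
    have "(B ^\<^sub>m Suc k) $$ (i, j) = (\<Sum>l<n. (B ^\<^sub>m k) $$ (i, l) * B $$ (l, j))"
      using that by (simp add: index_mult_mat_sum[OF Bk B])
    also have "\<dots> = 0"
    proof (intro sum.neutral ballI)
      fix l assume "l \<in> {..<n}"
      then show "(B ^\<^sub>m k) $$ (i, l) * B $$ (l, j) = 0"
        using that z by (cases "l < i") auto
    qed
    finally show ?thesis .
  qed
  moreover have "(B ^\<^sub>m Suc k) $$ (i, i) = (B $$ (i, i)) ^ Suc k" if "i < n" for i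
  proof -
    have "(B ^\<^sub>m Suc k) $$ (i, i) = (\<Sum>l<n. (B ^\<^sub>m k) $$ (i, l) * B $$ (l, i))"
      using that by (simp add: index_mult_mat_sum[OF Bk B])
    also have "\<dots> = (\<Sum>l<n. if l = i then (B ^\<^sub>m k) $$ (i, i) * B $$ (i, i) else 0)"
    proof (intro sum.cong refl)
      fix l assume l: "l \<in> {..<n}"
      \<comment> \<open>For \<open>l < i\<close> the left factor vanishes, for \<open>i < l\<close>
        the right one, so only the diagonal term survives.\<close>
      consider "l < i" | "l = i" | "i < l" by linarith
      then show "(B ^\<^sub>m k) $$ (i, l) * B $$ (l, i)
          = (if l = i then (B ^\<^sub>m k) $$ (i, i) * B $$ (i, i) else 0)"
        using that z l by cases auto
    qed
    also have "\<dots> = (B $$ (i, i)) ^ Suc k"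
      using that Suc.IH by (simp add: mult.commute)
    finally show ?thesis .
  qed
  ultimately show ?case using B unfolding upper_triangular_def by auto
qed

text \<open>Over the complex numbers the characteristic polynomial splits, so the multiset of its
  roots comes from a list, the form in which the Schur decomposition takes the eigenvalues.\<close>

lemma proots_char_poly_complex:
  assumes "(A :: complex mat) \<in> carrier_mat n n"
  obtains as where "char_poly A = (\<Prod>a\<leftarrow>as. [:- a, 1:])" "length as = n"
    "proots (char_poly A) = mset as"
proof -
  obtain as where as: "char_poly A = (\<Prod>a\<leftarrow>as. [:- a, 1:])" "length as = n"
    using char_poly_factorized[OF assms] by blast
  have "proots (\<Prod>a\<leftarrow>as. [:- a, 1:]) = mset as"
  proof (induction as)
    case (Cons a as)
    have "(\<Prod>a\<leftarrow>as. [:- a, 1:]) \<noteq> 0" by (auto simp: prod_list_zero_iff)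
    then have "proots ([:- a, 1:] * (\<Prod>a\<leftarrow>as. [:- a, 1:])) = {#a#} + mset as"
      using Cons by (subst proots_mult) auto
    then show ?case by (simp del: mult_pCons_left)
  qed simp
  then show ?thesis using as that by simp
qed

lemma size_proots_char_poly:
  assumes "(A :: complex mat) \<in> carrier_mat n n"
  shows "size (proots (char_poly A)) = n"
  using proots_char_poly_complex[OF assms] by (metis size_mset)

text \<open>Schur triangularisation puts the listed roots on the diagonal of a similar upper
  triangular matrix; powers of that matrix have the powers of the roots on the diagonal, and
  similarity preserves the trace.\<close>

lemma eigval_sum_power:
  assumes A: "A \<in> carrier_mat n n"
  shows "eigval_sum (\<lambda>z. z ^ k) A = mat_trace (A ^\<^sub>m k)"
proof -
  obtain as where as: "char_poly A = (\<Prod>a\<leftarrow>as. [:- a, 1:])" "length as = n"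
    and roots: "proots (char_poly A) = mset as"
    using proots_char_poly_complex[OF A] by blast
  obtain B P Q where BPQ: "schur_decomposition A as = (B, P, Q)"
    using prod_cases3 by blast
  have sim: "similar_mat_wit A B P Q" and ut: "upper_triangular B" and diag: "diag_mat B = as"
    using schur_decomposition[OF A as(1) BPQ] by blast+
  have B: "B \<in> carrier_mat n n"
    using similar_mat_witD2[OF A sim] by blast
  have "mat_trace (A ^\<^sub>m k) = mat_trace (B ^\<^sub>m k)"
    by (rule mat_trace_similar[OF similar_mat_wit_pow[OF sim]])
  also have "\<dots> = (\<Sum>i<n. (B $$ (i, i)) ^ k)"
    using upper_triangular_pow_mat[OF B ut, of k] B by (simp add: mat_trace_def)
  also have "\<dots> = sum_list (map (\<lambda>z. z ^ k) as)"
    unfolding diag[symmetric] diag_mat_def using B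
    by (simp add: comp_def sum_list_sum_nth atLeast0LessThan)
  also have "\<dots> = eigval_sum (\<lambda>z. z ^ k) A"
    unfolding eigval_sum_def roots by (induction as) auto
  finally show ?thesis by (rule sym)
qed

lemma eigval_sum_diff: "eigval_sum (\<lambda>z. F z - H z) A = eigval_sum F A - eigval_sum H A"
proof -
  have "(\<Sum>z\<in>#M. F z - H z) = (\<Sum>z\<in>#M. F z) - (\<Sum>z\<in>#M. H z)" for M :: "complex multiset"
    by (induction M) auto
  then show ?thesis by (simp add: eigval_sum_def)
qed

lemma eigval_sum_poly:
  assumes A: "A \<in> carrier_mat n n"
  shows "eigval_sum (\<lambda>z. \<Sum>k\<le>m. c k * z ^ k) A = (\<Sum>k\<le>m. c k * mat_trace (A ^\<^sub>m k))"
proof -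
  have "(\<Sum>z\<in>#M. \<Sum>k\<le>m. c k * z ^ k) = (\<Sum>k\<le>m. c k * (\<Sum>z\<in>#M. z ^ k))" for M :: "complex multiset"
    by (induction M) (simp_all add: sum.distrib distrib_left)
  then show ?thesis
    unfolding eigval_sum_power[OF A, symmetric] eigval_sum_def by blast
qed

lemma norm_eigval_sum_le:
  assumes A: "A \<in> carrier_mat n n"
    and le: "\<And>z. z \<in># proots (char_poly A) \<Longrightarrow> norm (F z) \<le> e"
  shows "norm (eigval_sum F A) \<le> real n * e"
proof -
  have "norm (\<Sum>z\<in>#M. F z) \<le> real (size M) * e" if "\<And>z. z \<in># M \<Longrightarrow> norm (F z) \<le> e"
    for M :: "complex multiset"
    using that
  proof (induction M)
    case (add x M)
    have "norm (F x + (\<Sum>z\<in>#M. F z)) \<le> e + real (size M) * e"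
      using add by (intro norm_triangle_mono) auto
    then show ?case by (simp add: algebra_simps)
  qed simp
  from this[of "proots (char_poly A)"] show ?thesis
    using le size_proots_char_poly[OF A] by (simp add: eigval_sum_def)
qed

section \<open>Location of the eigenvalues of Hermitian matrices\<close>

definition hermitian_mat :: "complex mat \<Rightarrow> bool" where
  "hermitian_mat A \<longleftrightarrow> square_mat A \<and> (\<forall>i<dim_row A. \<forall>j<dim_row A. A $$ (j, i) = cnj (A $$ (i, j)))"

text \<open>Realness comes from the quadratic form at an eigenvector, which equals its own
  conjugate; the bound is the maximal row sum estimate. Columns appear in the hypothesis because the
  bound on powers uses column sums; for a Hermitian matrix they agree with the row sums.\<close>

lemma hermitian_eigenvalue:
  assumes A: "A \<in> carrier_mat n n" and herm: "hermitian_mat A"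
    and cols: "\<And>j. j < n \<Longrightarrow> (\<Sum>i<n. norm (A $$ (i, j))) \<le> R"
    and z: "z \<in># proots (char_poly A)"
  shows "z \<in> \<real>" "norm z \<le> R"
proof -
  have "char_poly A \<noteq> 0" using degree_monic_char_poly[OF A] by auto
  then have "poly (char_poly A) z = 0" using z by simp
  then have "eigenvalue A z" by (simp add: eigenvalue_root_char_poly[OF A])
  then obtain v where v: "v \<in> carrier_vec n" "v \<noteq> 0\<^sub>v n" and Av: "A *\<^sub>v v = z \<cdot>\<^sub>v v"
    using A unfolding eigenvalue_def eigenvector_def by auto
  have eq: "(\<Sum>j<n. A $$ (i, j) * v $ j) = z * v $ i" if "i < n" for i
  proof -
    have "(A *\<^sub>v v) $ i = (\<Sum>j<n. A $$ (i, j) * v $ j)"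
      using that A v by (auto simp: scalar_prod_def atLeast0LessThan)
    moreover have "(z \<cdot>\<^sub>v v) $ i = z * v $ i" using v that by simp
    ultimately show ?thesis using Av by metis
  qed
  have herm': "A $$ (j, i) = cnj (A $$ (i, j))" if "i < n" "j < n" for i j
    using herm[unfolded hermitian_mat_def] carrier_matD(1)[OF A] that by metis
  obtain i0 where i0: "i0 < n" "v $ i0 \<noteq> 0"
    using v by (metis carrier_vecD eq_vecI index_zero_vec(1) index_zero_vec(2))
  \<comment> \<open>Squared norm of the eigenvector, positive because of the coordinate
    \<open>i0\<close>.\<close>
  define s where "s = (\<Sum>i<n. cnj (v $ i) * v $ i)"
  have s_real: "s = of_real (\<Sum>i<n. (norm (v $ i))\<^sup>2)"
    unfolding s_def of_real_sum complex_norm_square by (simp add: mult.commute)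
  have "(\<Sum>i<n. (norm (v $ i))\<^sup>2) > 0"
    using i0 by (intro sum_pos2[of _ i0]) auto
  then have s0: "s \<noteq> 0" using s_real by (metis less_irrefl of_real_eq_0_iff)
  have q: "z * s = (\<Sum>i<n. \<Sum>j<n. cnj (v $ i) * A $$ (i, j) * v $ j)"
  proof -
    have "z * s = (\<Sum>i<n. cnj (v $ i) * (\<Sum>j<n. A $$ (i, j) * v $ j))"
      unfolding s_def sum_distrib_left[of z] by (intro sum.cong) (auto simp: eq mult.left_commute)
    then show ?thesis by (simp add: sum_distrib_left mult.assoc)
  qed
  also have "\<dots> = (\<Sum>j<n. \<Sum>i<n. cnj (v $ i) * A $$ (i, j) * v $ j)"
    by (rule sum.swap)
  also have "\<dots> = cnj (z * s)"
  proof -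
    have "cnj (v $ i) * A $$ (i, j) * v $ j = cnj (cnj (v $ j) * A $$ (j, i) * v $ i)"
      if "i < n" "j < n" for i j
      using herm'[OF that(2,1)] by (simp add: mult_ac)
    then show ?thesis unfolding q cnj_sum by (intro sum.cong refl) (metis lessThan_iff)
  qed
  also have "\<dots> = cnj z * s"
    by (simp add: s_real)
  finally have "cnj z = z" using s0 by simp
  then show "z \<in> \<real>" by (simp add: Reals_cnj_iff)
  \<comment> \<open>In the row of a coordinate of largest modulus, the eigenvalue equation gives
    \<open>norm z * m \<le> R * m\<close>.\<close>
  define m where "m = Max ((\<lambda>i. norm (v $ i)) ` {..<n})"
  have fin: "finite ((\<lambda>i. norm (v $ i)) ` {..<n})" "(\<lambda>i. norm (v $ i)) ` {..<n} \<noteq> {}"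
    using i0 by auto
  obtain i where i: "i < n" "m = norm (v $ i)"
    using Max_in[OF fin] unfolding m_def by auto
  have m: "norm (v $ j) \<le> m" if "j < n" for j
    unfolding m_def using fin that by (intro Max_ge) auto
  have m0: "m > 0" using m[OF i0(1)] i0 by (meson less_le_trans zero_less_norm_iff)
  have "norm z * m = norm (\<Sum>j<n. A $$ (i, j) * v $ j)"
    using eq[OF i(1)] i by (simp add: norm_mult)
  also have "\<dots> \<le> (\<Sum>j<n. norm (A $$ (i, j) * v $ j))" by (rule norm_sum)
  also have "\<dots> \<le> (\<Sum>j<n. norm (A $$ (j, i)) * m)"
  proof (intro sum_mono)
    fix j assume j: "j \<in> {..<n}"
    then have "norm (A $$ (i, j)) = norm (A $$ (j, i))" using herm'[OF i(1)] by simp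
    then show "norm (A $$ (i, j) * v $ j) \<le> norm (A $$ (j, i)) * m"
      using m j by (simp add: norm_mult mult_left_mono)
  qed
  also have "\<dots> \<le> R * m"
    unfolding sum_distrib_right[symmetric] using cols[OF i(1)] m0 by (intro mult_right_mono) auto
  finally show "norm z \<le> R" using m0 by simp
qed

section \<open>From moments to the spectral distribution\<close>

text \<open>Only real arguments count, so the Weierstrass theorem is applied to the real and the
  imaginary part on \<open>{-R..R}\<close>, each with half of the tolerance.\<close>

lemma complex_polynomial_approximation:
  fixes F :: "complex \<Rightarrow> complex"
  assumes cont: "continuous_on UNIV F" and e: "e > 0"
  obtains c :: "nat \<Rightarrow> complex" and m where
    "\<And>z. z \<in> \<real> \<Longrightarrow> norm z \<le> R \<Longrightarrow> norm (F z - (\<Sum>k\<le>m. c k * z ^ k)) \<le> e"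
proof -
  have cR: "continuous_on {-R..R} (\<lambda>x. F (complex_of_real x))"
    by (intro continuous_on_compose2[OF cont] continuous_intros) auto
  have *: "\<exists>(c::nat \<Rightarrow> real) m. \<forall>x\<in>{-R..R}. \<bar>g x - (\<Sum>k\<le>m. c k * x ^ k)\<bar> < e / 2"
    if "continuous_on {-R..R} g" for g :: "real \<Rightarrow> real"
  proof -
    obtain h where h: "real_polynomial_function h" "\<And>x. x \<in> {-R..R} \<Longrightarrow> \<bar>g x - h x\<bar> < e / 2"
      by (rule Stone_Weierstrass_real_polynomial_function[of "{-R..R}" g "e / 2"]) (use \<open>continuous_on {-R..R} g\<close> e in auto)
    obtain c m where "h = (\<lambda>x. \<Sum>k\<le>m. c k * x ^ k)"
      using h(1) unfolding real_polynomial_function_iff_sum by blast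
    with h(2) show ?thesis by blast
  qed
  obtain c1 m1 where 1: "\<forall>x\<in>{-R..R}. \<bar>Re (F (of_real x)) - (\<Sum>k\<le>m1. c1 k * x ^ k)\<bar> < e / 2"
    using *[OF continuous_on_Re[OF cR]] by blast
  obtain c2 m2 where 2: "\<forall>x\<in>{-R..R}. \<bar>Im (F (of_real x)) - (\<Sum>k\<le>m2. c2 k * x ^ k)\<bar> < e / 2"
    using *[OF continuous_on_Im[OF cR]] by blast
  \<comment> \<open>The two real polynomials may differ in degree; padding with zeros makes them the
    real and imaginary parts of one coefficient sequence.\<close>
  define c where "c k = Complex (if k \<le> m1 then c1 k else 0) (if k \<le> m2 then c2 k else 0)" for k
  define m where "m = max m1 m2"
  have "norm (F z - (\<Sum>k\<le>m. c k * z ^ k)) \<le> e" if z: "z \<in> \<real>" "norm z \<le> R" for z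
  proof -
    obtain x where x: "z = of_real x" using z(1) by (auto elim: Reals_cases)
    have xR: "x \<in> {-R..R}" using z(2) x by auto
    have pw: "(complex_of_real x) ^ k = of_real (x ^ k)" for k by simp
    have "Re (\<Sum>k\<le>m. c k * z ^ k) = (\<Sum>k\<le>m. if k \<le> m1 then c1 k * x ^ k else 0)"
      unfolding x pw by (auto simp: c_def intro!: sum.cong)
    also have "\<dots> = (\<Sum>k\<le>m1. c1 k * x ^ k)"
      by (rule sum.mono_neutral_cong_right) (auto simp: m_def)
    finally have re: "Re (\<Sum>k\<le>m. c k * z ^ k) = (\<Sum>k\<le>m1. c1 k * x ^ k)" .
    have "Im (\<Sum>k\<le>m. c k * z ^ k) = (\<Sum>k\<le>m. if k \<le> m2 then c2 k * x ^ k else 0)"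
      unfolding x pw by (auto simp: c_def intro!: sum.cong)
    also have "\<dots> = (\<Sum>k\<le>m2. c2 k * x ^ k)"
      by (rule sum.mono_neutral_cong_right) (auto simp: m_def)
    finally have im: "Im (\<Sum>k\<le>m. c k * z ^ k) = (\<Sum>k\<le>m2. c2 k * x ^ k)" .
    have "norm (F z - (\<Sum>k\<le>m. c k * z ^ k))
        \<le> \<bar>Re (F z - (\<Sum>k\<le>m. c k * z ^ k))\<bar> + \<bar>Im (F z - (\<Sum>k\<le>m. c k * z ^ k))\<bar>"
      by (rule cmod_le)
    also have "\<dots> \<le> e / 2 + e / 2"
      unfolding minus_complex.simps re im using 1 2 xR x by (intro add_mono) force+
    finally show ?thesis by simp
  qed
  then show ?thesis using that by blast
qed

text \<open>Serves to show that the sum of \<open>F\<close> over the eigenvalues of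
  \<open>f t\<close> is continuous in \<open>t\<close> without a continuous choice of eigenvalues:
  for polynomials the sum is a linear combination of traces of powers, and uniform limits stay
  continuous.\<close>

lemma continuous_on_uniform_approximation:
  fixes h :: "'a::topological_space \<Rightarrow> 'b::metric_space"
  assumes "\<And>e. e > 0 \<Longrightarrow> \<exists>g. continuous_on S g \<and> (\<forall>x\<in>S. dist (g x) (h x) \<le> e)"
  shows "continuous_on S h"
proof -
  have "\<forall>n. \<exists>g. continuous_on S g \<and> (\<forall>x\<in>S. dist (g x) (h x) \<le> 1 / real (Suc n))"
    using assms by simp
  then obtain g where g: "\<And>n. continuous_on S (g n)"
    "\<And>n x. x \<in> S \<Longrightarrow> dist (g n x) (h x) \<le> 1 / real (Suc n)" by metis
  have "uniform_limit S g h sequentially"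
  proof (rule uniform_limitI)
    fix e :: real assume "e > 0"
    then obtain N where N: "1 / real (Suc N) < e"
      using nat_approx_posE by metis
    have "\<forall>x\<in>S. dist (g n x) (h x) < e" if "n \<ge> N" for n
    proof
      fix x assume "x \<in> S"
      then have "dist (g n x) (h x) \<le> 1 / real (Suc n)" by (rule g)
      also have "\<dots> \<le> 1 / real (Suc N)" using that by (simp add: frac_le)
      finally show "dist (g n x) (h x) < e" using N by linarith
    qed
    then show "\<forall>\<^sub>F n in sequentially. \<forall>x\<in>S. dist (g n x) (h x) < e"
      using eventually_sequentially by blast
  qed
  then show ?thesis
    by (rule uniform_limit_theorem[rotated]) (auto simp: g)
qed

lemma continuous_on_index_pow_mat:
  fixes f :: "'a::topological_space \<Rightarrow> 'b::{real_normed_field} mat"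
  assumes carr: "\<And>t. t \<in> S \<Longrightarrow> f t \<in> carrier_mat s s"
    and cont: "\<And>i j. i < s \<Longrightarrow> j < s \<Longrightarrow> continuous_on S (\<lambda>t. f t $$ (i, j))"
    and ij: "i < s" "j < s"
  shows "continuous_on S (\<lambda>t. (f t ^\<^sub>m k) $$ (i, j))"
  using ij
proof (induction k arbitrary: i j)
  case 0
  have "continuous_on S (\<lambda>t. (f t ^\<^sub>m 0) $$ (i, j)) \<longleftrightarrow> continuous_on S (\<lambda>t. if i = j then (1::'b) else 0)"
    using 0 by (intro continuous_on_cong) (auto dest: carr)
  then show ?case by simp
next
  case (Suc k)
  have "continuous_on S (\<lambda>t. (f t ^\<^sub>m Suc k) $$ (i, j)) \<longleftrightarrow>
    continuous_on S (\<lambda>t. \<Sum>l<s. (f t ^\<^sub>m k) $$ (i, l) * f t $$ (l, j))"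
  proof (intro continuous_on_cong refl)
    fix t assume t: "t \<in> S"
    show "(f t ^\<^sub>m Suc k) $$ (i, j) = (\<Sum>l<s. (f t ^\<^sub>m k) $$ (i, l) * f t $$ (l, j))"
      using index_mult_mat_sum[of "f t ^\<^sub>m k" s s "f t" s i j] carr[OF t] Suc.prems by simp
  qed
  also have "\<dots>" using Suc cont by (auto intro!: continuous_intros)
  finally show ?case .
qed

lemma continuous_on_mat_trace_pow:
  fixes f :: "'a::topological_space \<Rightarrow> 'b::{real_normed_field} mat"
  assumes carr: "\<And>t. t \<in> S \<Longrightarrow> f t \<in> carrier_mat s s"
    and cont: "\<And>i j. i < s \<Longrightarrow> j < s \<Longrightarrow> continuous_on S (\<lambda>t. f t $$ (i, j))"
  shows "continuous_on S (\<lambda>t. mat_trace (f t ^\<^sub>m k))"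
proof -
  have "continuous_on S (\<lambda>t. mat_trace (f t ^\<^sub>m k)) \<longleftrightarrow>
    continuous_on S (\<lambda>t. \<Sum>i<s. (f t ^\<^sub>m k) $$ (i, i))"
    by (intro continuous_on_cong) (auto simp: mat_trace_def dest!: carr)
  then show ?thesis
    using continuous_on_index_pow_mat[OF carr cont] by (auto intro!: continuous_intros)
qed

text \<open>One radius \<open>R\<close> confines the spectra of the symbol and, eventually, of the
  matrices, so a single polynomial is close to \<open>F\<close> on all of them. Averages of that
  polynomial are linear combinations of moments.\<close>

lemma spectral_distribution_of_moments:
  fixes f :: "'a::euclidean_space \<Rightarrow> complex mat" and A :: "'i \<Rightarrow> complex mat"
  assumes box: "box a b \<noteq> {}" and s: "0 < s"
    and f_carrier: "\<And>t. t \<in> cbox a b \<Longrightarrow> f t \<in> carrier_mat s s"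
    and f_cont: "\<And>i j. i < s \<Longrightarrow> j < s \<Longrightarrow> continuous_on (cbox a b) (\<lambda>t. f t $$ (i, j))"
    and f_herm: "\<And>t. t \<in> cbox a b \<Longrightarrow> hermitian_mat (f t)"
    and f_bound: "\<And>t j. t \<in> cbox a b \<Longrightarrow> j < s \<Longrightarrow> (\<Sum>i<s. norm (f t $$ (i, j))) \<le> R"
    and A_herm: "\<forall>\<^sub>F n in \<F>. hermitian_mat (A n)"
    and A_bound: "\<forall>\<^sub>F n in \<F>. \<forall>j<dim_row (A n). (\<Sum>i<dim_row (A n). norm (A n $$ (i, j))) \<le> R"
    and dims: "filterlim (\<lambda>n. dim_row (A n)) at_top \<F>"
    and moments: "\<And>k. ((\<lambda>n. mat_trace (A n ^\<^sub>m k) / of_nat (dim_row (A n))) \<longlongrightarrow>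
      integral (cbox a b) (\<lambda>t. mat_trace (f t ^\<^sub>m k)) / (of_nat s * of_real (measure lborel (cbox a b)))) \<F>"
  shows "spectral_distribution \<F> A s f (cbox a b)"
proof -
  let ?G = "cbox a b"
  have content: "measure lborel ?G > 0" using box by (simp add: content_pos_lt_eq box_ne_empty)
  have trace_cont: "continuous_on ?G (\<lambda>t. mat_trace (f t ^\<^sub>m k))" for k
    by (rule continuous_on_mat_trace_pow[OF f_carrier f_cont])
  have "((\<lambda>n. eigval_sum F (A n) / of_nat (dim_row (A n))) \<longlongrightarrow>
      (LINT t:?G|lebesgue. eigval_sum F (f t) / of_nat s) / of_real (measure lebesgue ?G)) \<F>"
    if F: "continuous_on UNIV F" for F :: "complex \<Rightarrow> complex"
  proof -
    let ?P = "\<lambda>c m z. \<Sum>k\<le>m. c k * z ^ k :: complex"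
    have poly_cont: "continuous_on ?G (\<lambda>t. eigval_sum (?P c m) (f t))" for c m
    proof -
      have "continuous_on ?G (\<lambda>t. eigval_sum (?P c m) (f t)) \<longleftrightarrow>
        continuous_on ?G (\<lambda>t. \<Sum>k\<le>m. c k * mat_trace (f t ^\<^sub>m k))"
        by (intro continuous_on_cong refl eigval_sum_poly[OF f_carrier])
      then show ?thesis by (auto intro!: continuous_intros trace_cont)
    qed
    have f_approx: "norm (eigval_sum F (f t) - eigval_sum (?P c m) (f t)) \<le> real s * e"
      if "t \<in> ?G" "\<And>z. z \<in> \<real> \<Longrightarrow> norm z \<le> R \<Longrightarrow> norm (F z - ?P c m z) \<le> e" for t c m e
      unfolding eigval_sum_diff[symmetric]
      using that hermitian_eigenvalue[OF f_carrier f_herm f_bound]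
      by (intro norm_eigval_sum_le f_carrier) auto
    have A_approx: "\<forall>\<^sub>F n in \<F>. norm (eigval_sum F (A n) - eigval_sum (?P c m) (A n)) \<le> real (dim_row (A n)) * e"
      if "\<And>z. z \<in> \<real> \<Longrightarrow> norm z \<le> R \<Longrightarrow> norm (F z - ?P c m z) \<le> e" for c m e
      using A_herm A_bound
    proof eventually_elim
      case (elim n)
      have An: "A n \<in> carrier_mat (dim_row (A n)) (dim_row (A n))"
        using elim(1) by (auto simp: hermitian_mat_def)
      show ?case
        unfolding eigval_sum_diff[symmetric]
        using that hermitian_eigenvalue[OF An elim(1)] elim(2)
        by (intro norm_eigval_sum_le An) blast
    qed
    have F_cont: "continuous_on ?G (\<lambda>t. eigval_sum F (f t))"
    proof (rule continuous_on_uniform_approximation)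
      fix e :: real assume "e > 0"
      then obtain c m where "\<And>z. z \<in> \<real> \<Longrightarrow> norm z \<le> R \<Longrightarrow> norm (F z - ?P c m z) \<le> e / real s"
        using complex_polynomial_approximation[OF F, of "e / real s" R] s by auto
      from f_approx[OF _ this] s
      show "\<exists>g. continuous_on ?G g \<and> (\<forall>t\<in>?G. dist (g t) (eigval_sum F (f t)) \<le> e)"
        by (intro exI[of _ "\<lambda>t. eigval_sum (?P c m) (f t)"])
          (auto simp: poly_cont dist_norm norm_minus_commute)
    qed
    define V where "V = real s * measure lborel ?G"
    have V: "V > 0" using content s by (simp add: V_def)
    \<comment> \<open>Continuity on the compact box identifies the Lebesgue integral with the gauge
      integral in which the moments are stated.\<close>
    have lim: "(LINT t:?G|lebesgue. eigval_sum F (f t) / of_nat s) / of_real (measure lebesgue ?G)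
        = integral ?G (\<lambda>t. eigval_sum F (f t)) / of_real V"
    proof -
      have "(LINT t:?G|lebesgue. eigval_sum F (f t) / of_nat s)
          = integral ?G (\<lambda>t. eigval_sum F (f t) / of_nat s)"
        by (intro set_lebesgue_integral_eq_integral absolutely_integrable_continuous
            continuous_intros F_cont) (use s in auto)
      then show ?thesis using s by (simp add: V_def integral_divide)
    qed
    have "((\<lambda>n. eigval_sum F (A n) / of_nat (dim_row (A n))) \<longlongrightarrow>
        integral ?G (\<lambda>t. eigval_sum F (f t)) / of_real V) \<F>"
    proof (rule tendstoI)
      fix e :: real assume e: "e > 0"
      \<comment> \<open>Three errors of at most \<open>e / 4\<close> each: replacing
        \<open>F\<close> in the matrix average, convergence of the moments, replacing
        \<open>F\<close> in the integral.\<close>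
      then obtain c m where approx: "\<And>z. z \<in> \<real> \<Longrightarrow> norm z \<le> R \<Longrightarrow> norm (F z - ?P c m z) \<le> e / 4"
        using complex_polynomial_approximation[OF F, of "e / 4" R] by auto
      define I where "I H = integral ?G (\<lambda>t. eigval_sum H (f t)) / of_real V" for H
      define S where "S H n = eigval_sum H (A n) / of_nat (dim_row (A n))" for H n
      have I_diff: "norm (I F - I (?P c m)) \<le> e / 4"
      proof -
        have int: "(\<lambda>t. eigval_sum F (f t)) integrable_on ?G" "(\<lambda>t. eigval_sum (?P c m) (f t)) integrable_on ?G"
          by (auto intro!: integrable_continuous F_cont poly_cont)
        have "norm (integral ?G (\<lambda>t. eigval_sum F (f t) - eigval_sum (?P c m) (f t)))
            \<le> integral ?G (\<lambda>t. real s * (e / 4))"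
          using f_approx[OF _ approx]
          by (intro integral_norm_bound_integral integrable_diff int) auto
        then have "norm (integral ?G (\<lambda>t. eigval_sum F (f t)) - integral ?G (\<lambda>t. eigval_sum (?P c m) (f t)))
            \<le> V * (e / 4)"
          by (simp add: integral_diff int V_def mult_ac)
        then show ?thesis
          using V by (simp add: I_def norm_divide pos_divide_le_eq mult.commute flip: diff_divide_distrib)
      qed
      have "((\<lambda>n. \<Sum>k\<le>m. c k * (mat_trace (A n ^\<^sub>m k) / of_nat (dim_row (A n)))) \<longlongrightarrow>
        (\<Sum>k\<le>m. c k * (integral ?G (\<lambda>t. mat_trace (f t ^\<^sub>m k)) / of_real V))) \<F>"
        using moments by (intro tendsto_sum tendsto_mult_left) (simp add: V_def)
      also have "(\<Sum>k\<le>m. c k * (integral ?G (\<lambda>t. mat_trace (f t ^\<^sub>m k)) / of_real V)) = I (?P c m)"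
      proof -
        have "integral ?G (\<lambda>t. eigval_sum (?P c m) (f t))
            = integral ?G (\<lambda>t. \<Sum>k\<le>m. c k * mat_trace (f t ^\<^sub>m k))"
          by (intro integral_cong eigval_sum_poly[OF f_carrier])
        also have "\<dots> = (\<Sum>k\<le>m. c k * integral ?G (\<lambda>t. mat_trace (f t ^\<^sub>m k)))"
          by (subst integral_sum) (auto intro!: integrable_continuous continuous_intros trace_cont)
        finally show ?thesis by (simp add: I_def sum_divide_distrib)
      qed
      finally have "\<forall>\<^sub>F n in \<F>. dist (\<Sum>k\<le>m. c k * (mat_trace (A n ^\<^sub>m k) / of_nat (dim_row (A n)))) (I (?P c m)) < e / 4"
        by (rule tendstoD) (use e in simp)
      moreover have "\<forall>\<^sub>F n in \<F>. norm (eigval_sum F (A n) - eigval_sum (?P c m) (A n))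
          \<le> real (dim_row (A n)) * (e / 4)"
        by (rule A_approx) (rule approx)
      ultimately have "\<forall>\<^sub>F n in \<F>. dist (S F n) (I F) < e"
        using A_herm
      proof eventually_elim
        case (elim n)
        have An: "A n \<in> carrier_mat (dim_row (A n)) (dim_row (A n))"
          using elim(3) by (auto simp: hermitian_mat_def)
        have S: "S (?P c m) n = (\<Sum>k\<le>m. c k * (mat_trace (A n ^\<^sub>m k) / of_nat (dim_row (A n))))"
          unfolding S_def eigval_sum_poly[OF An] by (simp add: sum_divide_distrib)
        have "norm (S F n - S (?P c m) n) \<le> e / 4"
        \<comment> \<open>For an empty matrix both averages are \<open>0\<close>, by division by
          zero.\<close>
        proof (cases "dim_row (A n) = 0")
          case False
          have "S F n - S (?P c m) n = (eigval_sum F (A n) - eigval_sum (?P c m) (A n)) / of_nat (dim_row (A n))"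
            by (simp add: S_def diff_divide_distrib)
          then show ?thesis using elim(2) False
            by (simp add: norm_divide pos_divide_le_eq mult.commute)
        qed (use e in \<open>simp add: S_def\<close>)
        moreover have "norm (S (?P c m) n - I (?P c m)) < e / 4"
          using elim(1) S by (simp add: dist_norm)
        ultimately have "norm ((S F n - S (?P c m) n) + (S (?P c m) n - I (?P c m)) - (I F - I (?P c m))) < e"
          using I_diff e by norm
        then show ?case by (simp add: dist_norm)
      qed
      then show "\<forall>\<^sub>F n in \<F>. dist (eigval_sum F (A n) / of_nat (dim_row (A n)))
          (integral ?G (\<lambda>t. eigval_sum F (f t)) / of_real V) < e"
        by (simp add: S_def I_def)
    qed
    then show ?thesis unfolding lim .
  qed
  moreover have "(\<lambda>t. f t $$ (i, j)) \<in> borel_measurable (lebesgue_on ?G)" if "i < s" "j < s" for i j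
    using f_cont[OF that] by (intro continuous_imp_measurable_on_sets_lebesgue) auto
  moreover have "\<forall>\<^sub>F n in \<F>. square_mat (A n)"
    using A_herm by eventually_elim (simp add: hermitian_mat_def)
  ultimately show ?thesis
    unfolding spectral_distribution_def using s f_carrier dims content by auto
qed

section \<open>Fourier characters and grids\<close>

text \<open>The characters of the three-dimensional torus, written as products so that integrals
  over the cube and symbols of tensor products factorise.\<close>

definition fourier_char :: "int \<times> int \<times> int \<Rightarrow> real \<times> real \<times> real \<Rightarrow> complex" where
  "fourier_char = (\<lambda>(u1, u2, u3) (\<theta>1, \<theta>2, \<theta>3).
     cis (of_int u1 * \<theta>1) * cis (of_int u2 * \<theta>2) * cis (of_int u3 * \<theta>3))"

lemma fourier_char_add: "fourier_char (u + v) \<theta> = fourier_char u \<theta> * fourier_char v \<theta>"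
  by (cases u; cases v; cases \<theta>) (simp add: fourier_char_def distrib_right flip: cis_mult)

lemma fourier_char_0: "fourier_char 0 \<theta> = 1"
  by (cases \<theta>) (simp add: fourier_char_def zero_prod_def)

lemma norm_fourier_char: "norm (fourier_char u \<theta>) = 1"
  by (cases u; cases \<theta>) (simp add: fourier_char_def norm_mult)

lemma continuous_on_fourier_char [continuous_intros]: "continuous_on S (fourier_char u)"
  unfolding fourier_char_def split_beta by (intro continuous_intros)

abbreviation theta_cube :: "(real \<times> real \<times> real) set" where
  "theta_cube \<equiv> cbox (-pi, -pi, -pi) (pi, pi, pi)"

text \<open>For \<open>k \<noteq> 0\<close> the antiderivative takes the same value at both ends,
  which differ by a multiple of the period.\<close>

lemma integral_cis: "integral {-pi..pi} (\<lambda>x. cis (of_int k * x)) = (if k = 0 then 2 * of_real pi else 0)"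
proof (cases "k = 0")
  case False
  let ?F = "\<lambda>x. cis (of_int k * x) / (\<i> * of_int k)"
  have "((\<lambda>x. cis (of_int k * x)) has_integral ?F pi - ?F (-pi)) {-pi..pi}"
  proof (rule fundamental_theorem_of_calculus)
    fix x :: real assume "x \<in> {-pi..pi}"
    have "((\<lambda>x. cis (of_int k * x)) has_vector_derivative of_int k *\<^sub>R (\<i> * cis (of_int k * x))) (at x within {-pi..pi})"
      by (auto intro!: derivative_eq_intros simp: has_vector_derivative_def fun_eq_iff scaleR_conv_of_real)
    then have "(?F has_vector_derivative (of_int k *\<^sub>R (\<i> * cis (of_int k * x))) / (\<i> * of_int k)) (at x within {-pi..pi})"
      by (rule has_vector_derivative_divide)
    then show "(?F has_vector_derivative cis (of_int k * x)) (at x within {-pi..pi})"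
      using False by (simp add: scaleR_conv_of_real)
  qed simp
  moreover have "cis (of_int k * pi) = cis (of_int k * (-pi))"
  proof -
    have "cis (of_int k * pi) = cis (of_int k * (-pi)) * cis (2 * pi * of_int k)"
      by (simp add: cis_mult algebra_simps)
    then show ?thesis by (simp add: cis_multiple_2pi)
  qed
  ultimately show ?thesis using False by (simp add: integral_unique)
qed (simp add: scaleR_conv_of_real)

text \<open>Fubini, applied twice, splits the integral into one factor per coordinate. This settles
  the zeroth power of the symbol, where the induction on powers starts.\<close>

lemma integral_fourier_char:
  "integral theta_cube (fourier_char u) = (if u = 0 then of_real ((2 * pi) ^ 3) else 0)"
proof -
  obtain u1 u2 u3 where u: "u = (u1, u2, u3)" by (cases u)
  let ?c = "\<lambda>k x. cis (of_int k * x)"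
  have "integral theta_cube (fourier_char u) = integral (cbox (-pi) pi) (\<lambda>x.
      integral (cbox (-pi, -pi) (pi, pi)) (\<lambda>y. fourier_char u (x, y)))"
    by (intro integral_prod_continuous continuous_intros)
  also have "\<dots> = integral (cbox (-pi) pi) (\<lambda>x. integral (cbox (-pi) pi) (\<lambda>y.
      integral (cbox (-pi) pi) (\<lambda>z. ?c u1 x * ?c u2 y * ?c u3 z)))"
  proof (intro integral_cong)
    fix x :: real
    have "integral (cbox (-pi, -pi) (pi, pi)) (\<lambda>y. fourier_char u (x, y))
        = integral (cbox (-pi) pi) (\<lambda>y. integral (cbox (-pi) pi) (\<lambda>z. fourier_char u (x, y, z)))"
      by (intro integral_prod_continuous continuous_on_compose2[OF continuous_on_fourier_char[of UNIV]]
          continuous_intros) auto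
    then show "integral (cbox (-pi, -pi) (pi, pi)) (\<lambda>y. fourier_char u (x, y))
        = integral (cbox (-pi) pi) (\<lambda>y. integral (cbox (-pi) pi) (\<lambda>z. ?c u1 x * ?c u2 y * ?c u3 z))"
      by (simp add: fourier_char_def u)
  qed
  also have "\<dots> = integral {-pi..pi} (?c u1) * integral {-pi..pi} (?c u2) * integral {-pi..pi} (?c u3)"
    by (simp add: mult.assoc)
  also have "\<dots> = (if u = 0 then of_real ((2 * pi) ^ 3) else 0)"
    unfolding integral_cis by (auto simp: u zero_prod_def power3_eq_cube)
  finally show ?thesis .
qed

section \<open>Three-dimensional grids and their boundary layers\<close>

definition offset_box :: "nat \<Rightarrow> (int \<times> int \<times> int) set" where
  "offset_box r = {- int r..int r} \<times> {- int r..int r} \<times> {- int r..int r}"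

text \<open>Points at least \<open>q\<close> steps inside every face; \<open>q = 0\<close> gives the
  whole grid. With integer bounds the set is empty when a side is no longer than two layers, and
  positions can be subtracted freely.\<close>

definition deep_grid :: "nat \<Rightarrow> nat \<Rightarrow> nat \<Rightarrow> nat \<Rightarrow> (int \<times> int \<times> int) set" where
  "deep_grid d1 d2 d3 q = {int q..<int d1 - int q} \<times> {int q..<int d2 - int q} \<times> {int q..<int d3 - int q}"

lemma finite_offset_box [simp]: "finite (offset_box r)"
  and card_offset_box: "card (offset_box r) = (2 * r + 1) ^ 3"
  by (auto simp: offset_box_def card_cartesian_product power3_eq_cube nat_add_distrib nat_mult_distrib)

lemma finite_deep_grid [simp]: "finite (deep_grid d1 d2 d3 q)"
  by (simp add: deep_grid_def)

lemma card_grid: "card (deep_grid d1 d2 d3 0) = d1 * d2 * d3"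
  by (simp add: deep_grid_def card_cartesian_product)

lemma deep_grid_add_offset:
  "y \<in> deep_grid d1 d2 d3 (q + r) \<Longrightarrow> u \<in> offset_box r \<Longrightarrow> y + u \<in> deep_grid d1 d2 d3 q"
  by (auto simp: deep_grid_def offset_box_def)

lemma deep_grid_antimono: "q \<le> q' \<Longrightarrow> deep_grid d1 d2 d3 q' \<subseteq> deep_grid d1 d2 d3 q"
  by (auto simp: deep_grid_def)

text \<open>A point that is not deep lies within \<open>q\<close> of one of two opposite faces in
  some direction. The count is quadratic in the sides, the grid itself is cubic.\<close>

lemma card_shallow_grid:
  "card (deep_grid d1 d2 d3 0 - deep_grid d1 d2 d3 q) \<le> 2 * q * (d2 * d3 + d1 * d3 + d1 * d2)"
proof -
  define E :: "nat \<Rightarrow> int set" where "E d = {0..<int q} \<union> {int d - int q..<int d}" for d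
  define G :: "nat \<Rightarrow> int set" where "G d = {0..<int d}" for d
  have E: "card (E d) \<le> 2 * q" "finite (E d)" for d
    unfolding E_def by (rule order_trans[OF card_Un_le]) auto
  have G: "card (G d) = d" "finite (G d)" for d by (auto simp: G_def)
  have "deep_grid d1 d2 d3 0 - deep_grid d1 d2 d3 q
      \<subseteq> (E d1 \<times> G d2 \<times> G d3 \<union> G d1 \<times> E d2 \<times> G d3) \<union> G d1 \<times> G d2 \<times> E d3" (is "_ \<subseteq> ?U")
    by (auto simp: deep_grid_def E_def G_def)
  then have "card (deep_grid d1 d2 d3 0 - deep_grid d1 d2 d3 q) \<le> card ?U"
    by (intro card_mono) (auto simp: E G)
  also have "\<dots> \<le> card (E d1) * (d2 * d3) + d1 * (card (E d2) * d3) + d1 * (d2 * card (E d3))"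
    by (intro order_trans[OF card_Un_le] add_mono) (auto simp: card_cartesian_product G)
  also have "\<dots> \<le> (2 * q) * (d2 * d3) + d1 * ((2 * q) * d3) + d1 * (d2 * (2 * q))"
    by (intro add_mono mult_mono E) auto
  finally show ?thesis by (simp add: algebra_simps)
qed

text \<open>Row and column \<open>i\<close> of a block matrix of the kind considered here is addressed by the number
  \<open>blk\<close> of its block and by a point \<open>pos\<close> of a three-dimensional grid, in which the third
  coordinate runs fastest.\<close>

definition blk :: "nat \<Rightarrow> nat \<Rightarrow> nat \<Rightarrow> nat \<Rightarrow> nat" where
  "blk d1 d2 d3 i = i div (d1 * d2 * d3)"

definition pos :: "nat \<Rightarrow> nat \<Rightarrow> nat \<Rightarrow> nat \<Rightarrow> int \<times> int \<times> int" where
  "pos d1 d2 d3 i = (let l = i mod (d1 * d2 * d3) in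
     (int (l div d3 div d2), int (l div d3 mod d2), int (l mod d3)))"

lemma bij_betw_div_mod:
  "bij_betw (\<lambda>i. (i div n, i mod n)) {..<m * n} ({..<m} \<times> {..<n::nat})"
proof (rule bij_betwI[where g = "\<lambda>(a, b). a * n + b"])
  show "(\<lambda>(a, b). a * n + b) \<in> {..<m} \<times> {..<n} \<rightarrow> {..<m * n}"
  proof clarsimp
    fix a b assume "a < m" "b < n"
    then have "a * n + b < (a + 1) * n" by simp
    moreover have "(a + 1) * n \<le> m * n" using \<open>a < m\<close> by (intro mult_le_mono1) simp
    ultimately show "a * n + b < m * n" by linarith
  qed
qed (auto simp: less_mult_imp_div_less, metis mod_less_divisor mult_0_right not_less_zero gr0I)

text \<open>Divisions with remainder by \<open>d1 * d2 * d3\<close>, then \<open>d3\<close>, then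
  \<open>d2\<close>. This order mirrors the block matrix and the Kronecker product nested to the
  left, so block and tensor factors can be read off from an index.\<close>

lemma bij_betw_blk_pos:
  "bij_betw (\<lambda>i. (blk d1 d2 d3 i, pos d1 d2 d3 i)) {..<s * (d1 * d2 * d3)} ({..<s} \<times> deep_grid d1 d2 d3 0)"
proof -
  let ?n = "d1 * d2 * d3"
  let ?dm = "\<lambda>n i. (i div n, i mod n :: nat)"
  have int: "bij_betw int {..<d} {0..<int d}" for d
    by (rule bij_betwI[where g = nat]) auto
  have "bij_betw (map_prod int (map_prod int int)) ({..<d1} \<times> {..<d2} \<times> {..<d3}) (deep_grid d1 d2 d3 0)"
    unfolding deep_grid_def by (auto intro!: bij_betw_map_prod int)
  moreover have "bij_betw (\<lambda>((a, b), c). (a, b, c)) (({..<d1} \<times> {..<d2}) \<times> {..<d3}) ({..<d1} \<times> {..<d2} \<times> {..<d3})"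
    by (rule bij_betwI[where g = "\<lambda>(a, b, c). ((a, b), c)"]) auto
  moreover have "bij_betw (map_prod (?dm d2) id) ({..<d1 * d2} \<times> {..<d3}) (({..<d1} \<times> {..<d2}) \<times> {..<d3})"
    by (intro bij_betw_map_prod bij_betw_div_mod bij_betw_id)
  moreover have "bij_betw (?dm d3) {..<d1 * d2 * d3} ({..<d1 * d2} \<times> {..<d3})"
    by (rule bij_betw_div_mod)
  ultimately have "bij_betw (map_prod int (map_prod int int) \<circ> ((\<lambda>((a, b), c). (a, b, c)) \<circ>
      (map_prod (?dm d2) id \<circ> ?dm d3))) {..<?n} (deep_grid d1 d2 d3 0)"
    by (intro bij_betw_trans)
  then have "bij_betw (map_prod id (map_prod int (map_prod int int) \<circ> ((\<lambda>((a, b), c). (a, b, c)) \<circ>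
      (map_prod (?dm d2) id \<circ> ?dm d3)))) ({..<s} \<times> {..<?n}) ({..<s} \<times> deep_grid d1 d2 d3 0)"
    by (intro bij_betw_map_prod bij_betw_id)
  from bij_betw_trans[OF bij_betw_div_mod this]
  show ?thesis
    by (rule iffD1[OF bij_betw_cong, rotated]) (simp add: blk_def pos_def Let_def)
qed

section \<open>Block Toeplitz-like matrices\<close>

lemma sum_blk_pos:
  fixes h :: "nat \<Rightarrow> int \<times> int \<times> int \<Rightarrow> 'a::comm_monoid_add"
  shows "(\<Sum>i<s * (d1 * d2 * d3). h (blk d1 d2 d3 i) (pos d1 d2 d3 i))
    = (\<Sum>c<s. \<Sum>z\<in>deep_grid d1 d2 d3 0. h c z)"
  using sum.reindex_bij_betw[OF bij_betw_blk_pos[of d1 d2 d3 s], of "\<lambda>(c, z). h c z"]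
  by (simp add: sum.cartesian_product)

lemma blk_less: "i < s * (d1 * d2 * d3) \<Longrightarrow> blk d1 d2 d3 i < s"
  by (simp add: blk_def less_mult_imp_div_less)

lemma pos_in_grid: "i < s * (d1 * d2 * d3) \<Longrightarrow> pos d1 d2 d3 i \<in> deep_grid d1 d2 d3 0"
  using bij_betwE[OF bij_betw_blk_pos[of d1 d2 d3 s]] by auto

text \<open>\<open>r\<close> is the bandwidth, \<open>q\<close> the thickness of the boundary layer,
  \<open>K\<close> a bound on all entries and \<open>T\<close> the Toeplitz coefficient of a pair of
  blocks. Depth is asked of the column alone: powers grow by a factor on the right, and inside the
  band a row is at most \<open>r\<close> shallower than its column.\<close>

definition block_toeplitz_like ::
  "nat \<Rightarrow> nat \<Rightarrow> nat \<Rightarrow> real \<Rightarrow> (nat \<Rightarrow> nat \<Rightarrow> int \<times> int \<times> int \<Rightarrow> complex) \<Rightarrow>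
    nat \<Rightarrow> nat \<Rightarrow> nat \<Rightarrow> complex mat \<Rightarrow> bool" where
  "block_toeplitz_like s r q K T d1 d2 d3 B \<longleftrightarrow>
     B \<in> carrier_mat (s * (d1 * d2 * d3)) (s * (d1 * d2 * d3)) \<and>
     (\<forall>i<s * (d1 * d2 * d3). \<forall>j<s * (d1 * d2 * d3).
       norm (B $$ (i, j)) \<le> K \<and>
       (pos d1 d2 d3 i - pos d1 d2 d3 j \<notin> offset_box r \<longrightarrow> B $$ (i, j) = 0) \<and>
       (pos d1 d2 d3 i - pos d1 d2 d3 j \<in> offset_box r \<longrightarrow> pos d1 d2 d3 j \<in> deep_grid d1 d2 d3 q \<longrightarrow>
         B $$ (i, j) = T (blk d1 d2 d3 i) (blk d1 d2 d3 j) (pos d1 d2 d3 i - pos d1 d2 d3 j)))"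

text \<open>The translate of the offset box by a point of depth \<open>r\<close> stays inside the
  grid, so the sum may run over offsets.\<close>

lemma sum_grid_offset:
  fixes h :: "int \<times> int \<times> int \<Rightarrow> 'a::comm_monoid_add"
  assumes "y \<in> deep_grid d1 d2 d3 r" and "\<And>z. z - y \<notin> offset_box r \<Longrightarrow> h z = 0"
  shows "(\<Sum>z\<in>deep_grid d1 d2 d3 0. h z) = (\<Sum>u\<in>offset_box r. h (y + u))"
proof -
  have "(\<Sum>u\<in>offset_box r. h (y + u)) = sum h ((+) y ` offset_box r)"
    by (subst sum.reindex) auto
  also have "\<dots> = (\<Sum>z\<in>deep_grid d1 d2 d3 0. h z)"
  proof (rule sum.mono_neutral_left)
    show "(+) y ` offset_box r \<subseteq> deep_grid d1 d2 d3 0"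
      using deep_grid_add_offset[of y d1 d2 d3 0 r] assms(1) by auto
    show "\<forall>z\<in>deep_grid d1 d2 d3 0 - (+) y ` offset_box r. h z = 0"
    proof
      fix z assume "z \<in> deep_grid d1 d2 d3 0 - (+) y ` offset_box r"
      then have "z - y \<notin> offset_box r" by (metis DiffD2 add_diff_cancel_left' diff_add_cancel add.commute image_eqI)
      then show "h z = 0" by (rule assms(2))
    qed
  qed simp
  finally show ?thesis ..
qed

text \<open>In each of the \<open>s\<close> blocks at most \<open>(2 * r + 1) ^ 3\<close> positions
  lie in the band of a given column, whatever the size of the grid.\<close>

lemma block_toeplitz_like_col_sum:
  assumes B: "block_toeplitz_like s r q K T d1 d2 d3 B" and j: "j < s * (d1 * d2 * d3)"
  shows "(\<Sum>i<s * (d1 * d2 * d3). norm (B $$ (i, j))) \<le> real s * real ((2 * r + 1) ^ 3) * K"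
proof -
  let ?p = "pos d1 d2 d3"
  have nB: "norm (B $$ (i, j)) \<le> K" if "i < s * (d1 * d2 * d3)" for i
    using B j that by (simp add: block_toeplitz_like_def)
  have K: "K \<ge> 0" using nB[OF j] norm_ge_zero order_trans by blast
  have "(\<Sum>i<s * (d1 * d2 * d3). norm (B $$ (i, j)))
      \<le> (\<Sum>i<s * (d1 * d2 * d3). if ?p i - ?p j \<in> offset_box r then K else 0)"
    using B j nB by (intro sum_mono) (auto simp: block_toeplitz_like_def)
  also have "\<dots> = (\<Sum>c<s. \<Sum>z\<in>deep_grid d1 d2 d3 0. if z - ?p j \<in> offset_box r then K else 0)"
    by (rule sum_blk_pos)
  also have "\<dots> = real s * (\<Sum>z\<in>{z \<in> deep_grid d1 d2 d3 0. z - ?p j \<in> offset_box r}. K)"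
    by (simp flip: sum.inter_filter)
  also have "\<dots> \<le> real s * (real ((2 * r + 1) ^ 3) * K)"
  proof -
    have "card {z \<in> deep_grid d1 d2 d3 0. z - ?p j \<in> offset_box r} \<le> card (offset_box r)"
      by (rule card_inj_on_le[where f = "\<lambda>z. z - ?p j"]) (auto simp: inj_on_def)
    then show ?thesis
      unfolding card_offset_box using K by (auto intro!: mult_left_mono mult_right_mono simp del: of_nat_power)
  qed
  finally show ?thesis by (simp add: mult.assoc)
qed

text \<open>By induction all entries of \<open>B ^\<^sub>m k\<close> are at most
  \<open>R ^ k\<close>, and one more factor on the right enters only through its column sum.\<close>

lemma norm_pow_mat_le:
  fixes B :: "complex mat"
  assumes B: "B \<in> carrier_mat N N" and R: "R \<ge> 0"
    and cols: "\<And>j. j < N \<Longrightarrow> (\<Sum>i<N. norm (B $$ (i, j))) \<le> R"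
    and ij: "i < N" "j < N"
  shows "norm ((B ^\<^sub>m k) $$ (i, j)) \<le> R ^ k"
  using ij
proof (induction k arbitrary: i j)
  case 0
  then show ?case using B by auto
next
  case (Suc k)
  have "norm ((B ^\<^sub>m Suc k) $$ (i, j)) = norm (\<Sum>l<N. (B ^\<^sub>m k) $$ (i, l) * B $$ (l, j))"
    using index_mult_mat_sum[of "B ^\<^sub>m k" N N B N i j] B Suc.prems by simp
  also have "\<dots> \<le> (\<Sum>l<N. R ^ k * norm (B $$ (l, j)))"
    using Suc by (intro sum_norm_le) (auto simp: norm_mult intro!: mult_right_mono)
  also have "\<dots> \<le> R ^ k * R"
    unfolding sum_distrib_left[symmetric] using cols Suc.prems R by (intro mult_left_mono) auto
  finally show ?case by (simp add: mult.commute)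
qed

text \<open>A trigonometric polynomial with the coefficients \<open>T\<close> of the Toeplitz part
  of the matrices; the frequency is the position of the row minus that of the column.\<close>

locale block_symbol =
  fixes s r :: nat and T :: "nat \<Rightarrow> nat \<Rightarrow> int \<times> int \<times> int \<Rightarrow> complex"
    and f :: "real \<times> real \<times> real \<Rightarrow> complex mat"
  assumes f_carrier: "f \<theta> \<in> carrier_mat s s"
    and f_eq: "a < s \<Longrightarrow> b < s \<Longrightarrow> f \<theta> $$ (a, b) = (\<Sum>u\<in>offset_box r. T a b u * fourier_char u \<theta>)"
begin

lemma continuous_on_f: "a < s \<Longrightarrow> b < s \<Longrightarrow> continuous_on S (\<lambda>\<theta>. f \<theta> $$ (a, b))"
  by (simp add: f_eq) (intro continuous_intros)

lemma continuous_on_f_pow: "a < s \<Longrightarrow> b < s \<Longrightarrow> continuous_on S (\<lambda>\<theta>. (f \<theta> ^\<^sub>m k) $$ (a, b))"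
  by (rule continuous_on_index_pow_mat[OF f_carrier continuous_on_f])

text \<open>Each factor can move an index by at most one bandwidth \<open>r\<close>, so columns at depth \<open>q + k * r\<close> do not
  see the boundary layer.\<close>

lemma pow_mat_eq_fourier_coefficient:
  assumes B: "block_toeplitz_like s r q K T d1 d2 d3 B"
    and ij: "i < s * (d1 * d2 * d3)" "j < s * (d1 * d2 * d3)"
    and deep: "pos d1 d2 d3 j \<in> deep_grid d1 d2 d3 (q + k * r)" and qr: "r \<le> q"
  shows "(B ^\<^sub>m k) $$ (i, j) = integral theta_cube (\<lambda>\<theta>. (f \<theta> ^\<^sub>m k) $$ (blk d1 d2 d3 i, blk d1 d2 d3 j)
    * fourier_char (pos d1 d2 d3 j - pos d1 d2 d3 i) \<theta>) / of_real ((2 * pi) ^ 3)"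
  using ij deep
proof (induction k arbitrary: j)
  case (0 j)
  let ?N = "s * (d1 * d2 * d3)"
  let ?b = "blk d1 d2 d3" and ?p = "pos d1 d2 d3"
  have B_carr: "B \<in> carrier_mat ?N ?N" using B by (simp add: block_toeplitz_like_def)
  \<comment> \<open>Block and position determine the index, so an entry of the identity is
    \<open>1\<close> exactly when the blocks agree and the frequency is zero.\<close>
  have inj: "i = j \<longleftrightarrow> ?b i = ?b j \<and> ?p j - ?p i = 0"
    using inj_onD[OF bij_betw_imp_inj_on[OF bij_betw_blk_pos[of d1 d2 d3 s]], of i j] 0(1,2) by fastforce
  have "(f \<theta> ^\<^sub>m 0) $$ (?b i, ?b j) = (if ?b i = ?b j then 1 else 0)" for \<theta>
    using f_carrier[of \<theta>] blk_less 0 by simp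
  then show ?case
    using B_carr 0 inj by (simp add: integral_fourier_char[unfolded fun_eq_iff])
next
  case (Suc k j)
  let ?N = "s * (d1 * d2 * d3)"
  let ?b = "blk d1 d2 d3" and ?p = "pos d1 d2 d3"
  let ?C = "of_real ((2 * pi) ^ 3) :: complex"
  define y where "y = ?p j"
  have B_carr: "B \<in> carrier_mat ?N ?N" using B by (simp add: block_toeplitz_like_def)
  have bi: "?b i < s" and bj: "?b j < s" using Suc.prems blk_less by blast+
  define H where "H c z = (if z - y \<in> offset_box r then
      integral theta_cube (\<lambda>\<theta>. (f \<theta> ^\<^sub>m k) $$ (?b i, c) * fourier_char (z - ?p i) \<theta>) / ?C * T c (?b j) (z - y)
      else 0)" for c z
  have "(B ^\<^sub>m Suc k) $$ (i, j) = (\<Sum>l<?N. (B ^\<^sub>m k) $$ (i, l) * B $$ (l, j))"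
    using index_mult_mat_sum[of "B ^\<^sub>m k" ?N ?N B ?N i j] B_carr Suc.prems by simp
  also have "\<dots> = (\<Sum>l<?N. H (?b l) (?p l))"
  proof (intro sum.cong refl)
    fix l assume "l \<in> {..<?N}"
    then have l: "l < ?N" by simp
    show "(B ^\<^sub>m k) $$ (i, l) * B $$ (l, j) = H (?b l) (?p l)"
    proof (cases "?p l - y \<in> offset_box r")
      case True
      \<comment> \<open>Row \<open>l\<close> is within one bandwidth of column \<open>j\<close>, so
        it keeps depth \<open>q + k * r\<close> and the induction hypothesis applies to it.\<close>
      have "?p l = y + (?p l - y)" by simp
      also have "\<dots> \<in> deep_grid d1 d2 d3 (q + k * r)"
        using Suc.prems(3) True by (intro deep_grid_add_offset) (auto simp: y_def algebra_simps)
      finally have deep_l: "?p l \<in> deep_grid d1 d2 d3 (q + k * r)" .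
      have "y \<in> deep_grid d1 d2 d3 q"
        using Suc.prems(3) deep_grid_antimono[of q "q + Suc k * r"] unfolding y_def by auto
      then have "B $$ (l, j) = T (?b l) (?b j) (?p l - y)"
        using B l Suc.prems True unfolding block_toeplitz_like_def y_def by blast
      then show ?thesis
        using Suc.IH[OF Suc.prems(1) l deep_l] True by (simp add: H_def)
    next
      case False
      then have "B $$ (l, j) = 0"
        using B l Suc.prems unfolding block_toeplitz_like_def y_def by blast
      then show ?thesis using False by (simp add: H_def)
    qed
  qed
  also have "\<dots> = (\<Sum>c<s. \<Sum>z\<in>deep_grid d1 d2 d3 0. H c z)" by (rule sum_blk_pos)
  also have "\<dots> = (\<Sum>c<s. \<Sum>u\<in>offset_box r. H c (y + u))"
  proof (rule sum.cong[OF refl], rule sum_grid_offset)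
    show "y \<in> deep_grid d1 d2 d3 r"
      using Suc.prems(3) deep_grid_antimono[of r "q + Suc k * r"] qr unfolding y_def by auto
  qed (simp add: H_def)
  also have "\<dots> = (\<Sum>c<s. \<Sum>u\<in>offset_box r. integral theta_cube
      (\<lambda>\<theta>. (f \<theta> ^\<^sub>m k) $$ (?b i, c) * (T c (?b j) u * fourier_char u \<theta>) * fourier_char (y - ?p i) \<theta>) / ?C)"
  proof (intro sum.cong refl)
    fix c u assume "u \<in> offset_box r"
    have "integral theta_cube (\<lambda>\<theta>. (f \<theta> ^\<^sub>m k) $$ (?b i, c) * fourier_char (y + u - ?p i) \<theta>) * T c (?b j) u
        = integral theta_cube (\<lambda>\<theta>. (f \<theta> ^\<^sub>m k) $$ (?b i, c) * fourier_char (y + u - ?p i) \<theta> * T c (?b j) u)"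
      by (rule integral_mult_left[symmetric])
    also have "\<dots> = integral theta_cube
      (\<lambda>\<theta>. (f \<theta> ^\<^sub>m k) $$ (?b i, c) * (T c (?b j) u * fourier_char u \<theta>) * fourier_char (y - ?p i) \<theta>)"
    proof (intro integral_cong)
      fix \<theta>
      \<comment> \<open>The shift by \<open>u\<close> becomes the character that completes
        \<open>T\<close> to a term of the Fourier series of \<open>f\<close>.\<close>
      have "fourier_char (y + u - ?p i) \<theta> = fourier_char u \<theta> * fourier_char (y - ?p i) \<theta>"
        unfolding fourier_char_add[symmetric] by (simp add: algebra_simps)
      then show "(f \<theta> ^\<^sub>m k) $$ (?b i, c) * fourier_char (y + u - ?p i) \<theta> * T c (?b j) u
        = (f \<theta> ^\<^sub>m k) $$ (?b i, c) * (T c (?b j) u * fourier_char u \<theta>) * fourier_char (y - ?p i) \<theta>"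
        by (simp add: mult_ac)
    qed
    finally show "H c (y + u) = integral theta_cube
      (\<lambda>\<theta>. (f \<theta> ^\<^sub>m k) $$ (?b i, c) * (T c (?b j) u * fourier_char u \<theta>) * fourier_char (y - ?p i) \<theta>) / ?C"
      using \<open>u \<in> offset_box r\<close> by (simp add: H_def)
  qed
  also have "\<dots> = integral theta_cube (\<lambda>\<theta>. \<Sum>c<s. \<Sum>u\<in>offset_box r.
      (f \<theta> ^\<^sub>m k) $$ (?b i, c) * (T c (?b j) u * fourier_char u \<theta>) * fourier_char (y - ?p i) \<theta>) / ?C"
  proof -
    have int: "(\<lambda>\<theta>. (f \<theta> ^\<^sub>m k) $$ (?b i, c) * (T c (?b j) u * fourier_char u \<theta>) * fourier_char (y - ?p i) \<theta>)
        integrable_on theta_cube" if "c < s" for c u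
      using bi that by (intro integrable_continuous continuous_intros continuous_on_f_pow)
    show ?thesis
      unfolding sum_divide_distrib[symmetric]
      by (subst integral_sum) (auto intro!: arg_cong[where f = "\<lambda>x. x / ?C"] sum.cong integral_sum[symmetric]
          integrable_sum int simp del: of_real_power)
  qed
  also have "\<dots> = integral theta_cube (\<lambda>\<theta>. (f \<theta> ^\<^sub>m Suc k) $$ (?b i, ?b j) * fourier_char (y - ?p i) \<theta>) / ?C"
  proof (intro arg_cong[where f = "\<lambda>x. x / ?C"] integral_cong)
    fix \<theta>
    have "(f \<theta> ^\<^sub>m Suc k) $$ (?b i, ?b j) = (\<Sum>c<s. (f \<theta> ^\<^sub>m k) $$ (?b i, c) * f \<theta> $$ (c, ?b j))"
      using index_mult_mat_sum[of "f \<theta> ^\<^sub>m k" s s "f \<theta>" s "?b i" "?b j"] f_carrier[of \<theta>] bi bj by simp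
    also have "\<dots> = (\<Sum>c<s. \<Sum>u\<in>offset_box r. (f \<theta> ^\<^sub>m k) $$ (?b i, c) * (T c (?b j) u * fourier_char u \<theta>))"
      using bj by (simp add: f_eq sum_distrib_left)
    finally show "(\<Sum>c<s. \<Sum>u\<in>offset_box r.
      (f \<theta> ^\<^sub>m k) $$ (?b i, c) * (T c (?b j) u * fourier_char u \<theta>) * fourier_char (y - ?p i) \<theta>)
      = (f \<theta> ^\<^sub>m Suc k) $$ (?b i, ?b j) * fourier_char (y - ?p i) \<theta>"
      by (simp only: sum_distrib_right)
  qed
  finally show ?case by (simp add: y_def)
qed

definition f_bound :: real where
  "f_bound = (\<Sum>a<s. \<Sum>b<s. \<Sum>u\<in>offset_box r. norm (T a b u))"

lemma f_col_sum: "b < s \<Longrightarrow> (\<Sum>a<s. norm (f \<theta> $$ (a, b))) \<le> f_bound"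
proof -
  assume b: "b < s"
  have "norm (f \<theta> $$ (a, b)) \<le> (\<Sum>b<s. \<Sum>u\<in>offset_box r. norm (T a b u))" if "a < s" for a
  proof -
    have "norm (f \<theta> $$ (a, b)) \<le> (\<Sum>u\<in>offset_box r. norm (T a b u))"
      unfolding f_eq[OF that b] by (intro sum_norm_le) (simp add: norm_mult norm_fourier_char)
    also have "\<dots> \<le> (\<Sum>b<s. \<Sum>u\<in>offset_box r. norm (T a b u))"
      using b by (intro member_le_sum) (auto intro: sum_nonneg)
    finally show ?thesis .
  qed
  then show ?thesis unfolding f_bound_def by (intro sum_mono) simp
qed

text \<open>Diagonal entries at depth \<open>q + k * r\<close> agree exactly with the mean of the
  symbol power; every other index contributes at most \<open>2 * R ^ k\<close>. Together with two
  faces per direction this makes the factor \<open>4\<close>.\<close>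

lemma trace_pow_mat_approx:
  assumes B: "block_toeplitz_like s r q K T d1 d2 d3 B" and qr: "r \<le> q"
    and R: "0 \<le> R" "f_bound \<le> R" "real s * real ((2 * r + 1) ^ 3) * K \<le> R"
    and d: "0 < d1" "0 < d2" "0 < d3" "0 < s"
  shows "norm (mat_trace (B ^\<^sub>m k) / of_nat (s * (d1 * d2 * d3))
      - integral theta_cube (\<lambda>\<theta>. mat_trace (f \<theta> ^\<^sub>m k)) / (of_nat s * of_real ((2 * pi) ^ 3)))
    \<le> 4 * R ^ k * real (q + k * r) * (1 / real d1 + 1 / real d2 + 1 / real d3)"
proof -
  let ?N = "s * (d1 * d2 * d3)" and ?G = "deep_grid d1 d2 d3 0" and ?D = "deep_grid d1 d2 d3 (q + k * r)"
  let ?b = "blk d1 d2 d3" and ?p = "pos d1 d2 d3"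
  let ?C = "of_real ((2 * pi) ^ 3) :: complex"
  have B_carr: "B \<in> carrier_mat ?N ?N" using B by (simp add: block_toeplitz_like_def)
  define I where "I a = integral theta_cube (\<lambda>\<theta>. (f \<theta> ^\<^sub>m k) $$ (a, a)) / ?C" for a
  have tr: "mat_trace (B ^\<^sub>m k) = (\<Sum>i<?N. (B ^\<^sub>m k) $$ (i, i))"
    using B_carr by (simp add: mat_trace_def)
  have "integral theta_cube (\<lambda>\<theta>. mat_trace (f \<theta> ^\<^sub>m k)) / ?C = (\<Sum>a<s. I a)"
  proof -
    have "mat_trace (f \<theta> ^\<^sub>m k) = (\<Sum>a<s. (f \<theta> ^\<^sub>m k) $$ (a, a))" for \<theta>
      using f_carrier[of \<theta>] by (simp add: mat_trace_def)
    then show ?thesis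
      unfolding I_def sum_divide_distrib[symmetric]
      by (subst integral_sum[symmetric]) (auto intro!: integrable_continuous continuous_on_f_pow)
  qed
  \<comment> \<open>The target value depends on the block alone and is repeated for every grid
    point.\<close>
  moreover have "(\<Sum>i<?N. I (?b i)) = of_nat (d1 * d2 * d3) * (\<Sum>a<s. I a)"
    using sum_blk_pos[of "\<lambda>c z. I c"] by (simp add: card_grid sum_distrib_left del: of_nat_mult)
  moreover have "J / (c * C) = X / (c * D)" if "J / C = S" "X = D * S" "D \<noteq> 0" for J C S X D c :: complex
    using that by auto
  ultimately have I_sum: "integral theta_cube (\<lambda>\<theta>. mat_trace (f \<theta> ^\<^sub>m k)) / (of_nat s * ?C)
      = (\<Sum>i<?N. I (?b i)) / of_nat ?N"
    using d unfolding of_nat_mult[of s] by (metis mult_pos_pos of_nat_eq_0_iff less_irrefl)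
  have I_le: "norm (I a) \<le> R ^ k" if "a < s" for a
  proof -
    have "norm ((f \<theta> ^\<^sub>m k) $$ (a, a)) \<le> R ^ k" for \<theta>
      using order_trans[OF f_col_sum R(2)] that by (intro norm_pow_mat_le[OF f_carrier R(1)])
    then have "norm (integral theta_cube (\<lambda>\<theta>. (f \<theta> ^\<^sub>m k) $$ (a, a))) \<le> integral theta_cube (\<lambda>\<theta>. R ^ k)"
      using that by (intro integral_norm_bound_integral integrable_continuous continuous_on_f_pow) auto
    also have "\<dots> = (2 * pi) ^ 3 * R ^ k"
      by (simp add: content_Pair power3_eq_cube)
    finally show ?thesis
      unfolding I_def by (simp add: norm_divide norm_power divide_le_eq mult.commute)
  qed
  have B_le: "norm ((B ^\<^sub>m k) $$ (i, i)) \<le> R ^ k" if "i < ?N" for i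
    using order_trans[OF block_toeplitz_like_col_sum[OF B] R(3)] that
    by (intro norm_pow_mat_le[OF B_carr R(1)])
  have dev: "norm ((B ^\<^sub>m k) $$ (i, i) - I (?b i)) \<le> (if ?p i \<in> ?D then 0 else 2 * R ^ k)" if "i < ?N" for i
  proof (cases "?p i \<in> ?D")
    case True
    then show ?thesis
      using pow_mat_eq_fourier_coefficient[OF B that that True qr] by (simp add: I_def fourier_char_0)
  next
    case False
    then show ?thesis
      using norm_triangle_ineq4[of "(B ^\<^sub>m k) $$ (i, i)" "I (?b i)"] B_le[OF that] I_le[OF blk_less[OF that]]
      by simp
  qed
  have "norm (\<Sum>i<?N. (B ^\<^sub>m k) $$ (i, i) - I (?b i)) \<le> (\<Sum>i<?N. if ?p i \<in> ?D then 0 else 2 * R ^ k)"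
    by (intro sum_norm_le dev) simp
  also have "\<dots> = (\<Sum>c<s. \<Sum>z\<in>?G. if z \<in> ?D then 0 else 2 * R ^ k)"
    by (rule sum_blk_pos)
  also have "(\<Sum>z\<in>?G. if z \<in> ?D then 0 else 2 * R ^ k) = (\<Sum>z\<in>?G - ?D. 2 * R ^ k)"
    by (rule sum.mono_neutral_cong_right) auto
  also have "(\<Sum>c<s. \<Sum>z\<in>?G - ?D. 2 * R ^ k) = real s * (real (card (?G - ?D)) * (2 * R ^ k))"
    by simp
  also have "\<dots> \<le> real s * (real (2 * (q + k * r) * (d2 * d3 + d1 * d3 + d1 * d2)) * (2 * R ^ k))"
    using card_shallow_grid[of d1 d2 d3 "q + k * r"] R(1)
    by (intro mult_left_mono mult_right_mono) (auto simp del: of_nat_mult of_nat_add)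
  finally have *: "norm (mat_trace (B ^\<^sub>m k) - (\<Sum>i<?N. I (?b i)))
      \<le> real s * (real (2 * (q + k * r) * (d2 * d3 + d1 * d3 + d1 * d2)) * (2 * R ^ k))"
    by (simp add: tr sum_subtractf)
  have "norm (mat_trace (B ^\<^sub>m k) / of_nat ?N - (\<Sum>i<?N. I (?b i)) / of_nat ?N)
      = norm (mat_trace (B ^\<^sub>m k) - (\<Sum>i<?N. I (?b i))) / real ?N"
    unfolding diff_divide_distrib[symmetric] norm_divide norm_of_nat ..
  also have "\<dots> \<le> real s * (real (2 * (q + k * r) * (d2 * d3 + d1 * d3 + d1 * d2)) * (2 * R ^ k)) / real ?N"
    by (intro divide_right_mono *) simp
  also have "\<dots> = 4 * R ^ k * real (q + k * r) * (1 / real d1 + 1 / real d2 + 1 / real d3)"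
  proof -
    have "c * (2 * Q * E * (2 * P)) / (c * D) = 4 * P * Q * H"
      if "E = D * H" "c \<noteq> 0" "D \<noteq> 0" for c Q E P D H :: real
      using that by simp
    moreover have "real (d2 * d3 + d1 * d3 + d1 * d2) = real (d1 * d2 * d3) * (1 / real d1 + 1 / real d2 + 1 / real d3)"
      using d by (simp add: distrib_left)
    moreover have "real s \<noteq> 0" "real (d1 * d2 * d3) \<noteq> 0" using d by auto
    ultimately show ?thesis unfolding of_nat_mult[of s] of_nat_mult[of "2 * _"] of_nat_mult[of 2] of_nat_numeral by blast
  qed
  finally show ?thesis by (subst I_sum)
qed

theorem spectral_distribution_block_toeplitz_like:
  fixes B :: "'i \<Rightarrow> complex mat"
  assumes s: "0 < s" and qr: "r \<le> q"
    and dims: "filterlim d1 at_top \<F>" "filterlim d2 at_top \<F>" "filterlim d3 at_top \<F>"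
    and f_herm: "\<And>\<theta>. hermitian_mat (f \<theta>)"
    and B_herm: "\<forall>\<^sub>F n in \<F>. hermitian_mat (B n)"
    and B: "\<forall>\<^sub>F n in \<F>. block_toeplitz_like s r q K T (d1 n) (d2 n) (d3 n) (B n)"
  shows "spectral_distribution \<F> B s f theta_cube"
proof (rule spectral_distribution_of_moments)
  \<comment> \<open>One radius for matrices and symbol; the maximum with \<open>0\<close> keeps it
    nonnegative.\<close>
  define R where "R = max (max 0 f_bound) (real s * real ((2 * r + 1) ^ 3) * K)"
  have R: "0 \<le> R" "f_bound \<le> R" "real s * real ((2 * r + 1) ^ 3) * K \<le> R"
    unfolding R_def by linarith+
  have content: "measure lborel theta_cube = (2 * pi) ^ 3"
    by (simp add: content_Pair power3_eq_cube)
  show "box (-pi, -pi, -pi) (pi, pi, pi) \<noteq> {}"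
    by (simp add: box_ne_empty Basis_prod_def) 
  show "0 < s" by (rule s)
  show "f \<theta> \<in> carrier_mat s s" "hermitian_mat (f \<theta>)" for \<theta> by (rule f_carrier f_herm)+
  show "continuous_on theta_cube (\<lambda>\<theta>. f \<theta> $$ (a, b))" if "a < s" "b < s" for a b
    by (rule continuous_on_f[OF that])
  show "(\<Sum>a<s. norm (f \<theta> $$ (a, b))) \<le> R" if "b < s" for \<theta> b
    using f_col_sum[OF that] R by (meson order_trans)
  show "\<forall>\<^sub>F n in \<F>. hermitian_mat (B n)" by (rule B_herm)
  have dim: "\<forall>\<^sub>F n in \<F>. dim_row (B n) = s * (d1 n * d2 n * d3 n)"
    using B by eventually_elim (auto simp: block_toeplitz_like_def)
  show "\<forall>\<^sub>F n in \<F>. \<forall>j<dim_row (B n). (\<Sum>i<dim_row (B n). norm (B n $$ (i, j))) \<le> R"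
    using B dim
  proof eventually_elim
    case (elim n)
    show ?case
      unfolding elim(2) using block_toeplitz_like_col_sum[OF elim(1)] R(3) by (meson order_trans)
  qed
  have pos: "\<forall>\<^sub>F n in \<F>. 0 < d1 n \<and> 0 < d2 n \<and> 0 < d3 n"
  proof -
    have "\<forall>\<^sub>F n in \<F>. 0 < d n" if "filterlim d at_top \<F>" for d :: "'i \<Rightarrow> nat"
      using filterlim_at_top[THEN iffD1, OF that, rule_format, of 1] by eventually_elim simp
    then show ?thesis using dims by (intro eventually_conj)
  qed
  show "filterlim (\<lambda>n. dim_row (B n)) at_top \<F>"
  proof (rule filterlim_at_top_mono[OF dims(1)])
    show "\<forall>\<^sub>F n in \<F>. d1 n \<le> dim_row (B n)"
      using pos dim by eventually_elim (use s in auto)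
  qed
  fix k
  show "((\<lambda>n. mat_trace (B n ^\<^sub>m k) / of_nat (dim_row (B n))) \<longlongrightarrow>
      integral theta_cube (\<lambda>t. mat_trace (f t ^\<^sub>m k)) / (of_nat s * of_real (measure lborel theta_cube))) \<F>"
    (is "(?S \<longlongrightarrow> ?L) _")
  proof (rule Lim_null[THEN iffD2], rule Lim_null_comparison)
    show "\<forall>\<^sub>F n in \<F>. norm (?S n - ?L)
        \<le> 4 * R ^ k * real (q + k * r) * (1 / real (d1 n) + 1 / real (d2 n) + 1 / real (d3 n))"
      using B dim pos
    proof eventually_elim
      case (elim n)
      show ?case
        unfolding elim(2) content using elim(3) s by (intro trace_pow_mat_approx[OF elim(1) qr R]) auto
    qed
    have "((\<lambda>n. 1 / real (d n)) \<longlongrightarrow> 0) \<F>" if "filterlim d at_top \<F>" for d :: "'i \<Rightarrow> nat"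
      using filterlim_compose[OF lim_1_over_n that] by simp
    then show "((\<lambda>n. 4 * R ^ k * real (q + k * r) * (1 / real (d1 n) + 1 / real (d2 n) + 1 / real (d3 n))) \<longlongrightarrow> 0) \<F>"
      using dims by (intro tendsto_mult_right_zero tendsto_add_zero)
  qed
qed

end

section \<open>Cardinal B-splines\<close>

declare cardinal_bspline.simps(2) [simp del]

lemma cardinal_bspline_eq_0: "t < 0 \<or> real p + 1 \<le> t \<Longrightarrow> cardinal_bspline p t = 0"
  by (induction p arbitrary: t) (auto simp: cardinal_bspline.simps(2))

text \<open>On the supports both weights of the recursion lie between \<open>0\<close> and
  \<open>1\<close>, so each degree costs a factor \<open>2\<close>. The bound serves only
  integrability.\<close>

lemma abs_cardinal_bspline_le: "\<bar>cardinal_bspline p t\<bar> \<le> 2 ^ p"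
proof (induction p arbitrary: t)
  case (Suc p)
  have 1: "\<bar>t / real (Suc p) * cardinal_bspline p t\<bar> \<le> 2 ^ p"
  proof (cases "0 \<le> t \<and> t < real p + 1")
    case True
    then have "\<bar>t / real (Suc p) * cardinal_bspline p t\<bar> \<le> 1 * 2 ^ p"
      unfolding abs_mult by (intro mult_mono Suc) (auto simp: divide_simps)
    then show ?thesis by simp
  qed (use cardinal_bspline_eq_0[of t p] in auto)
  have 2: "\<bar>(real (Suc p) + 1 - t) / real (Suc p) * cardinal_bspline p (t - 1)\<bar> \<le> 2 ^ p"
  proof (cases "0 \<le> t - 1 \<and> t - 1 < real p + 1")
    case True
    then have "\<bar>(real (Suc p) + 1 - t) / real (Suc p) * cardinal_bspline p (t - 1)\<bar> \<le> 1 * 2 ^ p"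
      unfolding abs_mult by (intro mult_mono Suc) (auto simp: divide_simps)
    then show ?thesis by simp
  qed (use cardinal_bspline_eq_0[of "t - 1" p] in auto)
  show ?case
    unfolding cardinal_bspline.simps(2) power_Suc mult_2
    by (rule order_trans[OF abs_triangle_ineq add_mono[OF 1 2]])
qed simp

lemma borel_measurable_cardinal_bspline [measurable]: "cardinal_bspline p \<in> borel_measurable borel"
proof (induction p)
  case 0
  have "cardinal_bspline 0 = (\<lambda>t. if 0 \<le> t \<and> t < 1 then 1 else 0)" by (rule ext) simp
  then show ?case by simp
next
  case (Suc p)
  note [measurable] = Suc
  have "cardinal_bspline (Suc p) = (\<lambda>t. t / real (Suc p) * cardinal_bspline p t
      + (real (Suc p) + 1 - t) / real (Suc p) * cardinal_bspline p (t - 1))"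
    by (rule ext) (rule cardinal_bspline.simps(2))
  then show ?case by simp
qed

lemma cardinal_bspline_1: "cardinal_bspline (Suc 0) t = max 0 (min t (2 - t))"
  by (auto simp: cardinal_bspline.simps(2) max_def min_def)

text \<open>Reflection exchanges the two summands of the recursion. Degree \<open>0\<close> is left
  out because a half-open interval is not symmetric.\<close>

lemma cardinal_bspline_reflect: "cardinal_bspline (Suc p) (real p + 2 - t) = cardinal_bspline (Suc p) t"
proof (induction p arbitrary: t)
  case 0
  show ?case by (simp add: cardinal_bspline_1 min.commute)
next
  case (Suc p)
  define B where "B = cardinal_bspline (Suc p)"
  have rec: "cardinal_bspline (Suc (Suc p)) x = x / real (Suc (Suc p)) * B x
      + (real (Suc (Suc p)) + 1 - x) / real (Suc (Suc p)) * B (x - 1)" for x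
    by (simp add: B_def cardinal_bspline.simps(2))
  have 1: "B (real (Suc p) + 2 - t) = B (t - 1)" "B (real (Suc p) + 2 - t - 1) = B t"
  proof -
    have "real (Suc p) + 2 - t = real p + 2 - (t - 1)" "real (Suc p) + 2 - t - 1 = real p + 2 - t"
      by simp_all
    then show "B (real (Suc p) + 2 - t) = B (t - 1)" "B (real (Suc p) + 2 - t - 1) = B t"
      by (simp_all only: B_def Suc)
  qed
  have 2: "real (Suc (Suc p)) + 1 - (real (Suc p) + 2 - t) = t"
    "real (Suc p) + 2 - t = real (Suc (Suc p)) + 1 - t" by simp_all
  show ?case
    unfolding rec 1 2(1) by (simp only: 2(2) add.commute)
qed

lemma isCont_cardinal_bspline: "isCont (cardinal_bspline (Suc p)) t"
proof (induction p arbitrary: t)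
  case 0
  have eq: "cardinal_bspline (Suc 0) = (\<lambda>t. max 0 (min t (2 - t)))"
    by (rule ext) (rule cardinal_bspline_1)
  show ?case unfolding eq by (intro continuous_intros)
next
  case (Suc p)
  define B where "B = cardinal_bspline (Suc p)"
  have eq: "cardinal_bspline (Suc (Suc p)) = (\<lambda>x. x / real (Suc (Suc p)) * B x
      + (real (Suc (Suc p)) + 1 - x) / real (Suc (Suc p)) * B (x - 1))"
    by (rule ext) (simp add: B_def cardinal_bspline.simps(2))
  have B: "isCont B x" for x using Suc by (simp add: B_def)
  then have "isCont (\<lambda>x. B (x - 1)) t" by (intro isCont_o2[where f = "\<lambda>x. x - 1" and g = B]) simp_all
  with B[of t] show ?case unfolding eq by (intro continuous_intros) auto
qed

lemma continuous_on_cardinal_bspline: "continuous_on S (cardinal_bspline (Suc p))"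
  by (simp add: continuous_at_imp_continuous_on isCont_cardinal_bspline)

lemma has_real_derivative_cardinal_bspline_0:
  assumes "t \<notin> \<int>"
  shows "(cardinal_bspline 0 has_real_derivative 0) (at t)"
proof (rule has_field_derivative_transform_within_open)
  show "((\<lambda>_. cardinal_bspline 0 t) has_real_derivative 0) (at t)" by simp
  show "open {of_int \<lfloor>t\<rfloor><..<of_int \<lfloor>t\<rfloor> + 1 :: real}" by simp
  have "of_int \<lfloor>t\<rfloor> \<noteq> t" using assms by (metis Ints_of_int)
  then have "of_int \<lfloor>t\<rfloor> < t" by (metis less_le of_int_floor_le)
  then show "t \<in> {of_int \<lfloor>t\<rfloor><..<of_int \<lfloor>t\<rfloor> + 1}"
    using floor_correct[of t] by auto
  fix x assume "x \<in> {of_int \<lfloor>t\<rfloor><..<of_int \<lfloor>t\<rfloor> + 1 :: real}"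
  then have "\<lfloor>x\<rfloor> = \<lfloor>t\<rfloor>" by (intro floor_unique) auto
  moreover have "cardinal_bspline 0 y = (if \<lfloor>y\<rfloor> = 0 then 1 else 0)" for y
    by (simp add: floor_eq_iff)
  ultimately show "cardinal_bspline 0 t = cardinal_bspline 0 x" by simp
qed

text \<open>The classical difference formula, proved through the recursion. Integers are excluded
  since the pieces of degree \<open>0\<close> jump there.\<close>

lemma has_real_derivative_cardinal_bspline_nonint:
  assumes "t \<notin> \<int>"
  shows "(cardinal_bspline (Suc p) has_real_derivative (cardinal_bspline p t - cardinal_bspline p (t - 1))) (at t)"
  using assms
proof (induction p arbitrary: t)
  case 0
  define B where "B = cardinal_bspline 0"
  have "t - 1 \<notin> \<int>" using 0 by (metis Ints_1 Ints_add diff_add_cancel)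
  then have d: "(B has_real_derivative 0) (at t)" "(B has_real_derivative 0) (at (t - 1))"
    using 0 has_real_derivative_cardinal_bspline_0 unfolding B_def by blast+
  have d': "((\<lambda>x. B (x - 1)) has_real_derivative 0) (at t)"
    using DERIV_shift[of B 0 t "- 1"] d(2) by simp
  have eq: "cardinal_bspline (Suc 0) = (\<lambda>x. x * B x + (2 - x) * B (x - 1))"
    by (rule ext) (simp add: B_def cardinal_bspline.simps(2))
  show ?case
    unfolding eq B_def[symmetric] by (rule derivative_eq_intros d d' refl | simp)+
next
  case (Suc p)
  define n where "n = real (Suc p)"
  define B where "B = cardinal_bspline (Suc p)"
  define A where "A = cardinal_bspline p"
  have n: "n > 0" by (simp add: n_def)
  have t1: "t - 1 \<notin> \<int>" using Suc by (metis Ints_1 Ints_add diff_add_cancel)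
  have dB: "(B has_real_derivative (A t - A (t - 1))) (at t)"
    using Suc by (simp add: A_def B_def)
  have "(B has_real_derivative (A (t - 1) - A (t - 1 - 1))) (at (t - 1))"
    using Suc.IH[OF t1] by (simp add: A_def B_def)
  then have dB': "((\<lambda>x. B (x - 1)) has_real_derivative (A (t - 1) - A (t - 1 - 1))) (at t)"
    using DERIV_shift[of B "A (t - 1) - A (t - 1 - 1)" t "- 1"] by simp
  \<comment> \<open>The recursion for \<open>B\<close> without denominators; used at
    \<open>t\<close> and \<open>t - 1\<close>, it identifies the outcome \<open>?D\<close> of the
    product rule.\<close>
  have B: "n * B x = x * A x + (n + 1 - x) * A (x - 1)" for x
  proof -
    have "B x = x / n * A x + (n + 1 - x) / n * A (x - 1)"
      by (simp only: A_def B_def n_def cardinal_bspline.simps(2))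
    then show ?thesis using n by (simp add: field_simps)
  qed
  have eq: "cardinal_bspline (Suc (Suc p)) = (\<lambda>x. x / (n + 1) * B x + (n + 2 - x) / (n + 1) * B (x - 1))"
    by (rule ext) (simp add: B_def n_def cardinal_bspline.simps(2))
  let ?D = "B t + t * (A t - A (t - 1)) - B (t - 1) + (n + 2 - t) * (A (t - 1) - A (t - 1 - 1))"
  have "((\<lambda>x. x / (n + 1) * B x + (n + 2 - x) / (n + 1) * B (x - 1)) has_real_derivative
      (1 / (n + 1) * B t + (A t - A (t - 1)) * (t / (n + 1)) +
      ((0 - 1) / (n + 1) * B (t - 1) + (A (t - 1) - A (t - 1 - 1)) * ((n + 2 - t) / (n + 1))))) (at t)"
    by (intro DERIV_add DERIV_mult DERIV_cdivide DERIV_diff DERIV_const DERIV_ident dB dB')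
  also have "1 / (n + 1) * B t + (A t - A (t - 1)) * (t / (n + 1)) +
      ((0 - 1) / (n + 1) * B (t - 1) + (A (t - 1) - A (t - 1 - 1)) * ((n + 2 - t) / (n + 1))) = ?D / (n + 1)"
    by (simp add: add_divide_distrib diff_divide_distrib algebra_simps)
  also have "?D = (n + 1) * (B t - B (t - 1))"
  proof -
    have "(n + 1) * (B t - B (t - 1)) = B t - B (t - 1) + (n * B t - n * B (t - 1))"
      by (simp add: algebra_simps)
    also have "\<dots> = ?D" unfolding B by (simp add: algebra_simps)
    finally show ?thesis by (rule sym)
  qed
  also have "\<dots> / (n + 1) = B t - B (t - 1)" using n by simp
  finally show ?case unfolding eq B_def[symmetric] .
qed

text \<open>The fundamental theorem tolerates the finitely many integers in the interval because the
  primitive is continuous.\<close>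

lemma cardinal_bspline_has_integral:
  assumes "a \<le> b"
  shows "((\<lambda>x. cardinal_bspline p x - cardinal_bspline p (x - 1)) has_integral
    (cardinal_bspline (Suc p) b - cardinal_bspline (Suc p) a)) {a..b}"
proof (rule fundamental_theorem_of_calculus_interior_strong)
  have "{a..b} \<inter> \<int> = {x \<in> \<int>. a \<le> x \<and> x \<le> b}" by auto
  then show "finite ({a..b} \<inter> \<int>)" by (simp add: finite_int_segment)
  show "a \<le> b" by fact
  show "(cardinal_bspline (Suc p) has_vector_derivative cardinal_bspline p x - cardinal_bspline p (x - 1)) (at x)"
    if "x \<in> {a<..<b} - {a..b} \<inter> \<int>" for x
    using has_real_derivative_cardinal_bspline_nonint[of x p] that
    by (auto simp: has_real_derivative_iff_has_vector_derivative)
  show "continuous_on {a..b} (cardinal_bspline (Suc p))" by (rule continuous_on_cardinal_bspline)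
qed

text \<open>From degree \<open>2\<close> on the difference is itself continuous, so differentiating
  its integral gives the formula at the integers as well.\<close>

lemma has_real_derivative_cardinal_bspline:
  "(cardinal_bspline (Suc (Suc p)) has_real_derivative
    (cardinal_bspline (Suc p) t - cardinal_bspline (Suc p) (t - 1))) (at t)"
proof -
  let ?B = "cardinal_bspline (Suc (Suc p))"
  let ?g = "\<lambda>x. cardinal_bspline (Suc p) x - cardinal_bspline (Suc p) (x - 1)"
  have "continuous_on {t - 1..t + 1} ?g"
    by (intro continuous_intros continuous_on_cardinal_bspline
        continuous_on_compose2[OF continuous_on_cardinal_bspline[of UNIV]]) auto
  then have "((\<lambda>u. integral {t - 1..u} ?g) has_real_derivative ?g t) (at t within {t - 1..t + 1})"
    by (intro integral_has_real_derivative) auto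
  then have "((\<lambda>u. integral {t - 1..u} ?g + ?B (t - 1)) has_real_derivative ?g t) (at t)"
    by (subst (asm) at_within_interior) (auto intro!: derivative_eq_intros)
  then show ?thesis
  proof (rule has_field_derivative_transform_within_open)
    show "open {t - 1<..<t + 1}" "t \<in> {t - 1<..<t + 1}" by auto
    fix x assume "x \<in> {t - 1<..<t + 1}"
    then have "integral {t - 1..x} ?g = ?B x - ?B (t - 1)"
      by (intro integral_unique cardinal_bspline_has_integral) auto
    then show "integral {t - 1..x} ?g + ?B (t - 1) = ?B x" by simp
  qed
qed

section \<open>Convolution and correlation of cardinal B-splines\<close>

lemma set_integrable_cardinal_bspline:
  assumes "S \<in> sets borel" "bounded S"
  shows "set_integrable lborel S (cardinal_bspline p)"
  unfolding set_integrable_def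
proof (rule integrableI_bounded_set[where A = S and B = "2 ^ p"])
  show "emeasure lborel S < \<infinity>" using emeasure_bounded_finite[OF assms(2)] by simp
qed (use assms abs_cardinal_bspline_le[of p] in \<open>auto simp: indicator_def\<close>)

text \<open>In the integrated difference formula the shifted integral cancels all but the last unit
  interval.\<close>

lemma cardinal_bspline_eq_integral:
  "cardinal_bspline (Suc p) t = (LBINT x:{t - 1..t}. cardinal_bspline p x)"
proof -
  \<comment> \<open>Left of the support and at most \<open>t - 1\<close>, so that everything at or
    below \<open>a\<close> vanishes.\<close>
  define a where "a = min t 0 - 1"
  let ?B = "cardinal_bspline p"
  have int: "?B integrable_on {x..y}" for x y
    by (rule set_borel_integral_eq_integral(1)[OF set_integrable_cardinal_bspline]) auto
  have int': "(\<lambda>x. ?B (x - 1)) integrable_on {x..y}" for x y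
    using integrable_shift_real_ivl[OF int[of "x - 1" "y - 1"], of "- 1"] by simp
  have a: "a \<le> t - 1" "a < 0" by (auto simp: a_def)
  have "cardinal_bspline (Suc p) t - cardinal_bspline (Suc p) a = integral {a..t} (\<lambda>x. ?B x - ?B (x - 1))"
    by (rule integral_unique[symmetric], rule cardinal_bspline_has_integral) (use a in simp)
  also have "\<dots> = integral {a..t} ?B - integral {a..t} (\<lambda>x. ?B (x - 1))"
    by (intro integral_diff int int')
  also have "integral {a..t} (\<lambda>x. ?B (x - 1)) = integral {a - 1..t - 1} ?B"
    using integral_shift_real_ivl[of "a - 1" "- 1" "t - 1" ?B] by simp
  also have "\<dots> = integral {a - 1..a} ?B + integral {a..t - 1} ?B"
    by (rule Henstock_Kurzweil_Integration.integral_combine[symmetric]) (use a int in auto)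
  also have "integral {a - 1..a} ?B = integral {a - 1..a} (\<lambda>x. 0)"
    by (intro integral_cong cardinal_bspline_eq_0) (use a in auto)
  also have "integral {a..t} ?B = integral {a..t - 1} ?B + integral {t - 1..t} ?B"
    by (rule Henstock_Kurzweil_Integration.integral_combine[symmetric]) (use a int in auto)
  also have "cardinal_bspline (Suc p) a = 0" using a by (intro cardinal_bspline_eq_0) auto
  also have "integral {t - 1..t} ?B = (LBINT x:{t - 1..t}. cardinal_bspline p x)"
    by (rule set_borel_integral_eq_integral(2)[OF set_integrable_cardinal_bspline, symmetric]) auto
  finally show ?thesis by simp
qed

lemma cardinal_bspline_eq_convolution:
  "cardinal_bspline (Suc p) t = (LBINT u. indicator {0..1} u * cardinal_bspline p (t - u))"
proof -
  have "cardinal_bspline (Suc p) t = (LBINT x. indicator {t - 1..t} x * cardinal_bspline p x)"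
    by (simp add: cardinal_bspline_eq_integral set_lebesgue_integral_def)
  also have "\<dots> = (LBINT u. indicator {t - 1..t} (t + (- 1) * u) * cardinal_bspline p (t + (- 1) * u))"
    using lborel_integral_real_affine[of "- 1" "\<lambda>x. indicator {t - 1..t} x * cardinal_bspline p x" t] by simp
  also have "\<dots> = (LBINT u. indicator {0..1} u * cardinal_bspline p (t - u))"
    by (intro Bochner_Integration.integral_cong) (auto simp: indicator_def)
  finally show ?thesis .
qed

text \<open>A B-spline is the convolution of indicator functions of \<open>[0, 1)\<close>, so the correlation of
  two of them is again a B-spline.\<close>

lemma integral_cardinal_bspline_mult:
  "(LBINT t. cardinal_bspline p t * cardinal_bspline q (t + s)) = cardinal_bspline (p + q + 1) (real p + 1 + s)"
proof (induction q arbitrary: s)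
  case 0
  have "(LBINT t. cardinal_bspline p t * cardinal_bspline 0 (t + s))
      = (LBINT t. indicator {(1 - s) - 1..1 - s} t * cardinal_bspline p t)"
  proof (rule integral_cong_AE)
    \<comment> \<open>The spline of degree \<open>0\<close> lives on a half-open interval; the
      endpoint added by its closure is a null set.\<close>
    show "AE t in lborel. cardinal_bspline p t * cardinal_bspline 0 (t + s)
        = indicator {(1 - s) - 1..1 - s} t * cardinal_bspline p t"
      using AE_lborel_singleton[of "1 - s"] by eventually_elim (auto simp: indicator_def)
  qed measurable
  also have "\<dots> = cardinal_bspline (Suc p) (1 - s)"
    by (simp add: cardinal_bspline_eq_integral set_lebesgue_integral_def)
  also have "\<dots> = cardinal_bspline (Suc p) (real p + 2 - (1 - s))"
    by (rule cardinal_bspline_reflect[symmetric])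
  finally show ?case by (simp add: add.commute add.left_commute)
next
  case (Suc q)
  \<comment> \<open>The integrand once the convolution for degree \<open>q + 1\<close> is unfolded.
    Boundedness and support in a rectangle justify Fubini.\<close>
  define g where "g t u = indicator {0..1} u * (cardinal_bspline p t * cardinal_bspline q (t + s - u))" for t u :: real
  have int: "integrable (lborel \<Otimes>\<^sub>M lborel) (\<lambda>(u, t). g t u)"
  proof (rule integrableI_bounded_set[where A = "{0..1} \<times> {0..real p + 1}" and B = "2 ^ p * 2 ^ q"])
    show "(\<lambda>(u, t). g t u) \<in> borel_measurable (lborel \<Otimes>\<^sub>M lborel)"
      unfolding g_def by measurable
    have "emeasure (lborel \<Otimes>\<^sub>M lborel) ({0..1::real} \<times> {0..real p + 1}) = emeasure lborel {0..1::real} * emeasure lborel {0..real p + 1}"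
      by (rule lborel.emeasure_pair_measure_Times) auto
    then show "emeasure (lborel \<Otimes>\<^sub>M lborel) ({0..1::real} \<times> {0..real p + 1}) < \<infinity>"
      by (simp add: ennreal_mult_less_top)
    have "\<bar>cardinal_bspline p t * cardinal_bspline q (t + s - u)\<bar> \<le> 2 ^ p * 2 ^ q" for t u
      unfolding abs_mult by (intro mult_mono abs_cardinal_bspline_le) auto
    then show "AE x\<in>{0..1} \<times> {0..real p + 1} in lborel \<Otimes>\<^sub>M lborel. norm (case x of (u, t) \<Rightarrow> g t u) \<le> 2 ^ p * 2 ^ q"
      by (auto simp: g_def indicator_def)
    have "g t u = 0" if "(u, t) \<notin> {0..1} \<times> {0..real p + 1}" for t u
      using that cardinal_bspline_eq_0[of t p] unfolding g_def by (cases "u \<in> {0..1}") auto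
    then show "AE x in lborel \<Otimes>\<^sub>M lborel. x \<notin> {0..1} \<times> {0..real p + 1} \<longrightarrow> (case x of (u, t) \<Rightarrow> g t u) = 0"
      by (intro AE_I2) (metis case_prod_unfold prod.collapse)
  qed auto
  have "(LBINT t. cardinal_bspline p t * cardinal_bspline (Suc q) (t + s)) = (LBINT t. LBINT u. g t u)"
    unfolding cardinal_bspline_eq_convolution g_def
    by (simp add: mult.left_commute flip: integral_mult_right_zero)
  also have "\<dots> = (LBINT u. LBINT t. g t u)"
    by (rule lborel_pair.Fubini_integral[OF int])
  also have "\<dots> = (LBINT u. indicator {0..1} u * cardinal_bspline (p + q + 1) (real p + 1 + s - u))"
  proof (intro Bochner_Integration.integral_cong refl)
    fix u :: real
    show "(LBINT t. g t u) = indicator {0..1} u * cardinal_bspline (p + q + 1) (real p + 1 + s - u)"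
    proof -
      have "(LBINT t. g t u) = indicator {0..1} u * (LBINT t. cardinal_bspline p t * cardinal_bspline q (t + (s - u)))"
        by (simp add: g_def add_diff_eq)
      then show ?thesis unfolding Suc by (simp add: add_diff_eq)
    qed
  qed
  also have "\<dots> = cardinal_bspline (p + Suc q + 1) (real p + 1 + s)"
    using cardinal_bspline_eq_convolution[of "p + q + 1" "real p + 1 + s"] by (simp)
  finally show ?case .
qed

lemma integral_cardinal_bspline_shift:
  "(LBINT t. cardinal_bspline p (t - a) * cardinal_bspline q (t - b)) = cardinal_bspline (p + q + 1) (real p + 1 + (a - b))"
proof -
  have "(LBINT t. cardinal_bspline p (t - a) * cardinal_bspline q (t - b))
      = (LBINT t. cardinal_bspline p t * cardinal_bspline q (t + (a - b)))"
    using lborel_integral_real_affine[of 1 "\<lambda>t. cardinal_bspline p (t - a) * cardinal_bspline q (t - b)" a]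
    by (simp add: algebra_simps)
  then show ?thesis by (simp only: integral_cardinal_bspline_mult)
qed

lemma deriv_cardinal_bspline:
  "deriv (cardinal_bspline (Suc (Suc p))) = (\<lambda>t. cardinal_bspline (Suc p) t - cardinal_bspline (Suc p) (t - 1))"
  by (rule ext) (rule DERIV_imp_deriv[OF has_real_derivative_cardinal_bspline])

text \<open>From degree \<open>3\<close> on the first derivative is a difference of splines that are
  differentiable everywhere; the symbols use degree \<open>2 * p + 1\<close>, which is at least
  \<open>3\<close> for \<open>p \<ge> 1\<close>.\<close>

lemma deriv2_cardinal_bspline:
  "(deriv ^^ 2) (cardinal_bspline (Suc (Suc (Suc p)))) =
    (\<lambda>t. cardinal_bspline (Suc p) t - 2 * cardinal_bspline (Suc p) (t - 1) + cardinal_bspline (Suc p) (t - 2))"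
proof
  fix t
  let ?B = "cardinal_bspline (Suc (Suc p))" and ?A = "cardinal_bspline (Suc p)"
  have 1: "(?B has_real_derivative ?A x - ?A (x - 1)) (at x)" for x
    by (rule has_real_derivative_cardinal_bspline)
  have "((\<lambda>x. ?B (x - 1)) has_real_derivative ?A (t - 1) - ?A (t - 1 - 1)) (at t)"
    using DERIV_shift[of ?B "?A (t - 1) - ?A (t - 1 - 1)" t "- 1"] 1[of "t - 1"] by simp
  from DERIV_diff[OF 1 this]
  have "((\<lambda>x. ?B x - ?B (x - 1)) has_real_derivative ?A t - 2 * ?A (t - 1) + ?A (t - 2)) (at t)"
    by (simp add: algebra_simps)
  then show "(deriv ^^ 2) (cardinal_bspline (Suc (Suc (Suc p)))) t = ?A t - 2 * ?A (t - 1) + ?A (t - 2)"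
    unfolding numeral_2_eq_2 funpow.simps comp_def deriv_cardinal_bspline id_def
    by (intro DERIV_imp_deriv)
qed

section \<open>B-splines on the open knot sequence\<close>

text \<open>Truncated subtraction and \<open>min\<close> encode the repeated boundary knots, which
  turns order and spacing of knots into facts about natural numbers.\<close>

lemma knot_eq: "n > 0 \<Longrightarrow> knot p n i = real (min (i - (p + 1)) n) / real n"
  by (auto simp: knot_def min_def of_nat_diff)

lemma knot_mono: "n > 0 \<Longrightarrow> i \<le> j \<Longrightarrow> knot p n i \<le> knot p n j"
  by (simp add: knot_eq divide_right_mono)

lemma knot_diff_le: "n > 0 \<Longrightarrow> knot p n (i + k) - knot p n i \<le> real k / real n"
  by (simp add: knot_eq flip: diff_divide_distrib) (auto intro!: divide_right_mono simp: min_def of_nat_diff)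

text \<open>Knots are multiples of \<open>1 / n\<close>: distinct ones are at least that far apart,
  and for equal ones division by zero gives \<open>0\<close>.\<close>

lemma inverse_knot_diff_le:
  assumes "n > 0"
  shows "\<bar>1 / (knot p n j - knot p n i)\<bar> \<le> real n"
proof -
  define a where "a = int (min (j - (p + 1)) n) - int (min (i - (p + 1)) n)"
  have "knot p n j - knot p n i = of_int a / real n"
    using assms by (simp add: knot_eq a_def diff_divide_distrib)
  moreover have "\<bar>1 / (of_int a / real n)\<bar> \<le> real n"
  proof (cases "a = 0")
    case False
    then have "1 \<le> \<bar>a\<bar>" by simp
    then have "1 \<le> \<bar>real_of_int a\<bar>" by linarith
    then show ?thesis using assms by (auto simp: abs_divide divide_simps mult_le_cancel_left1)
  qed simp
  ultimately show ?thesis by simp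
qed

lemma bspline_support:
  assumes "n > 0" "bspline p n k i x \<noteq> 0"
  shows "knot p n i \<le> x \<and> x < knot p n (i + k + 1)"
  using assms(2)
proof (induction k arbitrary: i)
  case (Suc k)
  from Suc.prems have "bspline p n k i x \<noteq> 0 \<or> bspline p n k (i + 1) x \<noteq> 0" by auto
  then consider "bspline p n k i x \<noteq> 0" | "bspline p n k (i + 1) x \<noteq> 0" by blast
  then show ?case
  proof cases
    case 1
    then show ?thesis using Suc.IH[of i] knot_mono[OF assms(1), of "i + k + 1" "i + Suc k + 1" p] by fastforce
  next
    case 2
    then show ?thesis using Suc.IH[of "i + 1"] knot_mono[OF assms(1), of i "i + 1" p] by fastforce
  qed
qed (auto split: if_splits)

lemma abs_ratio_le_1: "a \<le> x \<Longrightarrow> x < b \<Longrightarrow> \<bar>(x - a) / (b - a)\<bar> \<le> (1::real)"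
  "a \<le> x \<Longrightarrow> x < b \<Longrightarrow> \<bar>(b - x) / (b - a)\<bar> \<le> (1::real)"
  by (auto simp: abs_divide divide_simps)

text \<open>The family \<open>z\<close> stands for the B-splines of degree \<open>k\<close> or for
  their derivatives at \<open>x\<close>. Where a member is nonzero its weight is at most
  \<open>1\<close>, also at repeated knots, so the bound survives in each summand of the
  recursion.\<close>

lemma abs_bspline_step_le:
  assumes n: "n > 0" and z: "\<And>i. z i \<noteq> 0 \<Longrightarrow> knot p n i \<le> x \<and> x < knot p n (i + k + 1)"
    and le: "\<And>i. \<bar>z i\<bar> \<le> c"
  shows "\<bar>(x - knot p n i) / (knot p n (i + Suc k) - knot p n i) * z i\<bar> \<le> c"
    "\<bar>(knot p n (i + Suc k + 1) - x) / (knot p n (i + Suc k + 1) - knot p n (i + 1)) * z (i + 1)\<bar> \<le> c"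
proof -
  have c: "0 \<le> c" using le[of i] by linarith
  show "\<bar>(x - knot p n i) / (knot p n (i + Suc k) - knot p n i) * z i\<bar> \<le> c"
  proof (cases "z i = 0")
    case False
    then have "\<bar>(x - knot p n i) / (knot p n (i + Suc k) - knot p n i)\<bar> \<le> 1"
      using z[OF False] by (intro abs_ratio_le_1) auto
    from mult_mono[OF this le[of i]] show ?thesis by (simp add: abs_mult)
  qed (use c in simp)
  show "\<bar>(knot p n (i + Suc k + 1) - x) / (knot p n (i + Suc k + 1) - knot p n (i + 1)) * z (i + 1)\<bar> \<le> c"
  proof (cases "z (i + 1) = 0")
    case False
    then have "\<bar>(knot p n (i + Suc k + 1) - x) / (knot p n (i + Suc k + 1) - knot p n (i + 1))\<bar> \<le> 1"
      using z[OF False] by (intro abs_ratio_le_1) auto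
    from mult_mono[OF this le[of "i + 1"]] show ?thesis by (simp add: abs_mult)
  qed (use c in simp)
qed

lemma abs_bspline_le:
  assumes "n > 0"
  shows "\<bar>bspline p n k i x\<bar> \<le> 2 ^ k"
proof (induction k arbitrary: i)
  case (Suc k)
  note step = abs_bspline_step_le[OF assms, of "\<lambda>i. bspline p n k i x" p x k "2 ^ k",
      OF bspline_support[OF assms] Suc]
  show ?case
    unfolding bspline.simps(2) power_Suc mult_2
    by (rule order_trans[OF abs_triangle_ineq add_mono[OF step]])
qed simp

lemma bspline_0_has_derivative:
  assumes "x \<noteq> knot p n i" "x \<noteq> knot p n (i + 1)"
  shows "(bspline p n 0 i has_real_derivative 0) (at x)"
proof (rule has_field_derivative_transform_within_open)
  let ?S = "\<lambda>a. if a < x then {a<..} else {..<a} :: real set"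
  show "((\<lambda>_. bspline p n 0 i x) has_real_derivative 0) (at x)" by simp
  show "open (?S (knot p n i) \<inter> ?S (knot p n (i + 1)))" by (intro open_Int) auto
  show "x \<in> ?S (knot p n i) \<inter> ?S (knot p n (i + 1))" using assms by auto
  show "bspline p n 0 i x = bspline p n 0 i y" if "y \<in> ?S (knot p n i) \<inter> ?S (knot p n (i + 1))" for y
    using that assms by (auto split: if_splits)
qed

text \<open>The product rule adds \<open>2 * 2 ^ k * real n\<close> from the two weights to twice
  the previous bound, whence the constant. The support is carried along because the estimate of the
  recursion step asks for it.\<close>

lemma bspline_has_derivative_bounded:
  assumes n: "n > 0" and x: "x \<notin> range (knot p n)"
  shows "\<exists>D. (bspline p n k i has_real_derivative D) (at x) \<and> \<bar>D\<bar> \<le> real k * 2 ^ k * real n \<and>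
    (D \<noteq> 0 \<longrightarrow> knot p n i \<le> x \<and> x < knot p n (i + k + 1))"
proof (induction k arbitrary: i)
  case 0
  have "x \<noteq> knot p n i" "x \<noteq> knot p n (i + 1)" using x by auto
  then have "(bspline p n 0 i has_real_derivative 0) (at x)" by (rule bspline_0_has_derivative)
  then show ?case by (intro exI[of _ 0]) (simp del: bspline.simps)
next
  case (Suc k)
  then obtain D where D: "\<And>i. (bspline p n k i has_real_derivative D i) (at x)"
    "\<And>i. \<bar>D i\<bar> \<le> real k * 2 ^ k * real n"
    "\<And>i. D i \<noteq> 0 \<Longrightarrow> knot p n i \<le> x \<and> x < knot p n (i + k + 1)" by metis
  define N where "N i = bspline p n k i x" for i
  let ?\<xi> = "knot p n"
  define d where "d = (1 - 0) / (?\<xi> (i + Suc k) - ?\<xi> i) * N i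
    + D i * ((x - ?\<xi> i) / (?\<xi> (i + Suc k) - ?\<xi> i))
    + ((0 - 1) / (?\<xi> (i + Suc k + 1) - ?\<xi> (i + 1)) * N (i + 1)
    + D (i + 1) * ((?\<xi> (i + Suc k + 1) - x) / (?\<xi> (i + Suc k + 1) - ?\<xi> (i + 1))))"
  have "((\<lambda>x. (x - ?\<xi> i) / (?\<xi> (i + Suc k) - ?\<xi> i) * bspline p n k i x
      + (?\<xi> (i + Suc k + 1) - x) / (?\<xi> (i + Suc k + 1) - ?\<xi> (i + 1)) * bspline p n k (i + 1) x)
      has_real_derivative d) (at x)"
    unfolding d_def N_def
    by (intro DERIV_add DERIV_mult DERIV_cdivide DERIV_diff DERIV_const DERIV_ident D(1))
  moreover have "bspline p n (Suc k) i = (\<lambda>x. (x - ?\<xi> i) / (?\<xi> (i + Suc k) - ?\<xi> i) * bspline p n k i x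
      + (?\<xi> (i + Suc k + 1) - x) / (?\<xi> (i + Suc k + 1) - ?\<xi> (i + 1)) * bspline p n k (i + 1) x)"
    by (rule ext) (rule bspline.simps(2))
  ultimately have "(bspline p n (Suc k) i has_real_derivative d) (at x)" by simp
  moreover have "\<bar>d\<bar> \<le> real (Suc k) * 2 ^ Suc k * real n"
  proof -
    have N: "\<bar>N j\<bar> \<le> 2 ^ k" for j unfolding N_def by (rule abs_bspline_le[OF n])
    have 1: "\<bar>(1 - 0) / (?\<xi> (i + Suc k) - ?\<xi> i) * N i\<bar> \<le> real n * 2 ^ k"
      unfolding abs_mult diff_0_right by (intro mult_mono inverse_knot_diff_le n N) auto
    have "\<bar>(0 - 1) / (?\<xi> (i + Suc k + 1) - ?\<xi> (i + 1)) * N (i + 1)\<bar>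
        = \<bar>1 / (?\<xi> (i + Suc k + 1) - ?\<xi> (i + 1))\<bar> * \<bar>N (i + 1)\<bar>"
      by (simp add: abs_mult abs_divide)
    also have "\<dots> \<le> real n * 2 ^ k"
      by (intro mult_mono inverse_knot_diff_le n N) auto
    finally have 2: "\<bar>(0 - 1) / (?\<xi> (i + Suc k + 1) - ?\<xi> (i + 1)) * N (i + 1)\<bar> \<le> real n * 2 ^ k" .
    note step = abs_bspline_step_le[OF n, of D p x k "real k * 2 ^ k * real n", OF D(3,2)]
    have "\<bar>a + b + (c + e)\<bar> \<le> \<bar>a\<bar> + \<bar>b\<bar> + (\<bar>c\<bar> + \<bar>e\<bar>)" for a b c e :: real by linarith
    from this have "\<bar>d\<bar> \<le> real n * 2 ^ k + real k * 2 ^ k * real n + (real n * 2 ^ k + real k * 2 ^ k * real n)"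
      unfolding d_def mult.commute[of "D _"]
      by (rule order_trans[OF _ add_mono[OF add_mono[OF 1 step(1)] add_mono[OF 2 step(2)]]])
    also have "\<dots> = real (Suc k) * 2 ^ Suc k * real n" by (simp add: algebra_simps)
    finally show ?thesis .
  qed
  moreover have "?\<xi> i \<le> x \<and> x < ?\<xi> (i + Suc k + 1)" if "d \<noteq> 0"
  proof -
    have supp: "?\<xi> j \<le> x \<and> x < ?\<xi> (j + k + 1)" if "N j \<noteq> 0 \<or> D j \<noteq> 0" for j
      using that D(3) bspline_support[OF n] unfolding N_def by blast
    have "(N i \<noteq> 0 \<or> D i \<noteq> 0) \<or> (N (i + 1) \<noteq> 0 \<or> D (i + 1) \<noteq> 0)"
      using \<open>d \<noteq> 0\<close> by (auto simp: d_def)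
    then show ?thesis
    proof
      assume "N i \<noteq> 0 \<or> D i \<noteq> 0"
      from supp[OF this] show ?thesis using knot_mono[OF n, of "i + k + 1" "i + Suc k + 1" p] by fastforce
    next
      assume "N (i + 1) \<noteq> 0 \<or> D (i + 1) \<noteq> 0"
      from supp[OF this] show ?thesis using knot_mono[OF n, of i "i + 1" p] by fastforce
    qed
  qed
  ultimately show ?case by blast
qed

text \<open>The index range makes the knots \<open>i\<close> to \<open>i + k + 1\<close> equally
  spaced with step \<open>1 / n\<close>; after rescaling, both recursions coincide.\<close>

lemma bspline_eq_cardinal_bspline:
  assumes "n > 0" "p + 1 \<le> i" "i + k \<le> p + n"
  shows "bspline p n k i x = cardinal_bspline k (real n * x - real (i - (p + 1)))"
  using assms(2,3)
proof (induction k arbitrary: i)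
  case 0
  have \<xi>: "knot p n i = real (i - (p + 1)) / real n" "knot p n (i + 1) = (real (i - (p + 1)) + 1) / real n"
    using assms(1) 0 by (auto simp: knot_eq min_def Suc_diff_le)
  show ?case unfolding bspline.simps(1) \<xi> using assms(1) by (simp add: field_simps)
next
  case (Suc k)
  define a where "a = real (i - (p + 1))"
  have \<xi>: "knot p n (i + j) = (a + real j) / real n" if "j \<le> Suc k + 1" for j
    using assms(1) Suc.prems that by (auto simp: knot_eq min_def a_def of_nat_diff)
  have \<xi>': "knot p n i = a / real n" "knot p n (i + 1) = (a + 1) / real n"
    "knot p n (i + Suc k) = (a + real (Suc k)) / real n"
    "knot p n (i + Suc k + 1) = (a + real (Suc k) + 1) / real n"
    using \<xi>[of 0] \<xi>[of 1] \<xi>[of "Suc k"] \<xi>[of "Suc k + 1"] by (simp_all add: add.assoc)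
  have "real (i + 1 - (p + 1)) = a + 1" using Suc.prems by (simp add: a_def of_nat_diff)
  then have IH: "bspline p n k i x = cardinal_bspline k (real n * x - a)"
    "bspline p n k (i + 1) x = cardinal_bspline k (real n * x - a - 1)"
    using Suc.IH[of i] Suc.IH[of "i + 1"] Suc.prems by (simp_all add: a_def algebra_simps)
  have "(x - a / real n) / ((a + real (Suc k)) / real n - a / real n) = (real n * x - a) / real (Suc k)"
    using assms(1) by (simp add: divide_simps)
  moreover have "((a + real (Suc k) + 1) / real n - x) / ((a + real (Suc k) + 1) / real n - (a + 1) / real n)
      = (real (Suc k) + 1 - (real n * x - a)) / real (Suc k)"
    using assms(1) by (simp add: divide_simps)
  ultimately show ?case
    unfolding bspline.simps(2) \<xi>' IH cardinal_bspline.simps(2) a_def[symmetric] by simp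
qed

section \<open>Entries of the univariate matrices\<close>

text \<open>What is asked of splines near the boundary, for values with \<open>C\<close> of order
  \<open>1\<close> and for derivatives with \<open>C\<close> of order \<open>n\<close>. Knots are
  left out because \<open>deriv\<close> may be unspecified there.\<close>

definition spline_bounded :: "nat \<Rightarrow> nat \<Rightarrow> nat \<Rightarrow> real \<Rightarrow> (real \<Rightarrow> real) \<Rightarrow> bool" where
  "spline_bounded p n i C F \<longleftrightarrow> (\<forall>x. x \<notin> range (knot p n) \<longrightarrow>
     \<bar>F x\<bar> \<le> C \<and> (F x \<noteq> 0 \<longrightarrow> knot p n i \<le> x \<and> x < knot p n (i + p + 1)))"

text \<open>The factor \<open>p + 1\<close> anticipates the bound for derivatives, so that one
  constant serves both.\<close>

lemma spline_bounded_bspline: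
  assumes "n > 0"
  shows "spline_bounded p n i (real (p + 1) * 2 ^ p) (bspline p n p i)"
proof -
  have "\<bar>bspline p n p i x\<bar> \<le> real (p + 1) * 2 ^ p" for x
  proof -
    have "\<bar>bspline p n p i x\<bar> \<le> 1 * 2 ^ p" using abs_bspline_le[OF assms] by simp
    also have "\<dots> \<le> real (p + 1) * 2 ^ p" by (intro mult_right_mono) auto
    finally show ?thesis .
  qed
  then show ?thesis using bspline_support[OF assms] unfolding spline_bounded_def by blast
qed

lemma spline_bounded_deriv_bspline:
  assumes "n > 0"
  shows "spline_bounded p n i (real (p + 1) * 2 ^ p * real n) (deriv (bspline p n p i))"
  unfolding spline_bounded_def
proof (intro allI impI)
  fix x assume "x \<notin> range (knot p n)"
  from bspline_has_derivative_bounded[OF assms this, of p i]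
  obtain D where D: "(bspline p n p i has_real_derivative D) (at x)" "\<bar>D\<bar> \<le> real p * 2 ^ p * real n"
    "D \<noteq> 0 \<longrightarrow> knot p n i \<le> x \<and> x < knot p n (i + p + 1)" by blast
  have "real p * 2 ^ p * real n \<le> real (p + 1) * 2 ^ p * real n"
    by (intro mult_right_mono) auto
  then have "\<bar>D\<bar> \<le> real (p + 1) * 2 ^ p * real n" by (rule order_trans[OF D(2)])
  moreover have "deriv (bspline p n p i) x = D" by (rule DERIV_imp_deriv[OF D(1)])
  ultimately show "\<bar>deriv (bspline p n p i) x\<bar> \<le> real (p + 1) * 2 ^ p * real n \<and>
      (deriv (bspline p n p i) x \<noteq> 0 \<longrightarrow> knot p n i \<le> x \<and> x < knot p n (i + p + 1))"
    using D(3) by simp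
qed

lemma AE_not_knot: "AE x in lborel. x \<notin> range (knot p n)"
  by (rule AE_not_in) (intro countable_imp_null_set_lborel countable_image, simp)

lemma integral_eq_0_of_disjoint_support:
  assumes n: "n > 0" and F: "spline_bounded p n i C F" and G: "spline_bounded p n j D G"
    and ij: "\<bar>int i - int j\<bar> > int p"
  shows "(LBINT x:{0..1}. F x * G x) = 0"
  unfolding set_lebesgue_integral_def
proof (rule integral_eq_zero_AE)
  show "AE x in lborel. indicat_real {0..1} x *\<^sub>R (F x * G x) = 0"
    using AE_not_knot[of p n]
  proof eventually_elim
    case (elim x)
    have "F x * G x = 0"
    proof (rule ccontr)
      assume "F x * G x \<noteq> 0"
      then have F': "knot p n i \<le> x" "x < knot p n (i + p + 1)" and G': "knot p n j \<le> x" "x < knot p n (j + p + 1)"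
        using F[unfolded spline_bounded_def, rule_format, OF elim] G[unfolded spline_bounded_def, rule_format, OF elim]
        by auto
      show False
      proof (cases "i < j")
        case True
        then have "knot p n (i + p + 1) \<le> knot p n j" using ij by (intro knot_mono n) linarith
        then show False using F' G' by linarith
      next
        case False
        then have "knot p n (j + p + 1) \<le> knot p n i" using ij by (intro knot_mono n) linarith
        then show False using F' G' by linarith
      qed
    qed
    then show ?case by simp
  qed
qed

lemma abs_integral_spline_bounded_le:
  assumes n: "n > 0" and F: "spline_bounded p n i C F" and G: "spline_bounded p n j D G"
    and CD: "0 \<le> C" "0 \<le> D"
  shows "\<bar>LBINT x:{0..1}. F x * G x\<bar> \<le> C * D * (real (p + 1) / real n)"
\<comment> \<open>A non-integrable function has integral \<open>0\<close> by convention and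
  satisfies the bound trivially, which avoids proving measurability of \<open>deriv\<close>.\<close>
proof (cases "set_integrable lborel {0..1} (\<lambda>x. F x * G x)")
  case True
  let ?I = "{knot p n i..knot p n (i + p + 1)}"
  have "\<bar>LBINT x:{0..1}. F x * G x\<bar> \<le> (LBINT x. norm (indicat_real {0..1} x *\<^sub>R (F x * G x)))"
    unfolding set_lebesgue_integral_def real_norm_def[symmetric] by (rule integral_norm_bound)
  also have "\<dots> \<le> (LBINT x. C * D * indicator ?I x)"
  proof (rule integral_mono_AE)
    show "integrable lborel (\<lambda>x. norm (indicat_real {0..1} x *\<^sub>R (F x * G x)))"
      using True unfolding set_integrable_def by (rule integrable_norm)
    show "integrable lborel (\<lambda>x. C * D * indicat_real ?I x)"
      by (intro integrable_mult_right integrable_real_indicator emeasure_bounded_finite) auto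
    show "AE x in lborel. norm (indicat_real {0..1} x *\<^sub>R (F x * G x)) \<le> C * D * indicator ?I x"
      using AE_not_knot[of p n]
    proof eventually_elim
      case (elim x)
      have FG: "\<bar>F x\<bar> \<le> C" "\<bar>G x\<bar> \<le> D" "F x \<noteq> 0 \<Longrightarrow> x \<in> ?I"
        using F[unfolded spline_bounded_def, rule_format, OF elim] G[unfolded spline_bounded_def, rule_format, OF elim]
        by auto
      show ?case
      proof (cases "F x = 0")
        case False
        have "norm (indicat_real {0..1} x *\<^sub>R (F x * G x)) \<le> \<bar>F x\<bar> * \<bar>G x\<bar>"
          by (auto simp: indicator_def abs_mult)
        also have "\<dots> \<le> C * D" using FG CD by (intro mult_mono) auto
        finally show ?thesis using FG(3)[OF False] by simp
      qed (use CD in auto)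
    qed
  qed
  also have "\<dots> = C * D * (knot p n (i + p + 1) - knot p n i)"
    using knot_mono[OF n, of i "i + p + 1" p] by simp
  also have "\<dots> \<le> C * D * (real (p + 1) / real n)"
    using knot_diff_le[OF n, of p i "p + 1"] CD by (intro mult_left_mono) (auto simp: add.assoc)
  finally show ?thesis .
next
  case False
  then have "(LBINT x:{0..1}. F x * G x) = 0"
    unfolding set_integrable_def set_lebesgue_integral_def by (rule not_integrable_integral_eq)
  then show ?thesis using CD by simp
qed

text \<open>The derivative of \<open>cardinal_bspline p\<close> off the integers, continued by the
  difference formula; for \<open>p = 1\<close> the spline has kinks there.\<close>

definition cardinal_deriv :: "nat \<Rightarrow> real \<Rightarrow> real" where
  "cardinal_deriv p t = cardinal_bspline (p - 1) t - cardinal_bspline (p - 1) (t - 1)"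

lemma cardinal_deriv_eq_0: "p \<ge> 1 \<Longrightarrow> t < 0 \<or> real p + 1 \<le> t \<Longrightarrow> cardinal_deriv p t = 0"
  using cardinal_bspline_eq_0[of t "p - 1"] cardinal_bspline_eq_0[of "t - 1" "p - 1"]
  by (auto simp: cardinal_deriv_def of_nat_diff)

lemma deriv_bspline_eq_cardinal_deriv:
  assumes "n > 0" "p + 1 \<le> i" "i \<le> n" "p \<ge> 1" and x: "real n * x \<notin> \<int>"
  shows "deriv (bspline p n p i) x = real n * cardinal_deriv p (real n * x - real (i - (p + 1)))"
proof -
  obtain q where q: "p = Suc q" using assms(4) by (cases p) auto
  let ?a = "real (i - (p + 1))"
  have eq: "bspline p n p i = (\<lambda>x. cardinal_bspline p (real n * x - ?a))"
    using bspline_eq_cardinal_bspline[OF assms(1,2), of p] assms(3) by auto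
  have "real n * x - ?a \<notin> \<int>" using x by (metis Ints_add Ints_of_nat diff_add_cancel)
  from has_real_derivative_cardinal_bspline_nonint[OF this, of q]
  have "(cardinal_bspline p has_real_derivative cardinal_deriv p (real n * x - ?a)) (at (real n * x - ?a))"
    by (simp add: cardinal_deriv_def q)
  moreover have "((\<lambda>x. real n * x - ?a) has_real_derivative real n) (at x)"
    by (auto intro!: derivative_eq_intros)
  ultimately have "((\<lambda>x. cardinal_bspline p (real n * x - ?a)) has_real_derivative
      cardinal_deriv p (real n * x - ?a) * real n) (at x)"
    by (rule DERIV_chain2)
  then show ?thesis unfolding eq by (simp add: DERIV_imp_deriv mult.commute)
qed

text \<open>The substitution \<open>t = n * x\<close> yields the factor \<open>1 / n\<close>. The
  condition on \<open>a\<close> puts the support of \<open>f\<close> inside the unit interval, so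
  the integral extends to the whole line; the exceptional grid points are countable.\<close>

lemma integral_interior_spline:
  assumes n: "n > 0"
    and F: "\<And>x. real n * x \<notin> \<int> \<Longrightarrow> F x = cF * f (real n * x - real a)"
    and G: "\<And>x. real n * x \<notin> \<int> \<Longrightarrow> G x = cG * g (real n * x - real b)"
    and f: "\<And>t. t < 0 \<or> real p + 1 \<le> t \<Longrightarrow> f t = 0" and a: "a + p + 1 \<le> n"
  shows "(LBINT x:{0..1}. F x * G x) = cF * cG / real n * (LBINT t. f (t - real a) * g (t - real b))"
proof -
  define X where "X = (\<lambda>k. real_of_int k / real n) ` UNIV"
  have X: "real n * x \<notin> \<int>" if "x \<notin> X" for x
  proof
    assume "real n * x \<in> \<int>"
    then obtain k where "real n * x = of_int k" by (auto elim: Ints_cases)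
    then have "x = of_int k / real n" using n by (simp add: field_simps)
    then show False using that by (auto simp: X_def)
  qed
  have z: "f (real n * x - real a) = 0" if "x \<notin> {0..1}" for x
  proof (rule f)
    have "x < 0 \<or> 1 < x" using that by auto
    then show "real n * x - real a < 0 \<or> real p + 1 \<le> real n * x - real a"
    proof
      assume "x < 0"
      then have "real n * x < 0" using n by (simp add: mult_pos_neg)
      then show ?thesis by simp
    next
      assume "1 < x"
      then have "real n * 1 \<le> real n * x" using n by (intro mult_left_mono) auto
      moreover have "real a + real p + 1 \<le> real n" using a by linarith
      ultimately show ?thesis by linarith
    qed
  qed
  have "(LBINT x:{0..1}. F x * G x) = (LBINT x. cF * cG * (f (real n * x - real a) * g (real n * x - real b)))"
    unfolding set_lebesgue_integral_def
  proof (rule integral_discrete_difference[where X = X])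
    show "countable X" unfolding X_def by simp
    fix x assume "x \<notin> X"
    from X[OF this] show "indicat_real {0..1} x *\<^sub>R (F x * G x)
        = cF * cG * (f (real n * x - real a) * g (real n * x - real b))"
      using F G z[of x] by (cases "x \<in> {0..1}") (simp_all add: mult_ac)
  qed auto
  also have "\<dots> = cF * cG * (LBINT x. f (real n * x - real a) * g (real n * x - real b))"
    by (rule integral_mult_right_zero)
  also have "(LBINT x. f (real n * x - real a) * g (real n * x - real b)) =
      (LBINT t. f (t - real a) * g (t - real b)) / real n"
    using lborel_integral_real_affine[of "real n" "\<lambda>t. f (t - real a) * g (t - real b)" 0] n
    by simp
  finally show ?thesis by simp
qed

section \<open>Toeplitz coefficients as correlations\<close>

lemma integrable_cardinal_bspline_mult:
  "integrable lborel (\<lambda>t. cardinal_bspline p (t - a) * cardinal_bspline q (t - b))"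
proof (rule integrableI_bounded_set[where A = "{a..a + real p + 1}" and B = "2 ^ p * 2 ^ q"])
  have "\<bar>cardinal_bspline p (t - a) * cardinal_bspline q (t - b)\<bar> \<le> 2 ^ p * 2 ^ q" for t
    unfolding abs_mult by (intro mult_mono abs_cardinal_bspline_le) auto
  then show "AE t\<in>{a..a + real p + 1} in lborel. norm (cardinal_bspline p (t - a) * cardinal_bspline q (t - b)) \<le> 2 ^ p * 2 ^ q"
    by simp
  have "cardinal_bspline p (t - a) = 0" if "t \<notin> {a..a + real p + 1}" for t
    using that by (intro cardinal_bspline_eq_0) auto
  then show "AE t in lborel. t \<notin> {a..a + real p + 1} \<longrightarrow> cardinal_bspline p (t - a) * cardinal_bspline q (t - b) = 0"
    by simp
qed auto

lemma integral_cardinal_bspline_mult_deriv: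
  assumes "p \<ge> 1"
  shows "(LBINT t. cardinal_bspline p (t - a) * cardinal_deriv p (t - b))
    = deriv (cardinal_bspline (2 * p + 1)) (real p + 1 + (a - b))"
proof -
  obtain q where q: "p = Suc q" using assms by (cases p) auto
  have "(LBINT t. cardinal_bspline p (t - a) * cardinal_deriv p (t - b))
      = (LBINT t. cardinal_bspline p (t - a) * cardinal_bspline q (t - b)
          - cardinal_bspline p (t - a) * cardinal_bspline q (t - (b + 1)))"
    by (simp add: cardinal_deriv_def q algebra_simps)
  also have "\<dots> = cardinal_bspline (p + q + 1) (real p + 1 + (a - b)) - cardinal_bspline (p + q + 1) (real p + 1 + (a - (b + 1)))"
    by (simp add: integral_cardinal_bspline_shift integrable_cardinal_bspline_mult)
  also have "\<dots> = deriv (cardinal_bspline (2 * p + 1)) (real p + 1 + (a - b))"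
  proof -
    have "2 * p + 1 = Suc (Suc (2 * q + 1))" "p + q + 1 = Suc (2 * q + 1)" using q by auto
    then show ?thesis by (simp only: deriv_cardinal_bspline) (simp add: algebra_simps)
  qed
  finally show ?thesis .
qed

text \<open>Expanding both differences gives four correlations, hence a second difference of the
  spline of degree \<open>2 * p - 1\<close>; the minus sign is that of integration by parts.\<close>

lemma integral_cardinal_deriv_mult:
  assumes "p \<ge> 1"
  shows "(LBINT t. cardinal_deriv p (t - a) * cardinal_deriv p (t - b))
    = - (deriv ^^ 2) (cardinal_bspline (2 * p + 1)) (real p + 1 + (a - b))"
proof -
  obtain q where q: "p = Suc q" using assms by (cases p) auto
  let ?E = "\<lambda>a b t. cardinal_bspline q (t - a) * cardinal_bspline q (t - b)"
  let ?B = "cardinal_bspline (2 * q + 1)"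
  have E: "(LBINT t. ?E a b t) = ?B (real q + 1 + (a - b))" for a b
    using integral_cardinal_bspline_shift[of q a q b] by (simp add: mult_2)
  have "(LBINT t. cardinal_deriv p (t - a) * cardinal_deriv p (t - b))
      = (LBINT t. ?E a b t - ?E a (b + 1) t - (?E (a + 1) b t - ?E (a + 1) (b + 1) t))"
    by (simp add: cardinal_deriv_def q algebra_simps)
  also have "\<dots> = (LBINT t. ?E a b t) - (LBINT t. ?E a (b + 1) t) - ((LBINT t. ?E (a + 1) b t) - (LBINT t. ?E (a + 1) (b + 1) t))"
    by (simp add: integrable_cardinal_bspline_mult)
  also have "\<dots> = 2 * ?B (real p + (a - b)) - ?B (real p + (a - b) - 1) - ?B (real p + (a - b) + 1)"
    unfolding E using q by (simp add: algebra_simps)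
  also have "\<dots> = - (deriv ^^ 2) (cardinal_bspline (2 * p + 1)) (real p + 1 + (a - b))"
  proof -
    have "2 * p + 1 = Suc (Suc (Suc (2 * q)))" using q by auto
    then show ?thesis by (simp only: deriv2_cardinal_bspline) (simp add: algebra_simps)
  qed
  finally show ?thesis .
qed

text \<open>The four univariate factors of the tensor products; naming them lets size, band
  structure and interior values be treated uniformly in all blocks.\<close>

datatype kind = Mass | Adv | AdvT | Stiff

fun kind_entry :: "nat \<Rightarrow> nat \<Rightarrow> kind \<Rightarrow> nat \<Rightarrow> nat \<Rightarrow> real" where
  "kind_entry p n Mass i j = real n * mass_mat p n $$ (i, j)"
| "kind_entry p n Adv i j = adv_mat p n $$ (i, j)"
| "kind_entry p n AdvT i j = adv_mat p n $$ (j, i)"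
| "kind_entry p n Stiff i j = stiff_mat p n $$ (i, j) / real n"

text \<open>The offset \<open>u\<close> is row minus column, hence the opposite sign for the
  transpose. The reference point \<open>p + 1\<close> is the centre of the spline of degree
  \<open>2 * p + 1\<close>.\<close>

fun kind_coeff :: "nat \<Rightarrow> kind \<Rightarrow> int \<Rightarrow> real" where
  "kind_coeff p Mass u = cardinal_bspline (2 * p + 1) (real p + 1 + of_int u)"
| "kind_coeff p Adv u = deriv (cardinal_bspline (2 * p + 1)) (real p + 1 + of_int u)"
| "kind_coeff p AdvT u = deriv (cardinal_bspline (2 * p + 1)) (real p + 1 - of_int u)"
| "kind_coeff p Stiff u = - (deriv ^^ 2) (cardinal_bspline (2 * p + 1)) (real p + 1 + of_int u)"

text \<open>Advection coefficients are odd, so they sum to a sine series with a factor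
  \<open>\<i>\<close>; the transpose has the conjugate.\<close>

fun kind_symbol :: "nat \<Rightarrow> kind \<Rightarrow> real \<Rightarrow> complex" where
  "kind_symbol p Mass \<theta> = of_real (mass_symbol p \<theta>)"
| "kind_symbol p Adv \<theta> = \<i> * of_real (adv_symbol p \<theta>)"
| "kind_symbol p AdvT \<theta> = - \<i> * of_real (adv_symbol p \<theta>)"
| "kind_symbol p Stiff \<theta> = of_real (stiff_symbol p \<theta>)"

lemma mass_mat_index: "i < n + p - 2 \<Longrightarrow> j < n + p - 2 \<Longrightarrow> mass_mat p n $$ (i, j)
    = (LBINT x:{0..1}. bspline p n p (i + 2) x * bspline p n p (j + 2) x)"
  and adv_mat_index: "i < n + p - 2 \<Longrightarrow> j < n + p - 2 \<Longrightarrow> adv_mat p n $$ (i, j)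
    = (LBINT x:{0..1}. bspline p n p (i + 2) x * deriv (bspline p n p (j + 2)) x)"
  and stiff_mat_index: "i < n + p - 2 \<Longrightarrow> j < n + p - 2 \<Longrightarrow> stiff_mat p n $$ (i, j)
    = (LBINT x:{0..1}. deriv (bspline p n p (i + 2)) x * deriv (bspline p n p (j + 2)) x)"
  by (simp_all add: mass_mat_def adv_mat_def stiff_mat_def)

definition kind_bound :: "nat \<Rightarrow> real" where
  "kind_bound p = (real (p + 1) * 2 ^ p)\<^sup>2 * real (p + 1)"

text \<open>Each factor of the integrand is of order \<open>1\<close> or \<open>n\<close> and the
  support has length of order \<open>1 / n\<close>; the scaling in \<open>kind_entry\<close> removes
  the remaining power of \<open>n\<close>.\<close>

lemma abs_kind_entry_le:
  assumes n: "n > 0" and ij: "i < n + p - 2" "j < n + p - 2"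
  shows "\<bar>kind_entry p n \<kappa> i j\<bar> \<le> kind_bound p"
proof -
  define C where "C = real (p + 1) * 2 ^ p"
  define P where "P = real (p + 1)"
  note N = spline_bounded_bspline[OF n, of p, folded C_def]
    and D = spline_bounded_deriv_bspline[OF n, of p, folded C_def]
  have C: "0 \<le> C" "0 \<le> C * real n" by (auto simp: C_def)
  have K: "kind_bound p = C\<^sup>2 * P" by (simp add: kind_bound_def C_def P_def)
  have m: "\<bar>real n * L\<bar> \<le> C\<^sup>2 * P" if "\<bar>L\<bar> \<le> C * C * (P / real n)" for L
  proof -
    have "\<bar>real n * L\<bar> = real n * \<bar>L\<bar>" by (simp add: abs_mult)
    also have "\<dots> \<le> real n * (C * C * (P / real n))" using that by (rule mult_left_mono) simp
    also have "\<dots> = C\<^sup>2 * P" using n by (simp add: power2_eq_square)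
    finally show ?thesis .
  qed
  have a: "\<bar>L\<bar> \<le> C\<^sup>2 * P" if "\<bar>L\<bar> \<le> C * (C * real n) * (P / real n)" for L
    using that n by (simp add: power2_eq_square)
  have s: "\<bar>L / real n\<bar> \<le> C\<^sup>2 * P" if "\<bar>L\<bar> \<le> C * real n * (C * real n) * (P / real n)" for L
  proof -
    have "\<bar>L / real n\<bar> = \<bar>L\<bar> / real n" by simp
    also have "\<dots> \<le> C * real n * (C * real n) * (P / real n) / real n"
      using that by (rule divide_right_mono) simp
    also have "\<dots> = C\<^sup>2 * P" using n by (simp add: power2_eq_square)
    finally show ?thesis .
  qed
  show ?thesis
    unfolding K
  proof (cases \<kappa>)
    case Mass
    show "\<bar>kind_entry p n \<kappa> i j\<bar> \<le> C\<^sup>2 * P"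
      unfolding Mass kind_entry.simps mass_mat_index[OF ij]
      by (rule m, unfold P_def) (rule abs_integral_spline_bounded_le[OF n N N C(1) C(1)])
  next
    case Adv
    show "\<bar>kind_entry p n \<kappa> i j\<bar> \<le> C\<^sup>2 * P"
      unfolding Adv kind_entry.simps adv_mat_index[OF ij]
      by (rule a, unfold P_def) (rule abs_integral_spline_bounded_le[OF n N D C])
  next
    case AdvT
    show "\<bar>kind_entry p n \<kappa> i j\<bar> \<le> C\<^sup>2 * P"
      unfolding AdvT kind_entry.simps adv_mat_index[OF ij(2,1)]
      by (rule a, unfold P_def) (rule abs_integral_spline_bounded_le[OF n N D C])
  next
    case Stiff
    show "\<bar>kind_entry p n \<kappa> i j\<bar> \<le> C\<^sup>2 * P"
      unfolding Stiff kind_entry.simps stiff_mat_index[OF ij]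
      by (rule s, unfold P_def) (rule abs_integral_spline_bounded_le[OF n D D C(2) C(2)])
  qed
qed

lemma kind_entry_eq_0:
  assumes n: "n > 0" and ij: "i < n + p - 2" "j < n + p - 2" "\<bar>int i - int j\<bar> > int p"
  shows "kind_entry p n \<kappa> i j = 0"
proof -
  have 1: "\<bar>int (i + 2) - int (j + 2)\<bar> > int p" "\<bar>int (j + 2) - int (i + 2)\<bar> > int p" using ij by auto
  note N = spline_bounded_bspline[OF n, of p] and D = spline_bounded_deriv_bspline[OF n, of p]
  show ?thesis
  proof (cases \<kappa>)
    case Mass
    show ?thesis
      unfolding Mass kind_entry.simps mass_mat_index[OF ij(1,2)]
        integral_eq_0_of_disjoint_support[OF n N N 1(1)] by simp
  next
    case Adv
    show ?thesis
      unfolding Adv kind_entry.simps adv_mat_index[OF ij(1,2)]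
      by (rule integral_eq_0_of_disjoint_support[OF n N D 1(1)])
  next
    case AdvT
    show ?thesis
      unfolding AdvT kind_entry.simps adv_mat_index[OF ij(2,1)]
      by (rule integral_eq_0_of_disjoint_support[OF n N D 1(2)])
  next
    case Stiff
    show ?thesis
      unfolding Stiff kind_entry.simps stiff_mat_index[OF ij(1,2)]
        integral_eq_0_of_disjoint_support[OF n D D 1(1)] by simp
  qed
qed

text \<open>Matrix index \<open>i\<close> means B-spline \<open>i + 2\<close>, so
  \<open>p - 1 \<le> i\<close> and \<open>i + 2 \<le> n\<close> single out the splines on simple
  knots; such a spline is shifted by \<open>i + 1 - p\<close>.\<close>

lemma kind_entry_interior:
  assumes p: "p \<ge> 1" and i: "p - 1 \<le> i" "i + 2 \<le> n" and j: "p - 1 \<le> j" "j + 2 \<le> n"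
  shows "kind_entry p n \<kappa> i j = kind_coeff p \<kappa> (int i - int j)"
proof -
  have n: "n > 0" and ij: "i < n + p - 2" "j < n + p - 2" using p i j by auto
  have N: "bspline p n p (l + 2) x = 1 * cardinal_bspline p (real n * x - real (l + 1 - p))"
    if "p - 1 \<le> l" "l + 2 \<le> n" for l x
    using bspline_eq_cardinal_bspline[OF n, of p "l + 2" p x] that by simp
  have D: "deriv (bspline p n p (l + 2)) x = real n * cardinal_deriv p (real n * x - real (l + 1 - p))"
    if "real n * x \<notin> \<int>" "p - 1 \<le> l" "l + 2 \<le> n" for l x
    using deriv_bspline_eq_cardinal_deriv[OF n, of p "l + 2" x] that p by simp
  have z: "cardinal_bspline p t = 0" "cardinal_deriv p t = 0" if "t < 0 \<or> real p + 1 \<le> t" for t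
    using cardinal_bspline_eq_0 cardinal_deriv_eq_0[OF p] that by blast+
  have a: "i + 1 - p + p + 1 \<le> n" "j + 1 - p + p + 1 \<le> n" using i j p by auto
  have ab: "real (i + 1 - p) - real (j + 1 - p) = of_int (int i - int j)"
    "real (j + 1 - p) - real (i + 1 - p) = - of_int (int i - int j)" using i j p by (auto simp: of_nat_diff)
  have M: "mass_mat p n $$ (i, j) = 1 * 1 / real n *
      (LBINT t. cardinal_bspline p (t - real (i + 1 - p)) * cardinal_bspline p (t - real (j + 1 - p)))"
    unfolding mass_mat_index[OF ij]
    by (rule integral_interior_spline[OF n _ _ _ a(1)], (rule N[OF i]), (rule N[OF j]), (rule z(1)))
  have A: "adv_mat p n $$ (i, j) = 1 * real n / real n *
      (LBINT t. cardinal_bspline p (t - real (i + 1 - p)) * cardinal_deriv p (t - real (j + 1 - p)))"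
    unfolding adv_mat_index[OF ij]
    by (rule integral_interior_spline[OF n _ _ _ a(1)], (rule N[OF i]), (rule D[OF _ j], assumption), (rule z(1)))
  have T: "adv_mat p n $$ (j, i) = 1 * real n / real n *
      (LBINT t. cardinal_bspline p (t - real (j + 1 - p)) * cardinal_deriv p (t - real (i + 1 - p)))"
    unfolding adv_mat_index[OF ij(2,1)]
    by (rule integral_interior_spline[OF n _ _ _ a(2)], (rule N[OF j]), (rule D[OF _ i], assumption), (rule z(1)))
  have S: "stiff_mat p n $$ (i, j) = real n * real n / real n *
      (LBINT t. cardinal_deriv p (t - real (i + 1 - p)) * cardinal_deriv p (t - real (j + 1 - p)))"
    unfolding stiff_mat_index[OF ij]
    by (rule integral_interior_spline[OF n _ _ _ a(1)], (rule D[OF _ i], assumption), (rule D[OF _ j], assumption), (rule z(2)))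
  have cancel: "real n * (1 * 1 / real n * X) = X" "1 * real n / real n * X = X"
    "real n * real n / real n * X / real n = X" for X
    using n by simp_all
  show ?thesis
  proof (cases \<kappa>)
    case Mass
    have "p + p + 1 = 2 * p + 1" by simp
    then show ?thesis
      by (simp only: Mass kind_entry.simps M integral_cardinal_bspline_shift ab cancel kind_coeff.simps)
  next
    case Adv
    show ?thesis
      by (simp only: Adv kind_entry.simps A integral_cardinal_bspline_mult_deriv[OF p] ab cancel kind_coeff.simps)
  next
    case AdvT
    show ?thesis
      by (simp only: AdvT kind_entry.simps T integral_cardinal_bspline_mult_deriv[OF p] ab cancel kind_coeff.simps
          add_uminus_conv_diff)
  next
    case Stiff
    show ?thesis
      by (simp only: Stiff kind_entry.simps S integral_cardinal_deriv_mult[OF p] ab cancel kind_coeff.simps)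
  qed
qed

section \<open>The curl-div matrix as a sum of tensor products\<close>

lemma sum_symmetric_interval:
  fixes g :: "int \<Rightarrow> 'a::comm_monoid_add"
  shows "(\<Sum>u\<in>{- int p..int p}. g u) = g 0 + (\<Sum>k = 1..p. g (int k) + g (- int k))"
proof (induction p)
  case (Suc p)
  have "{- int (Suc p)..int (Suc p)} = insert (int (Suc p)) (insert (- int (Suc p)) {- int p..int p})"
    by auto
  then have "(\<Sum>u\<in>{- int (Suc p)..int (Suc p)}. g u)
      = g (int (Suc p)) + (g (- int (Suc p)) + (\<Sum>u\<in>{- int p..int p}. g u))" by simp
  then show ?case using Suc by (simp add: ac_simps)
qed simp

lemma fourier_sum_even:
  assumes "\<And>u. c (- u) = c u"
  shows "(\<Sum>u\<in>{- int p..int p}. of_real (c u) * cis (of_int u * \<theta>))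
    = of_real (c 0 + 2 * (\<Sum>k = 1..p. c (- int k) * cos (real k * \<theta>)))"
proof -
  have "of_real (c (int k)) * cis (of_int (int k) * \<theta>) + of_real (c (- int k)) * cis (of_int (- int k) * \<theta>)
      = of_real (2 * (c (- int k) * cos (real k * \<theta>)))" for k
    by (simp add: assms complex_eq_iff)
  then show ?thesis
    unfolding sum_symmetric_interval sum_distrib_left by simp
qed

lemma fourier_sum_odd:
  assumes "\<And>u. c (- u) = - c u"
  shows "(\<Sum>u\<in>{- int p..int p}. of_real (c u) * cis (of_int u * \<theta>))
    = \<i> * of_real (- 2 * (\<Sum>k = 1..p. c (- int k) * sin (real k * \<theta>)))"
proof -
  have "c 0 = 0" using assms[of 0] by simp
  moreover have "of_real (c (int k)) * cis (of_int (int k) * \<theta>) + of_real (c (- int k)) * cis (of_int (- int k) * \<theta>)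
      = \<i> * of_real (- 2 * (c (- int k) * sin (real k * \<theta>)))" for k
    by (simp add: assms complex_eq_iff)
  ultimately show ?thesis
    unfolding sum_symmetric_interval sum_distrib_left of_real_sum by simp
qed

text \<open>The spline of degree \<open>2 * p + 1\<close> is symmetric about \<open>p + 1\<close>,
  and each derivative changes the parity.\<close>

lemma kind_coeff_parity:
  assumes "p \<ge> 1"
  shows "kind_coeff p Mass (- u) = kind_coeff p Mass u"
    and "kind_coeff p Adv (- u) = - kind_coeff p Adv u"
    and "kind_coeff p Stiff (- u) = kind_coeff p Stiff u"
proof -
  obtain q where q: "p = Suc q" using assms by (cases p) auto
  have refl: "cardinal_bspline (Suc m) x = cardinal_bspline (Suc m) y" if "x + y = real m + 2" for m x y
    using cardinal_bspline_reflect[of m y] that by (metis add_diff_cancel_right')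
  have eqs: "2 * p + 1 = Suc (2 * p)" "2 * p + 1 = Suc (Suc (2 * q + 1))" "2 * p + 1 = Suc (Suc (Suc (2 * q)))"
    using q by auto
  show "kind_coeff p Mass (- u) = kind_coeff p Mass u"
    unfolding kind_coeff.simps eqs(1) by (rule refl) simp
  have 1: "cardinal_bspline (Suc (2 * q + 1)) (real p + 1 + of_int (- u)) = cardinal_bspline (Suc (2 * q + 1)) (real p + 1 + of_int u - 1)"
    "cardinal_bspline (Suc (2 * q + 1)) (real p + 1 + of_int (- u) - 1) = cardinal_bspline (Suc (2 * q + 1)) (real p + 1 + of_int u)"
    by (rule refl, simp add: q)+
  show "kind_coeff p Adv (- u) = - kind_coeff p Adv u"
    unfolding kind_coeff.simps eqs(2) deriv_cardinal_bspline 1 by simp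
  have 2: "cardinal_bspline (Suc (2 * q)) (real p + 1 + of_int (- u)) = cardinal_bspline (Suc (2 * q)) (real p + 1 + of_int u - 2)"
    "cardinal_bspline (Suc (2 * q)) (real p + 1 + of_int (- u) - 1) = cardinal_bspline (Suc (2 * q)) (real p + 1 + of_int u - 1)"
    "cardinal_bspline (Suc (2 * q)) (real p + 1 + of_int (- u) - 2) = cardinal_bspline (Suc (2 * q)) (real p + 1 + of_int u)"
    by (rule refl, simp add: q)+
  show "kind_coeff p Stiff (- u) = kind_coeff p Stiff u"
    unfolding kind_coeff.simps eqs(3) deriv2_cardinal_bspline 2 by simp
qed

lemma kind_symbol_eq_fourier_sum:
  assumes p: "p \<ge> 1"
  shows "kind_symbol p \<kappa> \<theta> = (\<Sum>u\<in>{- int p..int p}. of_real (kind_coeff p \<kappa> u) * cis (of_int u * \<theta>))"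
proof -
  note par = kind_coeff_parity[OF p]
  have Adv: "kind_symbol p Adv \<theta> = (\<Sum>u\<in>{- int p..int p}. of_real (kind_coeff p Adv u) * cis (of_int u * \<theta>))"
    unfolding fourier_sum_odd[of "kind_coeff p Adv", OF par(2)]
    by (simp add: adv_symbol_def del: funpow.simps)
  show ?thesis
  proof (cases \<kappa>)
    case Mass
    show ?thesis
      unfolding Mass fourier_sum_even[of "kind_coeff p Mass", OF par(1)] by (simp add: mass_symbol_def)
  next
    case Adv
    then show ?thesis using \<open>kind_symbol p Adv \<theta> = _\<close> by simp
  next
    case AdvT
    have "kind_coeff p AdvT u = - kind_coeff p Adv u" for u
      using par(2)[of u] by simp
    then have "(\<Sum>u\<in>{- int p..int p}. of_real (kind_coeff p AdvT u) * cis (of_int u * \<theta>)) = - kind_symbol p Adv \<theta>"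
      unfolding Adv by (simp only: of_real_minus mult_minus_left sum_negf)
    then show ?thesis using AdvT by simp
  next
    case Stiff
    show ?thesis
      unfolding Stiff fourier_sum_even[of "kind_coeff p Stiff", OF par(3)]
      by (simp add: stiff_symbol_def sum_negf)
  qed
qed

text \<open>The entries of \<open>kind_entry\<close> are scaled to be of order 1. The weights \<open>\<gamma>\<close> and \<open>\<delta>\<close> compensate these
  scalings together with the factor \<open>n\<close> in front of the curl-div matrix.\<close>

definition curl_div_terms :: "real \<Rightarrow> real \<Rightarrow> real \<Rightarrow> real \<Rightarrow> real \<Rightarrow> nat \<Rightarrow> nat \<Rightarrow>
    (real \<times> kind \<times> kind \<times> kind) list" where
  "curl_div_terms \<alpha> \<beta> \<nu>1 \<nu>2 \<nu>3 a b =
    (let \<gamma>1 = \<nu>1\<^sup>2 / (\<nu>1 * \<nu>2 * \<nu>3); \<gamma>2 = \<nu>2\<^sup>2 / (\<nu>1 * \<nu>2 * \<nu>3); \<gamma>3 = \<nu>3\<^sup>2 / (\<nu>1 * \<nu>2 * \<nu>3);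
         \<delta>1 = 1 / \<nu>1; \<delta>2 = 1 / \<nu>2; \<delta>3 = 1 / \<nu>3
     in [[[(\<alpha> * \<gamma>3, Mass, Mass, Stiff), (\<alpha> * \<gamma>2, Mass, Stiff, Mass), (\<beta> * \<gamma>1, Stiff, Mass, Mass)],
          [(- \<alpha> * \<delta>3, AdvT, Adv, Mass), (\<beta> * \<delta>3, Adv, AdvT, Mass)],
          [(- \<alpha> * \<delta>2, AdvT, Mass, Adv), (\<beta> * \<delta>2, Adv, Mass, AdvT)]],
         [[(- \<alpha> * \<delta>3, Adv, AdvT, Mass), (\<beta> * \<delta>3, AdvT, Adv, Mass)],
          [(\<alpha> * \<gamma>1, Stiff, Mass, Mass), (\<alpha> * \<gamma>3, Mass, Mass, Stiff), (\<beta> * \<gamma>2, Mass, Stiff, Mass)],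
          [(- \<alpha> * \<delta>1, Mass, AdvT, Adv), (\<beta> * \<delta>1, Mass, Adv, AdvT)]],
         [[(- \<alpha> * \<delta>2, Adv, Mass, AdvT), (\<beta> * \<delta>2, AdvT, Mass, Adv)],
          [(- \<alpha> * \<delta>1, Mass, Adv, AdvT), (\<beta> * \<delta>1, Mass, AdvT, Adv)],
          [(\<alpha> * \<gamma>1, Stiff, Mass, Mass), (\<alpha> * \<gamma>2, Mass, Stiff, Mass), (\<beta> * \<gamma>3, Mass, Mass, Stiff)]]]
        ! a ! b)"

text \<open>The type is left open so that the same list of terms evaluates to real entries, real
  Toeplitz coefficients and complex symbols.\<close>

definition tensor_sum :: "(real \<times> kind \<times> kind \<times> kind) list \<Rightarrow>
    (kind \<Rightarrow> 'a) \<Rightarrow> (kind \<Rightarrow> 'a) \<Rightarrow> (kind \<Rightarrow> 'a) \<Rightarrow> 'a::real_algebra_1" where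
  "tensor_sum ts e1 e2 e3 = (\<Sum>(w, \<kappa>1, \<kappa>2, \<kappa>3)\<leftarrow>ts. of_real w * e1 \<kappa>1 * e2 \<kappa>2 * e3 \<kappa>3)"

lemma tensor_sum_simps [simp]:
  "tensor_sum [] e1 e2 e3 = 0"
  "tensor_sum ((w, \<kappa>1, \<kappa>2, \<kappa>3) # ts) e1 e2 e3 = of_real w * e1 \<kappa>1 * e2 \<kappa>2 * e3 \<kappa>3 + tensor_sum ts e1 e2 e3"
  by (simp_all add: tensor_sum_def)

text \<open>Yields the band structure: an offset outside the box leaves the band in some coordinate,
  where all kinds vanish.\<close>

lemma tensor_sum_eq_0:
  assumes "(\<forall>\<kappa>. e1 \<kappa> = 0) \<or> (\<forall>\<kappa>. e2 \<kappa> = 0) \<or> (\<forall>\<kappa>. e3 \<kappa> = 0)"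
  shows "tensor_sum ts e1 e2 e3 = 0"
  using assms by (induction ts) auto

lemma of_real_tensor_sum:
  "complex_of_real (tensor_sum ts e1 e2 e3)
    = tensor_sum ts (\<lambda>\<kappa>. of_real (e1 \<kappa>)) (\<lambda>\<kappa>. of_real (e2 \<kappa>)) (\<lambda>\<kappa>. of_real (e3 \<kappa>))"
  by (induction ts) auto

lemma abs_tensor_sum_le:
  fixes e1 e2 e3 :: "kind \<Rightarrow> real"
  assumes "\<And>\<kappa>. \<bar>e1 \<kappa>\<bar> \<le> K" "\<And>\<kappa>. \<bar>e2 \<kappa>\<bar> \<le> K" "\<And>\<kappa>. \<bar>e3 \<kappa>\<bar> \<le> K"
  shows "\<bar>tensor_sum ts e1 e2 e3\<bar> \<le> (\<Sum>t\<leftarrow>ts. \<bar>fst t\<bar> * K ^ 3)"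
proof (induction ts)
  case (Cons t ts)
  obtain w \<kappa>1 \<kappa>2 \<kappa>3 where t: "t = (w, \<kappa>1, \<kappa>2, \<kappa>3)" by (cases t)
  have K: "0 \<le> K" using assms(1)[of Mass] by linarith
  have "\<bar>w * e1 \<kappa>1 * e2 \<kappa>2 * e3 \<kappa>3\<bar> \<le> \<bar>w\<bar> * K * K * K"
    unfolding abs_mult using K by (intro mult_mono assms) auto
  also have "\<dots> = \<bar>w\<bar> * K ^ 3" by (simp add: power3_eq_cube)
  finally have "\<bar>w * e1 \<kappa>1 * e2 \<kappa>2 * e3 \<kappa>3\<bar> \<le> \<bar>w\<bar> * K ^ 3" .
  then show ?case
    using Cons abs_triangle_ineq[of "w * e1 \<kappa>1 * e2 \<kappa>2 * e3 \<kappa>3" "tensor_sum ts e1 e2 e3"]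
    by (simp add: t)
qed simp

lemma tensor_sum_fourier:
  "(\<Sum>(u1, u2, u3)\<in>offset_box p. tensor_sum ts (\<lambda>\<kappa>. c1 \<kappa> u1) (\<lambda>\<kappa>. c2 \<kappa> u2) (\<lambda>\<kappa>. c3 \<kappa> u3)
      * fourier_char (u1, u2, u3) (\<theta>1, \<theta>2, \<theta>3))
    = tensor_sum ts (\<lambda>\<kappa>. \<Sum>u\<in>{- int p..int p}. c1 \<kappa> u * cis (of_int u * \<theta>1))
      (\<lambda>\<kappa>. \<Sum>u\<in>{- int p..int p}. c2 \<kappa> u * cis (of_int u * \<theta>2))
      (\<lambda>\<kappa>. \<Sum>u\<in>{- int p..int p}. c3 \<kappa> u * cis (of_int u * \<theta>3))"
proof (induction ts)
  case Nil
  then show ?case by simp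
next
  case (Cons t ts)
  let ?U = "{- int p..int p}"
  obtain w \<kappa>1 \<kappa>2 \<kappa>3 where t: "t = (w, \<kappa>1, \<kappa>2, \<kappa>3)" by (cases t)
  have "(\<Sum>(u1, u2, u3)\<in>offset_box p. of_real w * c1 \<kappa>1 u1 * c2 \<kappa>2 u2 * c3 \<kappa>3 u3
        * fourier_char (u1, u2, u3) (\<theta>1, \<theta>2, \<theta>3))
      = (\<Sum>u1\<in>?U. \<Sum>u2\<in>?U. \<Sum>u3\<in>?U. of_real w * ((c1 \<kappa>1 u1 * cis (of_int u1 * \<theta>1))
        * ((c2 \<kappa>2 u2 * cis (of_int u2 * \<theta>2)) * (c3 \<kappa>3 u3 * cis (of_int u3 * \<theta>3)))))"
    by (simp add: offset_box_def sum.cartesian_product fourier_char_def mult_ac)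
  also have "\<dots> = of_real w * (\<Sum>u\<in>?U. c1 \<kappa>1 u * cis (of_int u * \<theta>1))
      * (\<Sum>u\<in>?U. c2 \<kappa>2 u * cis (of_int u * \<theta>2)) * (\<Sum>u\<in>?U. c3 \<kappa>3 u * cis (of_int u * \<theta>3))"
  proof -
    have "(\<Sum>u1\<in>?U. \<Sum>u2\<in>?U. \<Sum>u3\<in>?U. v * (f u1 * (g u2 * h u3))) = v * sum f ?U * sum g ?U * sum h ?U"
      for v :: complex and f g h
      by (simp only: sum_distrib_left[symmetric] sum_distrib_right[symmetric] mult.assoc)
    then show ?thesis .
  qed
  finally show ?case
    using Cons by (simp add: t distrib_right sum.distrib split_beta)
qed

section \<open>Kronecker products and the blocks of the curl-div matrix\<close>

lemma dim_kron [simp]: "dim_row (A \<otimes>\<^sub>K B) = dim_row A * dim_row B" "dim_col (A \<otimes>\<^sub>K B) = dim_col A * dim_col B"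
  by (simp_all add: kron_def)

lemma kron3_index:
  assumes A: "A \<in> carrier_mat d1 d1" and B: "B \<in> carrier_mat d2 d2" and C: "C \<in> carrier_mat d3 d3"
    and kl: "k < d1 * d2 * d3" "l < d1 * d2 * d3"
  shows "(A \<otimes>\<^sub>K B \<otimes>\<^sub>K C) $$ (k, l) = A $$ (k div d3 div d2, l div d3 div d2)
    * B $$ (k div d3 mod d2, l div d3 mod d2) * C $$ (k mod d3, l mod d3)"
proof -
  have AB: "dim_row (A \<otimes>\<^sub>K B) = d1 * d2" "dim_col (A \<otimes>\<^sub>K B) = d1 * d2" using A B by auto
  have C': "dim_row C = d3" "dim_col C = d3" using C by auto
  have "k div d3 < d1 * d2" "l div d3 < d1 * d2" using kl by (auto intro: less_mult_imp_div_less)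
  then have "(A \<otimes>\<^sub>K B) $$ (k div d3, l div d3)
      = A $$ (k div d3 div d2, l div d3 div d2) * B $$ (k div d3 mod d2, l div d3 mod d2)"
    using A B by (simp add: kron_def)
  moreover have "(A \<otimes>\<^sub>K B \<otimes>\<^sub>K C) $$ (k, l) = (A \<otimes>\<^sub>K B) $$ (k div d3, l div d3) * C $$ (k mod d3, l mod d3)"
    using kl unfolding kron_def[of "A \<otimes>\<^sub>K B"] AB C' by simp
  ultimately show ?thesis by simp
qed

lemma uni_mat_carrier [simp]:
  "mass_mat p n \<in> carrier_mat (n + p - 2) (n + p - 2)" "adv_mat p n \<in> carrier_mat (n + p - 2) (n + p - 2)"
  "stiff_mat p n \<in> carrier_mat (n + p - 2) (n + p - 2)"
  by (simp_all add: mass_mat_def adv_mat_def stiff_mat_def)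

lemma curl_div_mat_dim:
  "dim_row (curl_div_mat p \<alpha> \<beta> (n1, n2, n3)) = 3 * ((n1 + p - 2) * (n2 + p - 2) * (n3 + p - 2))"
  "dim_col (curl_div_mat p \<alpha> \<beta> (n1, n2, n3)) = 3 * ((n1 + p - 2) * (n2 + p - 2) * (n3 + p - 2))"
  by (simp_all add: curl_div_mat_def block3_mat_def Let_def)

lemma curl_div_mat_index:
  fixes n1 n2 n3 p :: nat
  defines "d1 \<equiv> n1 + p - 2" and "d2 \<equiv> n2 + p - 2" and "d3 \<equiv> n3 + p - 2"
  assumes \<nu>: "\<nu>1 > 0" "\<nu>2 > 0" "\<nu>3 > 0" and n: "n > 0"
    and n_eq: "real n1 = n * \<nu>1" "real n2 = n * \<nu>2" "real n3 = n * \<nu>3"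
    and ij: "i < 3 * (d1 * d2 * d3)" "j < 3 * (d1 * d2 * d3)"
  defines "k \<equiv> i mod (d1 * d2 * d3)" and "l \<equiv> j mod (d1 * d2 * d3)"
  shows "n * curl_div_mat p \<alpha> \<beta> (n1, n2, n3) $$ (i, j)
    = tensor_sum (curl_div_terms \<alpha> \<beta> \<nu>1 \<nu>2 \<nu>3 (i div (d1 * d2 * d3)) (j div (d1 * d2 * d3)))
        (\<lambda>\<kappa>. kind_entry p n1 \<kappa> (k div d3 div d2) (l div d3 div d2))
        (\<lambda>\<kappa>. kind_entry p n2 \<kappa> (k div d3 mod d2) (l div d3 mod d2))
        (\<lambda>\<kappa>. kind_entry p n3 \<kappa> (k mod d3) (l mod d3))"
proof -
  let ?d = "d1 * d2 * d3"
  define a where "a = i div ?d"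
  define b where "b = j div ?d"
  have d: "0 < ?d" using ij by (metis mult_is_0 neq0_conv not_less_zero)
  then have pos: "0 < d1" "0 < d2" "0 < d3" by auto
  have kl: "k < ?d" "l < ?d" using d by (simp_all add: k_def l_def)
  have "a < 3" "b < 3" using ij unfolding a_def b_def by (auto intro: less_mult_imp_div_less)
  then have ab: "a = 0 \<or> a = 1 \<or> a = 2" "b = 0 \<or> b = 1 \<or> b = 2" by auto
  have lt: "k div d3 div d2 < d1" "l div d3 div d2 < d1" "k div d3 mod d2 < d2" "l div d3 mod d2 < d2"
    "k mod d3 < d3" "l mod d3 < d3"
    using kl pos by (auto intro!: less_mult_imp_div_less)
  define M1 where "M1 = mass_mat p n1" define M2 where "M2 = mass_mat p n2" define M3 where "M3 = mass_mat p n3"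
  define A1 where "A1 = adv_mat p n1" define A2 where "A2 = adv_mat p n2" define A3 where "A3 = adv_mat p n3"
  define S1 where "S1 = stiff_mat p n1" define S2 where "S2 = stiff_mat p n2" define S3 where "S3 = stiff_mat p n3"
  have carr: "M1 \<in> carrier_mat d1 d1" "M2 \<in> carrier_mat d2 d2" "M3 \<in> carrier_mat d3 d3"
    "A1 \<in> carrier_mat d1 d1" "A2 \<in> carrier_mat d2 d2" "A3 \<in> carrier_mat d3 d3"
    "S1 \<in> carrier_mat d1 d1" "S2 \<in> carrier_mat d2 d2" "S3 \<in> carrier_mat d3 d3"
    by (simp_all add: M1_def M2_def M3_def A1_def A2_def A3_def S1_def S2_def S3_def d1_def d2_def d3_def)
  have carrT: "transpose_mat A1 \<in> carrier_mat d1 d1" "transpose_mat A2 \<in> carrier_mat d2 d2"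
    "transpose_mat A3 \<in> carrier_mat d3 d3" using carr by auto
  have dims: "dim_row X = d" "dim_col X = d" if "X \<in> carrier_mat d d" for X :: "real mat" and d using that by auto
  note dims' = carr[THEN dims(1)] carr[THEN dims(2)] carrT[THEN dims(1)] carrT[THEN dims(2)]
  have T: "transpose_mat A1 $$ (k div d3 div d2, l div d3 div d2) = A1 $$ (l div d3 div d2, k div d3 div d2)"
    "transpose_mat A2 $$ (k div d3 mod d2, l div d3 mod d2) = A2 $$ (l div d3 mod d2, k div d3 mod d2)"
    "transpose_mat A3 $$ (k mod d3, l mod d3) = A3 $$ (l mod d3, k mod d3)"
    using lt dims' by simp_all
  note kron = kron3_index[OF _ _ _ kl]
  define \<gamma>1 where "\<gamma>1 = \<nu>1\<^sup>2 / (\<nu>1 * \<nu>2 * \<nu>3)"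
  define \<gamma>2 where "\<gamma>2 = \<nu>2\<^sup>2 / (\<nu>1 * \<nu>2 * \<nu>3)"
  define \<gamma>3 where "\<gamma>3 = \<nu>3\<^sup>2 / (\<nu>1 * \<nu>2 * \<nu>3)"
  define \<delta>1 where "\<delta>1 = 1 / \<nu>1"
  define \<delta>2 where "\<delta>2 = 1 / \<nu>2"
  define \<delta>3 where "\<delta>3 = 1 / \<nu>3"
  note weights = \<gamma>1_def \<gamma>2_def \<gamma>3_def \<delta>1_def \<delta>2_def \<delta>3_def
  \<comment> \<open>Two mass scalings stand against one stiffness scaling in the first three
    identities, and a single mass scaling appears in the others; the weights reduce what remains to
    one factor \<open>n\<close>.\<close>
  have w: "c * \<gamma>1 * x * (real n2 * y) * (real n3 * z) / real n1 = n * (c * (x * y * z))"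
    "c * \<gamma>2 * (real n1 * x) * y * (real n3 * z) / real n2 = n * (c * (x * y * z))"
    "c * \<gamma>3 * (real n1 * x) * (real n2 * y) * z / real n3 = n * (c * (x * y * z))"
    "c * \<delta>1 * (real n1 * x) * y * z = n * (c * (x * y * z))"
    "c * \<delta>2 * x * (real n2 * y) * z = n * (c * (x * y * z))"
    "c * \<delta>3 * x * y * (real n3 * z) = n * (c * (x * y * z))" for c x y z :: real
    unfolding n_eq weights using \<nu> n by (simp_all add: power2_eq_square)
  note ke = kind_entry.simps M1_def[symmetric] M2_def[symmetric] M3_def[symmetric] A1_def[symmetric]
    A2_def[symmetric] A3_def[symmetric] S1_def[symmetric] S2_def[symmetric] S3_def[symmetric]
  show ?thesis
    unfolding curl_div_mat_def curl_div_terms_def Let_def prod.case block3_mat_def ke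
      d1_def[symmetric] d2_def[symmetric] d3_def[symmetric] a_def[symmetric] b_def[symmetric]
      weights[symmetric]
    using ab
    by (elim disjE) (simp_all add: ij a_def[symmetric] b_def[symmetric] k_def[symmetric] l_def[symmetric]
      kl dims' kron carr carrT T w ke distrib_left right_diff_distrib)
qed

section \<open>The spectral distribution of the curl-div matrices\<close>

lemma kind_entry_transpose:
  assumes "i < n + p - 2" "j < n + p - 2"
  shows "kind_entry p n Mass j i = kind_entry p n Mass i j" "kind_entry p n Stiff j i = kind_entry p n Stiff i j"
    "kind_entry p n Adv j i = kind_entry p n AdvT i j" "kind_entry p n AdvT j i = kind_entry p n Adv i j"
  using assms by (simp_all add: mass_mat_index stiff_mat_index mult.commute)

text \<open>Transposition exchanges \<open>Adv\<close> and \<open>AdvT\<close>, and the lists of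
  opposite blocks differ by exactly this exchange.\<close>

lemma curl_div_terms_transpose:
  fixes e1 e2 e3 e1' e2' e3' :: "kind \<Rightarrow> real"
  assumes ab: "a < 3" "b < 3"
    and e1: "e1' Mass = e1 Mass" "e1' Stiff = e1 Stiff" "e1' Adv = e1 AdvT" "e1' AdvT = e1 Adv"
    and e2: "e2' Mass = e2 Mass" "e2' Stiff = e2 Stiff" "e2' Adv = e2 AdvT" "e2' AdvT = e2 Adv"
    and e3: "e3' Mass = e3 Mass" "e3' Stiff = e3 Stiff" "e3' Adv = e3 AdvT" "e3' AdvT = e3 Adv"
  shows "tensor_sum (curl_div_terms \<alpha> \<beta> \<nu>1 \<nu>2 \<nu>3 b a) e1' e2' e3'
    = tensor_sum (curl_div_terms \<alpha> \<beta> \<nu>1 \<nu>2 \<nu>3 a b) e1 e2 e3"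
proof -
  have "a = 0 \<or> a = 1 \<or> a = 2" "b = 0 \<or> b = 1 \<or> b = 2" using ab by auto
  then show ?thesis
    by (elim disjE) (simp_all add: curl_div_terms_def Let_def e1 e2 e3)
qed

lemma curl_div_symbol_carrier: "curl_div_symbol p \<alpha> \<beta> \<nu> \<theta> \<in> carrier_mat 3 3"
  by (cases \<nu>; cases \<theta>) (auto simp: curl_div_symbol_def Let_def mat_of_rows_list_def intro!: carrier_matI)

text \<open>Off the diagonal the factors \<open>\<i>\<close> and \<open>- \<i>\<close> multiply to
  \<open>1\<close>, so each term is real and the coefficients add up to
  \<open>\<beta> - \<alpha>\<close> times the weight.\<close>

lemma curl_div_symbol_index:
  assumes ab: "a < 3" "b < 3"
  shows "curl_div_symbol p \<alpha> \<beta> (\<nu>1, \<nu>2, \<nu>3) (\<theta>1, \<theta>2, \<theta>3) $$ (a, b)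
    = tensor_sum (curl_div_terms \<alpha> \<beta> \<nu>1 \<nu>2 \<nu>3 a b)
        (\<lambda>\<kappa>. kind_symbol p \<kappa> \<theta>1) (\<lambda>\<kappa>. kind_symbol p \<kappa> \<theta>2) (\<lambda>\<kappa>. kind_symbol p \<kappa> \<theta>3)"
proof -
  define m where "m = mass_symbol p"
  define s where "s = stiff_symbol p"
  define d where "d = adv_symbol p"
  note sym = m_def[symmetric] s_def[symmetric] d_def[symmetric]
  define \<gamma>1 where "\<gamma>1 = \<nu>1\<^sup>2 / (\<nu>1 * \<nu>2 * \<nu>3)"
  define \<gamma>2 where "\<gamma>2 = \<nu>2\<^sup>2 / (\<nu>1 * \<nu>2 * \<nu>3)"
  define \<gamma>3 where "\<gamma>3 = \<nu>3\<^sup>2 / (\<nu>1 * \<nu>2 * \<nu>3)"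
  define \<delta>1 where "\<delta>1 = 1 / \<nu>1"
  define \<delta>2 where "\<delta>2 = 1 / \<nu>2"
  define \<delta>3 where "\<delta>3 = 1 / \<nu>3"
  note weights = \<gamma>1_def \<gamma>2_def \<gamma>3_def \<delta>1_def \<delta>2_def \<delta>3_def
  have "a = 0 \<or> a = 1 \<or> a = 2" "b = 0 \<or> b = 1 \<or> b = 2" using ab by auto
  then show ?thesis
    unfolding curl_div_symbol_def curl_div_terms_def Let_def prod.case weights[symmetric] sym
    by (elim disjE) (simp_all add: mat_of_rows_list_def sym complex_eq_iff algebra_simps)
qed

lemma hermitian_curl_div_symbol: "hermitian_mat (curl_div_symbol p \<alpha> \<beta> \<nu> \<theta>)"
proof -
  obtain \<nu>1 \<nu>2 \<nu>3 where \<nu>: "\<nu> = (\<nu>1, \<nu>2, \<nu>3)" by (cases \<nu>)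
  obtain \<theta>1 \<theta>2 \<theta>3 where \<theta>: "\<theta> = (\<theta>1, \<theta>2, \<theta>3)" by (cases \<theta>)
  define x where "x = curl_div_symbol p \<alpha> \<beta> (\<nu>1, \<nu>2, \<nu>3) (\<theta>1, \<theta>2, \<theta>3)"
  have sym: "x $$ (j, i) = cnj (x $$ (i, j))" if "i < 3" "j < 3" for i j
  proof -
    have "i = 0 \<or> i = 1 \<or> i = 2" "j = 0 \<or> j = 1 \<or> j = 2" using that by auto
    then show ?thesis
      unfolding x_def curl_div_symbol_def Let_def prod.case
      by (elim disjE) (simp_all add: mat_of_rows_list_def)
  qed
  have x: "x \<in> carrier_mat 3 3" unfolding x_def by (rule curl_div_symbol_carrier)
  then have dim: "dim_row x = 3" and "square_mat x" by auto
  then show ?thesis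
    unfolding \<nu> \<theta> x_def[symmetric] hermitian_mat_def dim using sym by blast
qed

definition curl_div_coeff :: "nat \<Rightarrow> real \<Rightarrow> real \<Rightarrow> real \<Rightarrow> real \<Rightarrow> real \<Rightarrow>
    nat \<Rightarrow> nat \<Rightarrow> int \<times> int \<times> int \<Rightarrow> complex" where
  "curl_div_coeff p \<alpha> \<beta> \<nu>1 \<nu>2 \<nu>3 a b = (\<lambda>(u1, u2, u3). of_real (tensor_sum (curl_div_terms \<alpha> \<beta> \<nu>1 \<nu>2 \<nu>3 a b)
     (\<lambda>\<kappa>. kind_coeff p \<kappa> u1) (\<lambda>\<kappa>. kind_coeff p \<kappa> u2) (\<lambda>\<kappa>. kind_coeff p \<kappa> u3)))"

lemma block_symbol_curl_div:
  assumes p: "p \<ge> 1"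
  shows "block_symbol 3 p (curl_div_coeff p \<alpha> \<beta> \<nu>1 \<nu>2 \<nu>3) (curl_div_symbol p \<alpha> \<beta> (\<nu>1, \<nu>2, \<nu>3))"
proof
  fix \<theta> :: "real \<times> real \<times> real" and a b :: nat
  assume ab: "a < 3" "b < 3"
  obtain \<theta>1 \<theta>2 \<theta>3 where \<theta>: "\<theta> = (\<theta>1, \<theta>2, \<theta>3)" by (cases \<theta>)
  show "curl_div_symbol p \<alpha> \<beta> (\<nu>1, \<nu>2, \<nu>3) \<theta> $$ (a, b)
      = (\<Sum>u\<in>offset_box p. curl_div_coeff p \<alpha> \<beta> \<nu>1 \<nu>2 \<nu>3 a b u * fourier_char u \<theta>)"
    unfolding \<theta> curl_div_symbol_index[OF ab] kind_symbol_eq_fourier_sum[OF p] tensor_sum_fourier[symmetric]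
    by (intro sum.cong refl) (auto simp: curl_div_coeff_def of_real_tensor_sum)
qed (rule curl_div_symbol_carrier)

definition curl_div_bound :: "nat \<Rightarrow> real \<Rightarrow> real \<Rightarrow> real \<Rightarrow> real \<Rightarrow> real \<Rightarrow> real" where
  "curl_div_bound p \<alpha> \<beta> \<nu>1 \<nu>2 \<nu>3 =
    (\<Sum>a<3. \<Sum>b<3. \<Sum>t\<leftarrow>curl_div_terms \<alpha> \<beta> \<nu>1 \<nu>2 \<nu>3 a b. \<bar>fst t\<bar> * kind_bound p ^ 3)"

lemma block_toeplitz_like_curl_div:
  fixes p n1 n2 n3 :: nat and n \<alpha> \<beta> \<nu>1 \<nu>2 \<nu>3 :: real
  assumes p: "p \<ge> 1" and \<nu>: "\<nu>1 > 0" "\<nu>2 > 0" "\<nu>3 > 0" and n: "n > 0"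
    and n_eq: "real n1 = n * \<nu>1" "real n2 = n * \<nu>2" "real n3 = n * \<nu>3"
  defines "B \<equiv> map_mat complex_of_real (n \<cdot>\<^sub>m curl_div_mat p \<alpha> \<beta> (n1, n2, n3))"
  shows "block_toeplitz_like 3 p (2 * p) (curl_div_bound p \<alpha> \<beta> \<nu>1 \<nu>2 \<nu>3) (curl_div_coeff p \<alpha> \<beta> \<nu>1 \<nu>2 \<nu>3)
      (n1 + p - 2) (n2 + p - 2) (n3 + p - 2) B" (is ?toeplitz)
    and "hermitian_mat B" (is ?herm)
proof -
  define d1 d2 d3 where d_def: "d1 = n1 + p - 2" "d2 = n2 + p - 2" "d3 = n3 + p - 2"
  let ?d = "d1 * d2 * d3"
  let ?b = "blk d1 d2 d3" and ?p = "pos d1 d2 d3"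
  let ?t = "curl_div_terms \<alpha> \<beta> \<nu>1 \<nu>2 \<nu>3"
  have B_carr: "B \<in> carrier_mat (3 * ?d) (3 * ?d)"
    unfolding B_def d_def by (auto simp: curl_div_mat_dim)
  define x1 where "x1 i = i mod ?d div d3 div d2" for i
  define x2 where "x2 i = i mod ?d div d3 mod d2" for i
  define x3 where "x3 i = i mod ?d mod d3" for i
  have pos: "?p i = (int (x1 i), int (x2 i), int (x3 i))" for i
    by (simp add: pos_def x1_def x2_def x3_def Let_def)
  have lt: "x1 i < d1" "x2 i < d2" "x3 i < d3" if "i < 3 * ?d" for i
    using pos_in_grid[OF that] by (auto simp: pos deep_grid_def)
  have n_pos: "n1 > 0" "n2 > 0" "n3 > 0" using \<nu> n n_eq by (auto intro!: gr0I)
  define e where "e i j = tensor_sum (?t (?b i) (?b j)) (\<lambda>\<kappa>. kind_entry p n1 \<kappa> (x1 i) (x1 j))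
    (\<lambda>\<kappa>. kind_entry p n2 \<kappa> (x2 i) (x2 j)) (\<lambda>\<kappa>. kind_entry p n3 \<kappa> (x3 i) (x3 j))" for i j
  have B_index: "B $$ (i, j) = of_real (e i j)" if "i < 3 * ?d" "j < 3 * ?d" for i j
  proof -
    have "B $$ (i, j) = of_real (n * curl_div_mat p \<alpha> \<beta> (n1, n2, n3) $$ (i, j))"
      using that unfolding B_def d_def by (simp add: curl_div_mat_dim)
    also have "n * curl_div_mat p \<alpha> \<beta> (n1, n2, n3) $$ (i, j) = e i j"
      using curl_div_mat_index[OF \<nu> n n_eq, of i p j \<alpha> \<beta>] that
      unfolding e_def blk_def x1_def x2_def x3_def d_def by blast
    finally show ?thesis .
  qed
  show ?herm
    unfolding hermitian_mat_def
  proof (intro conjI allI impI)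
    show "square_mat B" using B_carr by auto
    fix i j assume "i < dim_row B" "j < dim_row B"
    then have ij: "i < 3 * ?d" "j < 3 * ?d" using B_carr by auto
    note l = lt[OF ij(1)] lt[OF ij(2)]
    have "e j i = e i j"
      unfolding e_def
      by (rule curl_div_terms_transpose[OF blk_less[OF ij(1)] blk_less[OF ij(2)]];
          rule kind_entry_transpose; fact l[unfolded d_def])
    then show "B $$ (j, i) = cnj (B $$ (i, j))" using ij by (simp add: B_index)
  qed
  show ?toeplitz
    unfolding block_toeplitz_like_def d_def[symmetric]
  proof (intro conjI allI impI)
    show "B \<in> carrier_mat (3 * ?d) (3 * ?d)" by (rule B_carr)
    fix i j assume ij: "i < 3 * ?d" "j < 3 * ?d"
    note l = lt[OF ij(1)] lt[OF ij(2)]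
    note ld = l[unfolded d_def]
    have "\<bar>e i j\<bar> \<le> (\<Sum>t\<leftarrow>?t (?b i) (?b j). \<bar>fst t\<bar> * kind_bound p ^ 3)"
      unfolding e_def using ld n_pos by (intro abs_tensor_sum_le abs_kind_entry_le)
    also have "\<dots> \<le> (\<Sum>b<3. \<Sum>t\<leftarrow>?t (?b i) b. \<bar>fst t\<bar> * kind_bound p ^ 3)"
      by (rule member_le_sum)
        (auto simp: blk_less[OF ij(2)] kind_bound_def intro!: sum_list_nonneg)
    also have "\<dots> \<le> curl_div_bound p \<alpha> \<beta> \<nu>1 \<nu>2 \<nu>3"
      unfolding curl_div_bound_def
      by (rule member_le_sum)
        (auto simp: blk_less[OF ij(1)] kind_bound_def intro!: sum_list_nonneg sum_nonneg)
    finally show "norm (B $$ (i, j)) \<le> curl_div_bound p \<alpha> \<beta> \<nu>1 \<nu>2 \<nu>3"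
      using ij by (simp add: B_index)
    show "B $$ (i, j) = 0" if "?p i - ?p j \<notin> offset_box p"
    proof -
      have "\<bar>int (x1 i) - int (x1 j)\<bar> > int p \<or> \<bar>int (x2 i) - int (x2 j)\<bar> > int p \<or> \<bar>int (x3 i) - int (x3 j)\<bar> > int p"
        using that by (auto simp: pos offset_box_def)
      then have "e i j = 0"
        unfolding e_def
        using kind_entry_eq_0[OF n_pos(1) ld(1,4)] kind_entry_eq_0[OF n_pos(2) ld(2,5)]
          kind_entry_eq_0[OF n_pos(3) ld(3,6)]
        by (intro tensor_sum_eq_0) blast
      then show ?thesis using ij by (simp add: B_index)
    qed
    show "B $$ (i, j) = curl_div_coeff p \<alpha> \<beta> \<nu>1 \<nu>2 \<nu>3 (?b i) (?b j) (?p i - ?p j)"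
      if box: "?p i - ?p j \<in> offset_box p" and deep: "?p j \<in> deep_grid d1 d2 d3 (2 * p)"
    proof -
      \<comment> \<open>At depth \<open>2 * p\<close> the column is interior, and so is a row at
        offset at most \<open>p\<close>.\<close>
      have int: "kind_entry p n \<kappa> x y = kind_coeff p \<kappa> (int x - int y)"
        if "int x - int y \<in> {- int p..int p}" "int y \<in> {int (2 * p)..<int (n + p - 2) - int (2 * p)}"
        for n x y \<kappa>
        using that p by (intro kind_entry_interior) auto
      have u: "int (x1 i) - int (x1 j) \<in> {- int p..int p}" "int (x2 i) - int (x2 j) \<in> {- int p..int p}"
        "int (x3 i) - int (x3 j) \<in> {- int p..int p}"
        using box by (simp_all add: pos offset_box_def)
      have y: "int (x1 j) \<in> {int (2 * p)..<int d1 - int (2 * p)}" "int (x2 j) \<in> {int (2 * p)..<int d2 - int (2 * p)}"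
        "int (x3 j) \<in> {int (2 * p)..<int d3 - int (2 * p)}"
        using deep by (simp_all add: pos deep_grid_def)
      have "e i j = tensor_sum (?t (?b i) (?b j)) (\<lambda>\<kappa>. kind_coeff p \<kappa> (int (x1 i) - int (x1 j)))
        (\<lambda>\<kappa>. kind_coeff p \<kappa> (int (x2 i) - int (x2 j))) (\<lambda>\<kappa>. kind_coeff p \<kappa> (int (x3 i) - int (x3 j)))"
        unfolding e_def int[OF u(1) y(1)[unfolded d_def]] int[OF u(2) y(2)[unfolded d_def]]
          int[OF u(3) y(3)[unfolded d_def]] by (rule refl)
      then show ?thesis using ij by (simp add: B_index curl_div_coeff_def pos)
    qed
  qed
qed

text \<open>Proved along all \<open>n\<close>, with the floor in place of \<open>n * \<nu>\<close>;
  passing to a finer filter preserves the limit.\<close>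

lemma filterlim_grid_dim:
  fixes \<nu> :: real
  assumes "\<nu> > 0"
  shows "filterlim (\<lambda>n. nat \<lfloor>real n * \<nu>\<rfloor> + p - 2) at_top sequentially"
  unfolding filterlim_at_top
proof
  fix Z :: nat
  have "filterlim (\<lambda>n. real n * \<nu>) at_top sequentially"
    using assms by (intro filterlim_at_top_mult_tendsto_pos[OF tendsto_const _ filterlim_real_sequentially])
  then have "\<forall>\<^sub>F n in sequentially. real (Z + 2) \<le> real n * \<nu>"
    by (simp add: filterlim_at_top)
  then show "\<forall>\<^sub>F n in sequentially. Z \<le> nat \<lfloor>real n * \<nu>\<rfloor> + p - 2"
  proof eventually_elim
    case (elim n)
    then have "int (Z + 2) \<le> \<lfloor>real n * \<nu>\<rfloor>" by (simp add: le_floor_iff)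
    then show ?case by linarith
  qed
qed

theorem theorem5p5:
  fixes p :: nat and \<alpha> \<beta> \<nu>1 \<nu>2 \<nu>3 :: real
  assumes "p \<ge> 1"
    and "\<nu>1 \<in> \<rat>" "\<nu>2 \<in> \<rat>" "\<nu>3 \<in> \<rat>"
    and "\<nu>1 > 0" "\<nu>2 > 0" "\<nu>3 > 0"
  shows "spectral_distribution
    (inf sequentially (principal {n. real n * \<nu>1 \<in> \<nat> \<and> real n * \<nu>2 \<in> \<nat> \<and> real n * \<nu>3 \<in> \<nat>}))
    (\<lambda>n. map_mat complex_of_real
       (real n \<cdot>\<^sub>m curl_div_mat p \<alpha> \<beta>
          (nat \<lfloor>real n * \<nu>1\<rfloor>, nat \<lfloor>real n * \<nu>2\<rfloor>, nat \<lfloor>real n * \<nu>3\<rfloor>)))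
    3 (curl_div_symbol p \<alpha> \<beta> (\<nu>1, \<nu>2, \<nu>3)) ({-pi..pi} \<times> {-pi..pi} \<times> {-pi..pi})"
    (is "spectral_distribution ?\<F> ?B 3 ?f ?G")
proof -
  interpret block_symbol 3 p "curl_div_coeff p \<alpha> \<beta> \<nu>1 \<nu>2 \<nu>3" ?f
    by (rule block_symbol_curl_div) fact
  have cube: "?G = theta_cube" by (simp add: cbox_Pair_eq)
  \<comment> \<open>Along the restricted filter the products are natural numbers, so the floor is
    exact.\<close>
  have floor: "real (nat \<lfloor>real n * \<nu>\<rfloor>) = real n * \<nu>" if "real n * \<nu> \<in> \<nat>" for n \<nu>
    using that by (auto elim!: Nats_cases)
  \<comment> \<open>The index \<open>n = 0\<close> meets the integrality conditions, so positivity
    is available only eventually.\<close>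
  have ev: "\<forall>\<^sub>F n in ?\<F>. (real n * \<nu>1 \<in> \<nat> \<and> real n * \<nu>2 \<in> \<nat> \<and> real n * \<nu>3 \<in> \<nat>) \<and> 0 < n"
    unfolding eventually_inf_principal
    using eventually_gt_at_top[of "0::nat"] by eventually_elim auto
  note \<F> = inf_le1[of sequentially "principal {n. real n * \<nu>1 \<in> \<nat> \<and> real n * \<nu>2 \<in> \<nat> \<and> real n * \<nu>3 \<in> \<nat>}"]
  show ?thesis
    unfolding cube
  proof (rule spectral_distribution_block_toeplitz_like[where q = "2 * p"])
    show "filterlim (\<lambda>n. nat \<lfloor>real n * \<nu>1\<rfloor> + p - 2) at_top ?\<F>"
      "filterlim (\<lambda>n. nat \<lfloor>real n * \<nu>2\<rfloor> + p - 2) at_top ?\<F>"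
      "filterlim (\<lambda>n. nat \<lfloor>real n * \<nu>3\<rfloor> + p - 2) at_top ?\<F>"
      using assms by (auto intro!: filterlim_mono[OF filterlim_grid_dim order_refl \<F>])
    show "hermitian_mat (?f \<theta>)" for \<theta> by (rule hermitian_curl_div_symbol)
    show "\<forall>\<^sub>F n in ?\<F>. hermitian_mat (?B n)"
      using ev
    proof eventually_elim
      case (elim n)
      then show ?case
        by (intro block_toeplitz_like_curl_div(2)[of p \<nu>1 \<nu>2 \<nu>3] assms(1,5-7) floor) auto
    qed
    show "\<forall>\<^sub>F n in ?\<F>. block_toeplitz_like 3 p (2 * p) (curl_div_bound p \<alpha> \<beta> \<nu>1 \<nu>2 \<nu>3)
        (curl_div_coeff p \<alpha> \<beta> \<nu>1 \<nu>2 \<nu>3) (nat \<lfloor>real n * \<nu>1\<rfloor> + p - 2) (nat \<lfloor>real n * \<nu>2\<rfloor> + p - 2)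
        (nat \<lfloor>real n * \<nu>3\<rfloor> + p - 2) (?B n)"
      using ev
    proof eventually_elim
      case (elim n)
      then show ?case by (intro block_toeplitz_like_curl_div(1) assms(1,5-7) floor) auto
    qed
  qed simp_all
qed

end
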